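(* There exist positive universal constants $C$ and $C'=(4C)^{-1}$ such that for all $\alpha\in\mathbb{R}$, $N\ge1$ and normalized $\Psi\in\mathcal{D}_{\alpha,0}$, $$\langle\Psi,\hat T_\alpha\Psi\rangle\ge C(j_{\alpha_N}')^2\int_{\mathbb{R}^2}\varrho_\Psi(\mathbf{x})^2\,d\mathbf{x},$$ and, for every external potential $V:\mathbb{R}^2\to\mathbb{R}$ acting by $\hat V(\mathrm{x})=\sum_{j=1}^NV(\mathbf{x}_j)$, $$\langle\Psi,(\hat T_\alpha+\hat V)\Psi\rangle\ge-C'(j_{\alpha_N}')^{-2}\int_{\mathbb{R}^2}V_-(\mathbf{x})^2\,d\mathbf{x},$$ where $V_-=\max\{-V,0\}$.
   Context: Ideal anyons ($R=0$): $\mathbf{x}^\perp=(-y,x)$; $D_j=-i\nabla_{\mathbf{x}_j}+\alpha\sum_{k\neq j}(\mathbf{x}_j-\mathbf{x}_k)^\perp/|\mathbf{x}_j-\mathbf{x}_k|^2$ on $(\mathbb{R}^2)^N$. $\mathcal{D}_{\alpha,0}$ is the closure of $C_c^\infty(\mathbb{R}^{2N}\setminus\triangle)\cap L^2_{\mathrm{sym}}(\mathbb{R}^{2N})$ in the norm $(\|\Psi\|^2+\sum_j\|D_j\Psi\|^2)^{1/2}$, $\triangle$ the set where some $\mathbf{x}_j=\mathbf{x}_k$, $j\neq k$; $\langle\Psi,\hat T_\alpha\Psi\rangle:=\sum_{j=1}^N\int|D_j\Psi|^2$. One-body density: $\varrho_\Psi(\mathbf{x})=\sum_{j=1}^N\int_{\mathbb{R}^{2(N-1)}}|\Psi(\mathbf{x}_1,\dots,\mathbf{x}_{j-1},\mathbf{x},\mathbf{x}_{j+1},\dots,\mathbf{x}_N)|^2\prod_{k\ne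 j}d\mathbf{x}_k$. $\alpha_N:=\min_{p\in\{0,\dots,N-2\}}\min_{q\in\mathbb{Z}}|(2p+1)\alpha-2q|$. $j_\nu'$ is the first positive zero of $J_\nu'$ ($J_\nu$ the Bessel function), $j_0':=0$. *)

theory Defs
  imports "HOL-Analysis.Analysis" "HOL-Probability.Probability"
begin

text \<open>A configuration (x_1,...,x_N) is represented as an extensional function
 nat => real^2 with x k = undefined for k >= N (particles indexed 0..N-1).
 The Lebesgue measure on (R^2)^N is the product measure.\<close>

definition cfg :: "nat \<Rightarrow> (nat \<Rightarrow> real^2) set" where
  "cfg N = PiE {..<N} (\<lambda>_. UNIV)"

definition cfgM :: "nat \<Rightarrow> (nat \<Rightarrow> real^2) measure" where
  "cfgM N = PiM {..<N} (\<lambda>_. lborel)"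

definition diag :: "nat \<Rightarrow> (nat \<Rightarrow> real^2) set" where
  "diag N = {x \<in> cfg N. \<exists>j<N. \<exists>k<N. j \<noteq> k \<and> x j = x k}"

definition pdiff :: "nat \<Rightarrow> 2 \<Rightarrow> ((nat \<Rightarrow> real^2) \<Rightarrow> complex) \<Rightarrow> (nat \<Rightarrow> real^2) \<Rightarrow> complex" where
  "pdiff j c f x = vector_derivative (\<lambda>t. f (x(j := x j + t *\<^sub>R axis c 1))) (at 0)"

coinductive smooth_cfg :: "nat \<Rightarrow> ((nat \<Rightarrow> real^2) \<Rightarrow> complex) \<Rightarrow> bool" for N where
  "continuous_on (cfg N) f \<Longrightarrow>
   (\<forall>j<N. \<forall>c. \<forall>x\<in>cfg N. (\<lambda>t. f (x(j := x j + t *\<^sub>R axis c 1))) differentiable (at 0)) \<Longrightarrow>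
   (\<forall>j<N. \<forall>c. smooth_cfg N (pdiff j c f)) \<Longrightarrow> smooth_cfg N f"

definition test_sym :: "nat \<Rightarrow> ((nat \<Rightarrow> real^2) \<Rightarrow> complex) set" where
  "test_sym N = {f. smooth_cfg N f \<and>
     (\<exists>K. compact K \<and> K \<subseteq> cfg N \<and> K \<inter> diag N = {} \<and> (\<forall>x\<in>cfg N - K. f x = 0)) \<and>
     (\<forall>\<sigma>. \<sigma> permutes {..<N} \<longrightarrow> (\<forall>x\<in>cfg N. f (x \<circ> \<sigma>) = f x))}"

definition perp :: "real^2 \<Rightarrow> real^2" where
  "perp v = vector [- (v$2), v$1]"

definition Apot :: "nat \<Rightarrow> nat \<Rightarrow> (nat \<Rightarrow> real^2) \<Rightarrow> real^2" where
  "Apot N j x = (\<Sum>k\<in>{..<N} - {j}. (1 / (norm (x j - x k))\<^sup>2) *\<^sub>R perp (x j - x k))"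

definition Dop :: "real \<Rightarrow> nat \<Rightarrow> nat \<Rightarrow> 2 \<Rightarrow> ((nat \<Rightarrow> real^2) \<Rightarrow> complex) \<Rightarrow> (nat \<Rightarrow> real^2) \<Rightarrow> complex" where
  "Dop \<alpha> N j c f x = - \<i> * pdiff j c f x + complex_of_real (\<alpha> * (Apot N j x $ c)) * f x"

definition rho :: "nat \<Rightarrow> ((nat \<Rightarrow> real^2) \<Rightarrow> complex) \<Rightarrow> real^2 \<Rightarrow> ennreal" where
  "rho N \<Psi> x = (\<Sum>j<N. \<integral>\<^sup>+ y. ennreal ((cmod (\<Psi> (y(j := x))))\<^sup>2)
                    \<partial>(PiM ({..<N} - {j}) (\<lambda>_. lborel)))"

definition BesselJ :: "real \<Rightarrow> real \<Rightarrow> real" where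
  "BesselJ \<nu> x = (x / 2) powr \<nu> *
     (\<Sum>m. (-1) ^ m / (fact m * Gamma (real m + \<nu> + 1)) * (x / 2) ^ (2 * m))"

definition jprime :: "real \<Rightarrow> real" where
  "jprime \<nu> = (if \<nu> = 0 then 0 else Inf {x. x > 0 \<and> deriv (BesselJ \<nu>) x = 0})"

text \<open>alpha_N; for N = 1 (empty minimum) we use the convention alpha_1 = 1.\<close>
definition alphaN :: "real \<Rightarrow> nat \<Rightarrow> real" where
  "alphaN \<alpha> N = (if N < 2 then 1 else
     Min ((\<lambda>p. INF q::int. \<bar>(2 * real p + 1) * \<alpha> - 2 * of_int q\<bar>) ` {0..N-2}))"

end

theory Submission
  imports Defs
begin

text \<open>
  Let \<open>m\<close> and \<open>T\<close> be the mass and the kinetic energy in a square \<open>Q\<close> of side \<open>L\<close>. Two local estimates hold.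

  Uncertainty: the integral of \<open>\<rho>\<^sup>2\<close> over \<open>Q\<close> is at most \<open>9 (m\<^sup>2 / L\<^sup>2 + m T)\<close>. The vector potential is real, so
  \<open>|\<partial>|\<Psi>|\<^sup>2| \<le> 2 |\<Psi>| |D \<Psi>|\<close>, and one integrates this along coordinate lines.

  Exclusion: \<open>\<alpha>\<^sub>N (m - \<parallel>\<Psi>\<parallel>\<^sup>2)\<close> is at most a constant times \<open>L\<^sup>2 T\<close>. Rotating two particles by a half turn about
  their centre exchanges them, and parallel transport along this path, which encloses \<open>p\<close> other particles,
  produces the phase \<open>exp (i \<pi> (2 p + 1) \<alpha>)\<close>. As \<open>\<Psi>\<close> is symmetric, the angular energy of the pair at distance \<open>r\<close>
  is bounded below by a constant times \<open>\<alpha>\<^sub>N\<^sup>2 |\<Psi>|\<^sup>2 / r\<^sup>2\<close>. Its product with the radial energy controls \<open>|\<Psi>|\<^sup>2\<close> linearly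
  in \<open>\<alpha>\<^sub>N\<close>.

  Repeatedly halving a large square and combining both estimates bounds \<open>\<alpha>\<^sub>N\<close> times the integral of \<open>\<rho>\<^sup>2\<close> by the energy.
  Finally, the power series of \<open>J\<^sub>\<nu>'\<close> changes sign before \<open>x = 2 sqrt \<nu>\<close>, so \<open>(j\<^sub>\<nu>')\<^sup>2 \<le> 4 \<nu>\<close>.
\<close>

section \<open>Integration in the plane\<close>

text \<open>The exclusion bound has to be linear in \<open>alphaN\<close>, since the square of
  \<open>jprime \<nu>\<close> is of order \<open>\<nu>\<close> for small \<open>\<nu>\<close>. The
  angular (Hardy) inequality alone is quadratic; the gain comes from test functions vanishing at
  coincidences, which lets radial integration start from zero. Half turns about the centre of a pair
  need not stay in a square. Exclusion is therefore shown for pairs in its middle third and carried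
  over by contraction towards the centre; the error contains half of the mass, which is finite and
  can be absorbed. Test functions are treated with arbitrary norm, since approximants of a
  normalised state need not be normalised. The potential is singular, so integrals take values in
  the extended nonnegative reals, and Cauchy-Schwarz appears as Young's inequality with a tuned
  parameter. The constant is \<open>1 / (24000 * 120 * 54 * 4)\<close>: 24000 stems from exclusion,
  120 and 54 from the covering, 4 from the Bessel bound.\<close>

lemma ennreal_norm_diff_le_nn_integral:
  fixes v :: "real \<Rightarrow> 'b::euclidean_space"
  assumes "a \<le> b"
    and d: "\<And>t. t \<in> {a..b} \<Longrightarrow> (v has_vector_derivative v' t) (at t)"
    and c: "continuous_on {a..b} v'"
    and g: "\<And>t. t \<in> {a..b} \<Longrightarrow> norm (v' t) \<le> g t"
  shows "ennreal (norm (v b - v a)) \<le> (\<integral>\<^sup>+t. ennreal (g t) * indicator {a..b} t \<partial>lborel)"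
proof -
  have 1: "(v' has_integral (v b - v a)) {a..b}"
    by (rule fundamental_theorem_of_calculus[OF \<open>a \<le> b\<close>])
       (auto intro!: has_vector_derivative_at_within d)
  have c2: "continuous_on {a..b} (\<lambda>t. norm (v' t))"
    using c by (intro continuous_intros)
  have 2: "(\<lambda>t. norm (v' t)) integrable_on {a..b}"
    by (rule integrable_continuous_interval[OF c2])
  have "norm (v b - v a) \<le> integral {a..b} (\<lambda>t. norm (v' t))"
    using integral_norm_bound_integral[of v' "{a..b}" "\<lambda>t. norm (v' t)"] 1 2
    by (metis has_integral_integrable integral_unique order_refl)
  also have "ennreal \<dots> = (\<integral>\<^sup>+t. ennreal (indicator {a..b} t * norm (v' t)) \<partial>lborel)"
  proof -
    have "set_integrable lborel {a..b} (\<lambda>t. norm (v' t))"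
      by (rule borel_integrable_atLeastAtMost'[OF c2])
    then have I: "integrable lborel (\<lambda>t. indicator {a..b} t * norm (v' t))"
      and e: "integral {a..b} (\<lambda>t. norm (v' t)) = (\<integral>t. indicator {a..b} t * norm (v' t) \<partial>lborel)"
      using set_borel_integral_eq_integral(2)[of "{a..b}" "\<lambda>t. norm (v' t)"]
      by (auto simp: set_integrable_def set_lebesgue_integral_def)
    show ?thesis unfolding e
      by (rule nn_integral_eq_integral[symmetric, OF I]) auto
  qed
  \<comment> \<open>\<open>g\<close> is only a pointwise majorant and need be neither continuous nor
    integrable: in the applications it contains the square root of an energy density that is
    singular where particles meet.\<close>
  also have "\<dots> \<le> (\<integral>\<^sup>+t. ennreal (g t) * indicator {a..b} t \<partial>lborel)"
    by (rule nn_integral_mono) (auto split: split_indicator intro!: ennreal_leI g)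
  finally show ?thesis by (simp add: ennreal_leI)
qed

lemma has_vector_derivative_cmod_sq:
  fixes g :: "real \<Rightarrow> complex"
  assumes "(g has_vector_derivative g') (at t)"
  shows "((\<lambda>t. (cmod (g t))\<^sup>2) has_vector_derivative 2 * Re (cnj (g t) * g')) (at t)"
proof -
  have W: "(cmod z)\<^sup>2 = Re z * Re z + Im z * Im z" for z
    unfolding cmod_power2 by (simp add: power2_eq_square)
  note r = bounded_linear.has_vector_derivative[OF bounded_linear_Re assms, folded has_real_derivative_iff_has_vector_derivative]
  note i = bounded_linear.has_vector_derivative[OF bounded_linear_Im assms, folded has_real_derivative_iff_has_vector_derivative]
  show ?thesis unfolding W
    using DERIV_add[OF DERIV_mult[OF r r] DERIV_mult[OF i i]]
    unfolding has_real_derivative_iff_has_vector_derivative by (simp add: algebra_simps)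
qed

lemma nn_integral_lborel_affine:
  fixes t :: "'a::euclidean_space"
  assumes [measurable]: "g \<in> borel_measurable borel" and "c > 0"
  shows "(\<integral>\<^sup>+x. g x \<partial>lborel) = ennreal (c ^ DIM('a)) * (\<integral>\<^sup>+x. g (t + c *\<^sub>R x) \<partial>lborel)"
proof -
  have "(\<integral>\<^sup>+x. g x \<partial>lborel) = (\<integral>\<^sup>+x. g x \<partial>density (distr lborel borel (\<lambda>x. t + c *\<^sub>R x)) (\<lambda>_. \<bar>c\<bar>^DIM('a)))"
    using lborel_affine[of c t] \<open>c > 0\<close> by simp
  also have "\<dots> = (\<integral>\<^sup>+x. ennreal (c ^ DIM('a)) * g (t + c *\<^sub>R x) \<partial>lborel)"
    using \<open>c > 0\<close> by (simp add: nn_integral_density nn_integral_distr)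
  finally show ?thesis by (simp add: nn_integral_cmult)
qed

lemma nn_integral_lborel_translate:
  fixes t :: "'a::euclidean_space"
  assumes [measurable]: "g \<in> borel_measurable borel"
  shows "(\<integral>\<^sup>+x. g (t + x) \<partial>lborel) = (\<integral>\<^sup>+x. g x \<partial>lborel)"
  using nn_integral_lborel_affine[of g 1 t] by simp

lemma borel_measurable_perp [measurable]: "perp \<in> borel_measurable borel"
proof -
  have "linear perp"
    by (rule linearI) (auto simp: perp_def vec_eq_iff forall_2)
  then show ?thesis
    by (intro borel_measurable_continuous_onI linear_continuous_on linear_conv_bounded_linear[THEN iffD1])
qed

definition rot :: "real \<Rightarrow> real^2 \<Rightarrow> real^2" where
  "rot \<theta> r = cos \<theta> *\<^sub>R r + sin \<theta> *\<^sub>R perp r"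

lemma linear_rot: "linear (rot \<theta>)"
  by (rule linearI) (auto simp: rot_def perp_def vec_eq_iff forall_2 algebra_simps)

lemma det_rot: "det (matrix (rot \<theta>)) = 1"
proof -
  have "cos \<theta> * cos \<theta> + sin \<theta> * sin \<theta> = 1"
    using sin_cos_squared_add[of \<theta>] by (simp add: power2_eq_square)
  then show ?thesis
  by (simp add: det_2 matrix_def rot_def perp_def axis_def)
qed

lemma cos_sin_cancel: "cos \<theta> * (cos \<theta> * y) + sin \<theta> * (sin \<theta> * y) = (y::real)"
proof -
  have "cos \<theta> * (cos \<theta> * y) + sin \<theta> * (sin \<theta> * y) = ((sin \<theta>)\<^sup>2 + (cos \<theta>)\<^sup>2) * y"
    by (simp add: power2_eq_square distrib_right mult.assoc)
  then show ?thesis by simp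
qed

lemma rot_rot_minus: "rot \<theta> (rot (-\<theta>) x) = x"
  using cos_sin_cancel[of \<theta> "x$1"] cos_sin_cancel[of \<theta> "x$2"]
  by (simp add: rot_def perp_def vec_eq_iff forall_2 distrib_left right_diff_distrib)

lemma norm_rot [simp]: "norm (rot \<theta> x) = norm x"
proof -
  have "(cos \<theta> * x$1 - sin \<theta> * x$2)\<^sup>2 + (cos \<theta> * x$2 + sin \<theta> * x$1)\<^sup>2
      = ((sin \<theta>)\<^sup>2 + (cos \<theta>)\<^sup>2) * ((x$1)\<^sup>2 + (x$2)\<^sup>2)"
    by algebra
  then show ?thesis
    by (simp add: norm_vec_def L2_set_def sum_2 rot_def perp_def)
qed

lemma borel_measurable_rot [measurable]: "rot \<theta> \<in> borel_measurable borel"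
  unfolding rot_def by measurable

text \<open>The preimage of a box is its image under the inverse rotation, so the determinant
  formula for linear images gives the measure of the box, and values on boxes determine Lebesgue
  measure.\<close>

lemma distr_lborel_rot: "distr lborel borel (rot \<theta>) = lborel"
proof (rule lborel_eqI[symmetric])
  fix l u :: "real^2" assume lu: "\<And>b. b \<in> Basis \<Longrightarrow> l \<bullet> b \<le> u \<bullet> b"
  have v: "rot \<theta> -` box l u = rot (-\<theta>) ` box l u"
    using rot_rot_minus[of \<theta>] rot_rot_minus[of "-\<theta>"] by (auto simp: image_iff) (metis)
  have "emeasure (distr lborel borel (rot \<theta>)) (box l u) = emeasure lborel (rot \<theta> -` box l u)"
    by (simp add: emeasure_distr)
  also have "\<dots> = emeasure lebesgue (rot \<theta> -` box l u)"
    using measurable_sets[OF borel_measurable_rot[of \<theta>] borel_open[OF open_box[of l u]]] by simp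
  also have "\<dots> = emeasure lebesgue (rot (-\<theta>) ` box l u)" by (simp add: v)
  also have "\<dots> = ennreal (measure lebesgue (rot (-\<theta>) ` box l u))"
    by (rule emeasure_eq_measure2) (intro measurable_linear_image linear_rot lmeasurable_box)
  also have "measure lebesgue (rot (-\<theta>) ` box l u) = measure lebesgue (box l u)"
    by (subst measure_linear_image[OF linear_rot]) (auto simp: det_rot)
  finally show "emeasure (distr lborel borel (rot \<theta>)) (box l u) = (\<Prod>b\<in>Basis. (u - l) \<bullet> b)"
    using lu by (simp add: measure_lborel_box_eq)
qed simp

lemma nn_integral_rot:
  assumes [measurable]: "g \<in> borel_measurable borel"
  shows "(\<integral>\<^sup>+x. g (rot \<theta> x) \<partial>lborel) = (\<integral>\<^sup>+x. g x \<partial>lborel)"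
  by (subst (2) distr_lborel_rot[of \<theta>, symmetric]) (simp add: nn_integral_distr)

text \<open>Here \<open>X\<close> is the centre and \<open>r\<close> half the separation, so that a
  half turn moves \<open>r\<close> and fixes \<open>X\<close>. The substitution
  \<open>a = b + 2 r\<close> at fixed \<open>b\<close> costs the factor \<open>2 ^ DIM('a)\<close>;
  the shift \<open>b = X - r\<close> costs nothing.\<close>

lemma nn_integral_lborel_centre_relative:
  fixes g :: "'a::euclidean_space \<Rightarrow> 'a \<Rightarrow> ennreal"
  assumes [measurable]: "(\<lambda>(a,b). g a b) \<in> borel_measurable borel"
  shows "(\<integral>\<^sup>+b. \<integral>\<^sup>+a. g a b \<partial>lborel \<partial>lborel) =
    ennreal (2 ^ DIM('a)) * (\<integral>\<^sup>+X. \<integral>\<^sup>+r. g (X + r) (X - r) \<partial>lborel \<partial>lborel)"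
proof -
  have m [measurable]: "(\<lambda>p. g (h p) (k p)) \<in> borel_measurable M"
    if "h \<in> borel_measurable M" "k \<in> borel_measurable M" for h k and M :: "'c measure"
    using measurable_compose[OF borel_measurable_Pair[OF that] assms] by simp
  have "(\<integral>\<^sup>+b. \<integral>\<^sup>+a. g a b \<partial>lborel \<partial>lborel) = (\<integral>\<^sup>+b. ennreal (2 ^ DIM('a)) * \<integral>\<^sup>+r. g (b + 2 *\<^sub>R r) b \<partial>lborel \<partial>lborel)"
    by (intro nn_integral_cong nn_integral_lborel_affine) auto
  also have "\<dots> = ennreal (2 ^ DIM('a)) * (\<integral>\<^sup>+b. \<integral>\<^sup>+r. g (b + 2 *\<^sub>R r) b \<partial>lborel \<partial>lborel)"
    by (rule nn_integral_cmult) measurable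
  also have "(\<integral>\<^sup>+b. \<integral>\<^sup>+r. g (b + 2 *\<^sub>R r) b \<partial>lborel \<partial>lborel) = (\<integral>\<^sup>+r. \<integral>\<^sup>+b. g (b + 2 *\<^sub>R r) b \<partial>lborel \<partial>lborel)"
    by (rule lborel_pair.Fubini') measurable
  also have "\<dots> = (\<integral>\<^sup>+r. \<integral>\<^sup>+X. g ((- r + X) + 2 *\<^sub>R r) (- r + X) \<partial>lborel \<partial>lborel)"
    by (intro nn_integral_cong nn_integral_lborel_translate[symmetric]) measurable
  also have "\<dots> = (\<integral>\<^sup>+r. \<integral>\<^sup>+X. g (X + r) (X - r) \<partial>lborel \<partial>lborel)"
    by (intro nn_integral_cong arg_cong2[where f=g]) (auto simp: algebra_simps scaleR_2)
  also have "\<dots> = (\<integral>\<^sup>+X. \<integral>\<^sup>+r. g (X + r) (X - r) \<partial>lborel \<partial>lborel)"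
    by (rule lborel_pair.Fubini') measurable
  finally show ?thesis .
qed

text \<open>\<open>real^2\<close> is not a product type, so Fubini along coordinate lines first
  needs this identification.\<close>

lemma distr_lborel_vector2: "distr (lborel \<Otimes>\<^sub>M lborel) borel (\<lambda>(s,t). vector [s, t]) = (lborel :: (real^2) measure)"
proof (rule lborel_eqI[symmetric])
  have m [measurable]: "(\<lambda>(s,t). vector [s, t] :: real^2) \<in> borel_measurable (lborel \<Otimes>\<^sub>M lborel)"
  proof -
    have "(vector [s, t] :: real^2) = s *\<^sub>R axis 1 1 + t *\<^sub>R axis 2 1" for s t
      by (simp add: vec_eq_iff forall_2 axis_def)
    then show ?thesis by simp
  qed
  fix l u :: "real^2" assume lu: "\<And>b. b \<in> Basis \<Longrightarrow> l \<bullet> b \<le> u \<bullet> b"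
  then have lu': "l $ 1 \<le> u $ 1" "l $ 2 \<le> u $ 2" using axis_in_Basis_iff[of _ "1::real"]
    by (metis Basis_real_def axis_in_Basis_iff cart_eq_inner_axis insertI1)+
  have "(\<lambda>(s,t). vector [s, t] :: real^2) -` box l u \<inter> space (lborel \<Otimes>\<^sub>M lborel) = {l$1<..<u$1} \<times> {l$2<..<u$2}"
    by (auto simp: mem_box_cart forall_2 space_pair_measure)
  then show "emeasure (distr (lborel \<Otimes>\<^sub>M lborel) borel (\<lambda>(s,t). vector [s, t] :: real^2)) (box l u) = (\<Prod>b\<in>Basis. (u - l) \<bullet> b)"
    using lu' by (simp add: emeasure_distr lborel.emeasure_pair_measure_Times ennreal_mult[symmetric])
      (simp add: Basis_vec_def  UN_singleton sum_2 UNIV_2 inner_axis axis_eq_axis)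
qed simp

lemma nn_integral_lborel_vector2:
  fixes g :: "real^2 \<Rightarrow> ennreal"
  assumes [measurable]: "g \<in> borel_measurable borel"
  shows "(\<integral>\<^sup>+x. g x \<partial>lborel) = (\<integral>\<^sup>+s. \<integral>\<^sup>+t. g (vector [s, t]) \<partial>lborel \<partial>lborel)"
    "(\<integral>\<^sup>+x. g x \<partial>lborel) = (\<integral>\<^sup>+t. \<integral>\<^sup>+s. g (vector [s, t]) \<partial>lborel \<partial>lborel)"
proof -
  have m [measurable]: "(\<lambda>(s,t). vector [s, t] :: real^2) \<in> borel_measurable (lborel \<Otimes>\<^sub>M lborel)"
  proof -
    have "(vector [s, t] :: real^2) = s *\<^sub>R axis 1 1 + t *\<^sub>R axis 2 1" for s t
      by (simp add: vec_eq_iff forall_2 axis_def)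
    then show ?thesis by simp
  qed
  have "(\<integral>\<^sup>+x. g x \<partial>lborel) = (\<integral>\<^sup>+p. g (case p of (s,t) \<Rightarrow> vector [s,t]) \<partial>(lborel \<Otimes>\<^sub>M lborel))"
    by (subst distr_lborel_vector2[symmetric]) (simp add: nn_integral_distr)
  also have "\<dots> = (\<integral>\<^sup>+s. \<integral>\<^sup>+t. g (vector [s, t]) \<partial>lborel \<partial>lborel)"
    by (subst lborel.nn_integral_fst[symmetric]) auto
  finally show 1: "(\<integral>\<^sup>+x. g x \<partial>lborel) = (\<integral>\<^sup>+s. \<integral>\<^sup>+t. g (vector [s, t]) \<partial>lborel \<partial>lborel)" .
  show "(\<integral>\<^sup>+x. g x \<partial>lborel) = (\<integral>\<^sup>+t. \<integral>\<^sup>+s. g (vector [s, t]) \<partial>lborel \<partial>lborel)"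
    unfolding 1 by (rule lborel_pair.Fubini') (use measurable_compose[OF m assms] in \<open>simp add: case_prod_unfold\<close>)
qed

section \<open>Half turns of a pair\<close>

text \<open>Sine is concave on \<open>[0, pi]\<close>, so up to \<open>pi/2\<close> it lies above
  the chord.\<close>

lemma jordan_sin:
  assumes "0 \<le> y" "y \<le> 1"
  shows "y \<le> sin (pi * y / 2)"
proof -
  have "convex_on {0..pi} (\<lambda>x. - sin x)"
  proof (rule f''_ge0_imp_convex)
    show "((\<lambda>x. - sin x) has_real_derivative - cos x) (at x)" for x by (auto intro!: derivative_eq_intros)
    show "((\<lambda>x. - cos x) has_real_derivative sin x) (at x)" for x by (auto intro!: derivative_eq_intros)
  qed (auto intro: sin_ge_zero)
  from convex_onD[OF this, of y 0 "pi/2"] assms show ?thesis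
    by (simp add: mult.commute)
qed

text \<open>Reduce \<open>\<beta>\<close> modulo 2 to some \<open>y\<close> with
  \<open>|y| <= 1\<close>. The chord of the unit circle has length
  \<open>2 |sin (pi y / 2)|\<close>, which is at least \<open>2 |y|\<close> by Jordan's inequality,
  and \<open>|y|\<close> is the distance of \<open>\<beta>\<close> from an even integer.\<close>

lemma norm_cis_minus_one_ge:
  assumes a: "\<And>q::int. a \<le> \<bar>\<beta> - 2 * of_int q\<bar>"
  shows "2 * a \<le> cmod (cis (pi * \<beta>) - 1)"
proof -
  define q where "q = round (\<beta> / 2)"
  define y where "y = \<beta> - 2 * of_int q"
  have "\<bar>of_int q - \<beta> / 2\<bar> \<le> 1/2" unfolding q_def by (rule of_int_round_abs_le)
  then have y: "\<bar>y\<bar> \<le> 1" unfolding y_def by linarith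
  have "cis (pi * \<beta>) = cis (pi * y) * cis (2 * pi * of_int q)"
    unfolding cis_mult y_def by (simp add: algebra_simps)
  also have "cis (2 * pi * of_int q) = 1"
    by (simp add: complex_eq_iff cos_int_2pin sin_int_2pin)
  finally have c: "cis (pi * \<beta>) = cis (pi * y)" by simp
  have "(cmod (cis (pi * y) - 1))\<^sup>2 = 2 - 2 * cos (pi * y)"
    using sin_cos_squared_add[of "pi * y"]
    unfolding cmod_power2 by (simp add: power2_eq_square algebra_simps)
  also have "\<dots> = (2 * sin (pi * \<bar>y\<bar> / 2))\<^sup>2"
    using cos_double_sin[of "pi * \<bar>y\<bar> / 2"] by (cases "y \<ge> 0") (auto simp: power2_eq_square)
  finally have "cmod (cis (pi * y) - 1) = \<bar>2 * sin (pi * \<bar>y\<bar> / 2)\<bar>"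
    by (metis abs_norm_cancel power2_eq_iff abs_minus_cancel)
  moreover have "\<bar>y\<bar> \<le> sin (pi * \<bar>y\<bar> / 2)" using y by (intro jordan_sin) auto
  moreover have "a \<le> \<bar>y\<bar>" unfolding y_def by (rule a)
  ultimately show ?thesis unfolding c by linarith
qed

text \<open>In this coordinate \<open>perp\<close> is multiplication by the imaginary unit and
  \<open>rot\<close> multiplication by a phase, so the flux through a path becomes the imaginary
  part of a logarithmic derivative.\<close>

definition cplx :: "real^2 \<Rightarrow> complex" where "cplx v = Complex (v$1) (v$2)"

lemma cplx_simps:
  "cplx (u + v) = cplx u + cplx v" "cplx (u - v) = cplx u - cplx v" "cplx (- v) = - cplx v"
  "cplx (perp v) = \<i> * cplx v" "cplx (rot \<theta> v) = cis \<theta> * cplx v"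
  by (auto simp: cplx_def perp_def rot_def complex_eq_iff)

lemma norm_cplx: "cmod (cplx v) = norm v"
  by (simp add: cplx_def cmod_def norm_vec_def L2_set_def sum_2)

lemma cplx_eq_0_iff: "cplx v = 0 \<longleftrightarrow> v = 0"
  using norm_cplx[of v] by (metis norm_eq_zero)

text \<open>The potential \<open>v\<^sup>\<bottom> / |v|\<^sup>2\<close> is the gradient of the argument of \<open>v\<close>.\<close>
lemma inner_perp_eq_Im:
  "u \<bullet> ((1 / (norm v)\<^sup>2) *\<^sub>R perp v) = Im (cplx u / cplx v)"
proof -
  have n: "(norm v)\<^sup>2 = (v$1)\<^sup>2 + (v$2)\<^sup>2"
    unfolding power2_norm_eq_inner by (simp add: inner_vec_def sum_2 power2_eq_square)
  have "u \<bullet> perp v = u$2 * v$1 - u$1 * v$2"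
    by (simp add: perp_def inner_vec_def sum_2)
  then show ?thesis
    unfolding Im_divide inner_scaleR_right n by (simp add: cplx_def)
qed

text \<open>With the centre of the pair as origin, \<open>w\<^sup>2 - (\<zeta> e\<^sup>i\<^sup>\<theta>)\<^sup>2\<close> is the product of the displacements of the antipodal
  points \<open>\<plusminus> \<zeta> e\<^sup>i\<^sup>\<theta>\<close> from \<open>w\<close>; its argument grows by \<open>2 \<pi>\<close> over a half turn exactly if \<open>w\<close> is enclosed.\<close>
lemma half_turn_argument:
  fixes \<zeta> w :: complex
  assumes "cmod w \<noteq> cmod \<zeta>"
  shows "\<exists>\<Lambda>::real \<Rightarrow> real. (\<forall>\<theta>. (\<Lambda> has_real_derivative
      Im (- 2 * \<i> * (\<zeta> * cis \<theta>)\<^sup>2 / (w\<^sup>2 - (\<zeta> * cis \<theta>)\<^sup>2))) (at \<theta>)) \<and>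
    \<Lambda> pi - \<Lambda> 0 = (if cmod w < cmod \<zeta> then 2 * pi else 0)"
proof -
  \<comment> \<open>A positive real part keeps \<open>1 - q * cis t\<close> off the branch cut of
    \<open>Ln\<close>. Its argument is then a smooth periodic function and contributes nothing over
    a full period.\<close>
  have Re: "1 - q * cis t \<notin> \<real>\<^sub>\<le>\<^sub>0" if "cmod q < 1" for q t
  proof -
    have "Re (q * cis t) \<le> cmod (q * cis t)" by (rule complex_Re_le_cmod)
    with that have "Re (1 - q * cis t) > 0" by (simp add: norm_mult)
    then show ?thesis by (auto simp: complex_nonpos_Reals_iff)
  qed
  have D: "((\<lambda>\<theta>. Im (Ln (1 - q * cis (k * \<theta>)))) has_real_derivative
      Im (- q * (\<i> * k) * cis (k * \<theta>) / (1 - q * cis (k * \<theta>)))) (at \<theta>)"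
    if "cmod q < 1" for q \<theta> and k :: real
  proof -
    have c: "((\<lambda>\<theta>. 1 - q * cis (k * \<theta>)) has_vector_derivative (- q * (\<i> * k) * cis (k * \<theta>))) (at \<theta>)"
    proof -
      have "((\<lambda>z. 1 - q * exp (\<i> * (k * z))) has_field_derivative (- q * (\<i> * k) * exp (\<i> * (k * of_real \<theta>)))) (at (of_real \<theta>))"
        by (auto intro!: derivative_eq_intros)
      from has_vector_derivative_real_field[OF this] show ?thesis
        by (simp add: cis_conv_exp)
    qed
    have "((\<lambda>\<theta>. Ln (1 - q * cis (k * \<theta>))) has_vector_derivative
       (- q * (\<i> * k) * cis (k * \<theta>)) * inverse (1 - q * cis (k * \<theta>))) (at \<theta>)"
      using field_vector_diff_chain_at[OF c has_field_derivative_Ln[OF Re[OF that]]]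
      by (simp add: o_def)
    from bounded_linear.has_vector_derivative[OF bounded_linear_Im this] show ?thesis
      by (simp add: has_real_derivative_iff_has_vector_derivative divide_inverse)
  qed
  have cis2: "(\<zeta> * cis \<theta>)\<^sup>2 = \<zeta>\<^sup>2 * cis (2 * \<theta>)" for \<theta>
    by (simp add: power_mult_distrib cis_mult power2_eq_square)
  show ?thesis
  proof (cases "cmod w < cmod \<zeta>")
    case True
    define q where "q = (w / \<zeta>)\<^sup>2"
    have q: "cmod q < 1" using True unfolding q_def
      by (simp add: norm_power norm_divide power_less_one_iff) (simp add: divide_less_eq)
    have z: "\<zeta> \<noteq> 0" using True by auto
    \<comment> \<open>Factor \<open>w^2 - (\<zeta> cis \<theta>)^2\<close> as
      \<open>- \<zeta>^2 cis (2 \<theta>) (1 - q cis (-2 \<theta>))\<close>: the growth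
      \<open>2 \<theta>\<close> is the argument of the phase in front.\<close>
    let ?L = "\<lambda>\<theta>. 2 * \<theta> + Im (Ln (1 - q * cis (-2 * \<theta>)))"
    have "(?L has_real_derivative Im (- 2 * \<i> * (\<zeta> * cis \<theta>)\<^sup>2 / (w\<^sup>2 - (\<zeta> * cis \<theta>)\<^sup>2))) (at \<theta>)" for \<theta>
    proof -
      have ne: "1 - q * cis (-2*\<theta>) \<noteq> 0" using Re[OF q, of "-2*\<theta>"] by auto
      have w: "w\<^sup>2 = q * \<zeta>\<^sup>2" using z by (simp add: q_def power_divide)
      have e: "cis (2*\<theta>) * cis (-2*\<theta>) = 1" by (simp add: cis_mult)
      have ne2: "q - cis (2 * \<theta>) \<noteq> 0"
        using ne e by (metis cis_neq_zero eq_iff_diff_eq_0 mult_cancel_right mult.commute)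
      have "- 2 * \<i> * (\<zeta> * cis \<theta>)\<^sup>2 / (w\<^sup>2 - (\<zeta> * cis \<theta>)\<^sup>2)
         = - 2 * \<i> * cis (2*\<theta>) / (q - cis (2*\<theta>))"
        unfolding cis2 w using z by (simp add: divide_simps) (simp add: algebra_simps)
      also have "\<dots> = 2 * \<i> + (- q * (\<i> * complex_of_real (-2)) * cis (-2*\<theta>) / (1 - q * cis (-2*\<theta>)))"
      proof -
        have "(- 2 * \<i> * cis (2*\<theta>)) * (1 - q * cis (-2*\<theta>)) =
          (2 * \<i> * (1 - q * cis (-2*\<theta>)) + (- q * (\<i> * complex_of_real (-2)) * cis (-2*\<theta>))) * (q - cis (2*\<theta>))"
          using e by (simp add: algebra_simps)
        then show ?thesis using ne ne2 by (simp add: divide_simps)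
      qed
      finally have e2: "Im (- 2 * \<i> * (\<zeta> * cis \<theta>)\<^sup>2 / (w\<^sup>2 - (\<zeta> * cis \<theta>)\<^sup>2)) =
        2 + Im (- q * (\<i> * complex_of_real (-2)) * cis (-2*\<theta>) / (1 - q * cis (-2*\<theta>)))"
        by (simp only: plus_complex.sel) simp
      have "((\<lambda>\<theta>. 2 * \<theta>) has_real_derivative 2) (at \<theta>)"
        by (auto intro!: derivative_eq_intros)
      from DERIV_add[OF this D[OF q, of "-2" \<theta>]] show ?thesis unfolding e2 by simp
    qed
    moreover have "?L pi - ?L 0 = 2 * pi"
      by (simp add: cis.ctr)
    ultimately show ?thesis using True by (intro exI[of _ ?L]) auto
  next
    case False
    define q where "q = (\<zeta> / w)\<^sup>2"
    have lt: "cmod \<zeta> < cmod w" using False assms by auto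
    have q: "cmod q < 1" using lt unfolding q_def
      by (simp add: norm_power norm_divide power_less_one_iff) (simp add: divide_less_eq)
    have z: "w \<noteq> 0" using lt by auto
    \<comment> \<open>Now the factor in front is the constant \<open>w^2\<close>, and the remaining
      factor \<open>1 - q cis (2 \<theta>)\<close> does not wind around zero.\<close>
    let ?L = "\<lambda>\<theta>. Im (Ln (1 - q * cis (2 * \<theta>)))"
    have "(?L has_real_derivative Im (- 2 * \<i> * (\<zeta> * cis \<theta>)\<^sup>2 / (w\<^sup>2 - (\<zeta> * cis \<theta>)\<^sup>2))) (at \<theta>)" for \<theta>
    proof -
      have w: "\<zeta>\<^sup>2 = q * w\<^sup>2" using z by (simp add: q_def power_divide)
      have ne: "1 - q * cis (2*\<theta>) \<noteq> 0" using Re[OF q, of "2*\<theta>"] by auto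
      have ww: "w\<^sup>2 - q * w\<^sup>2 * cis (2*\<theta>) = w\<^sup>2 * (1 - q * cis (2*\<theta>))" by (simp add: algebra_simps)
      have "- 2 * \<i> * (\<zeta> * cis \<theta>)\<^sup>2 / (w\<^sup>2 - (\<zeta> * cis \<theta>)\<^sup>2)
        = - q * (\<i> * complex_of_real 2) * cis (2*\<theta>) / (1 - q * cis (2*\<theta>))"
        unfolding cis2 w ww using z ne by (simp add: divide_simps)
      then show ?thesis using D[OF q, of 2 \<theta>] by simp
    qed
    moreover have "?L pi - ?L 0 = 0" by (simp add: cis.ctr)
    ultimately show ?thesis using False by (intro exI[of _ ?L]) auto
  qed
qed

section \<open>Exclusion for a pair\<close>

text \<open>The wave function seen by two particles while the others, indexed by \<open>I\<close>,
  stay at the positions \<open>z\<close>. \<open>P1\<close> and \<open>P2\<close> are its partial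
  derivatives. How many of the others a half turn encloses depends on the pair, so
  \<open>a_le\<close> asks for the phase gap \<open>a\<close> for every count from 0 to
  \<open>card I\<close>.\<close>

locale anyon_pair =
  fixes F :: "real^2 \<Rightarrow> real^2 \<Rightarrow> complex"
    and P1 P2 :: "2 \<Rightarrow> real^2 \<Rightarrow> real^2 \<Rightarrow> complex"
    and \<alpha> a :: real and I :: "nat set" and z :: "nat \<Rightarrow> real^2"
  assumes deriv_F: "\<And>x y. ((\<lambda>p. F (fst p) (snd p)) has_derivative
      (\<lambda>h. (\<Sum>c\<in>UNIV. (fst h $ c) *\<^sub>R P1 c x y) + (\<Sum>c\<in>UNIV. (snd h $ c) *\<^sub>R P2 c x y))) (at (x, y))"
    and cont_P1: "\<And>c. continuous_on UNIV (\<lambda>p. P1 c (fst p) (snd p))"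
    and cont_P2: "\<And>c. continuous_on UNIV (\<lambda>p. P2 c (fst p) (snd p))"
    and F_sym: "\<And>x y. F x y = F y x"
    and F_diag: "\<And>x. F x x = 0"
    and finite_I: "finite I"
    and a_pos: "a > 0"
    and a_le: "\<And>p q::int. 0 \<le> p \<Longrightarrow> p \<le> int (card I) \<Longrightarrow> a \<le> \<bar>(2 * of_int p + 1) * \<alpha> - 2 * of_int q\<bar>"
begin

text \<open>The potential felt by a particle at \<open>x\<close> whose partner is at
  \<open>y\<close>; the partner itself feels \<open>A y x\<close>. A coincident particle contributes
  0, because division by zero gives 0.\<close>

definition A :: "real^2 \<Rightarrow> real^2 \<Rightarrow> real^2" where
  "A x y = (1 / (norm (x - y))\<^sup>2) *\<^sub>R perp (x - y) + (\<Sum>l\<in>I. (1 / (norm (x - z l))\<^sup>2) *\<^sub>R perp (x - z l))"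

definition D1 where "D1 c x y = - \<i> * P1 c x y + complex_of_real (\<alpha> * A x y $ c) * F x y"
definition D2 where "D2 c x y = - \<i> * P2 c x y + complex_of_real (\<alpha> * A y x $ c) * F x y"
definition E :: "real^2 \<Rightarrow> real^2 \<Rightarrow> real" where
  "E x y = (\<Sum>c\<in>UNIV. (cmod (D1 c x y))\<^sup>2) + (\<Sum>c\<in>UNIV. (cmod (D2 c x y))\<^sup>2)"
definition W :: "real^2 \<Rightarrow> real^2 \<Rightarrow> real" where "W x y = (cmod (F x y))\<^sup>2"

definition dF where
  "dF h k x y = (\<Sum>c\<in>UNIV. (h $ c) *\<^sub>R P1 c x y) + (\<Sum>c\<in>UNIV. (k $ c) *\<^sub>R P2 c x y)"
definition Cov where
  "Cov h k x y = (\<Sum>c\<in>UNIV. (h $ c) *\<^sub>R D1 c x y) + (\<Sum>c\<in>UNIV. (k $ c) *\<^sub>R D2 c x y)"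

lemma E_nonneg: "E x y \<ge> 0"
  unfolding E_def by (intro add_nonneg_nonneg sum_nonneg) auto

lemma W_nonneg: "W x y \<ge> 0"
  by (simp add: W_def)

text \<open>For a joint displacement by \<open>h\<close> and \<open>k\<close>, the plain and the
  covariant derivative differ by an imaginary multiple of \<open>F\<close>. It disappears from the
  derivative of \<open>W\<close>, and along a path it can be absorbed into a phase.\<close>

lemma dF_Cov: "dF h k x y = \<i> * Cov h k x y - \<i> * complex_of_real (\<alpha> * (h \<bullet> A x y + k \<bullet> A y x)) * F x y"
  unfolding dF_def Cov_def D1_def D2_def
  by (simp add: sum_2 inner_vec_def scaleR_conv_of_real algebra_simps)

lemma norm_Cov: "cmod (Cov h k x y) \<le> norm (h, k) * sqrt (E x y)"
proof -
  \<comment> \<open>Passing to the moduli of all components reduces the claim to Cauchy-Schwarz for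
    real vectors in dimension four.\<close>
  define h' k' d1 d2 :: "real^2" where "h' = (\<chi> c. \<bar>h $ c\<bar>)" and "k' = (\<chi> c. \<bar>k $ c\<bar>)"
    and "d1 = (\<chi> c. cmod (D1 c x y))" and "d2 = (\<chi> c. cmod (D2 c x y))"
  have "cmod (Cov h k x y) \<le> (\<Sum>c\<in>UNIV. cmod ((h $ c) *\<^sub>R D1 c x y)) + (\<Sum>c\<in>UNIV. cmod ((k $ c) *\<^sub>R D2 c x y))"
    unfolding Cov_def by (intro norm_triangle_mono norm_sum)
  also have "\<dots> = (h', k') \<bullet> (d1, d2)"
    by (simp add: h'_def k'_def d1_def d2_def inner_vec_def)
  also have "\<dots> \<le> norm (h', k') * norm (d1, d2)" by (rule norm_cauchy_schwarz)
  also have "norm (h', k') = norm (h, k)"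
    by (simp add: norm_Pair h'_def k'_def norm_vec_def L2_set_def)
  also have "norm (d1, d2) = sqrt (E x y)"
    by (simp add: norm_Pair d1_def d2_def norm_vec_def L2_set_def E_def sum_nonneg)
  finally show ?thesis .
qed

lemma vderiv_F:
  assumes "(g1 has_vector_derivative h) (at t)" "(g2 has_vector_derivative k) (at t)"
  shows "((\<lambda>t. F (g1 t) (g2 t)) has_vector_derivative dF h k (g1 t) (g2 t)) (at t)"
proof -
  have g: "((\<lambda>t. (g1 t, g2 t)) has_vector_derivative (h, k)) (at t)"
    by (rule has_vector_derivative_Pair[OF assms])
  from vector_derivative_diff_chain_within[of "\<lambda>t. (g1 t, g2 t)" "(h,k)" t UNIV "\<lambda>p. F (fst p) (snd p)"
     "\<lambda>h. (\<Sum>c\<in>UNIV. (fst h $ c) *\<^sub>R P1 c (g1 t) (g2 t)) + (\<Sum>c\<in>UNIV. (snd h $ c) *\<^sub>R P2 c (g1 t) (g2 t))"] g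
  show ?thesis
    by (simp add: o_def dF_def has_derivative_at_withinI[OF deriv_F])
qed

lemma deriv_W:
  assumes "(g1 has_vector_derivative h) (at t)" "(g2 has_vector_derivative k) (at t)"
  shows "((\<lambda>t. W (g1 t) (g2 t)) has_vector_derivative 2 * Re (cnj (F (g1 t) (g2 t)) * dF h k (g1 t) (g2 t))) (at t)"
  unfolding W_def by (rule has_vector_derivative_cmod_sq[OF vderiv_F[OF assms]])

lemma deriv_W_bound:
  "\<bar>2 * Re (cnj (F x y) * dF h k x y)\<bar> \<le> 2 * cmod (F x y) * norm (h, k) * sqrt (E x y)"
proof -
  \<comment> \<open>The gauge term contributes \<open>cnj F * F\<close> times an imaginary number,
    which has no real part.\<close>
  have "Re (cnj (F x y) * dF h k x y) = Re (cnj (F x y) * (\<i> * Cov h k x y))"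
    unfolding dF_Cov by (simp add: algebra_simps)
  also have "\<bar>\<dots>\<bar> \<le> cmod (cnj (F x y) * (\<i> * Cov h k x y))" by (rule abs_Re_le_cmod)
  also have "\<dots> = cmod (F x y) * cmod (Cov h k x y)" by (simp add: norm_mult)
  also have "\<dots> \<le> cmod (F x y) * (norm (h, k) * sqrt (E x y))"
    by (intro mult_left_mono norm_Cov) auto
  finally show ?thesis by (simp add: abs_mult mult.assoc)
qed

lemma cont_F: "continuous_on UNIV (\<lambda>p. F (fst p) (snd p))"
  by (auto simp: continuous_on_eq_continuous_at intro!: has_derivative_continuous[OF deriv_F])

lemma cont_F' [continuous_intros]:
  "continuous_on S f \<Longrightarrow> continuous_on S g \<Longrightarrow> continuous_on S (\<lambda>t. F (f t) (g t))"
  using continuous_on_compose2[OF cont_F, of S "\<lambda>t. (f t, g t)"] by (auto intro: continuous_on_Pair)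

lemma cont_dF [continuous_intros]:
  assumes "continuous_on S f" "continuous_on S g" "continuous_on S h" "continuous_on S k"
  shows "continuous_on S (\<lambda>t. dF (h t) (k t) (f t) (g t))"
proof -
  have 1: "continuous_on S (\<lambda>t. P1 c (f t) (g t))" for c
    using continuous_on_compose2[OF cont_P1, of S "\<lambda>t. (f t, g t)"] assms by (auto intro: continuous_on_Pair)
  have 2: "continuous_on S (\<lambda>t. P2 c (f t) (g t))" for c
    using continuous_on_compose2[OF cont_P2, of S "\<lambda>t. (f t, g t)"] assms by (auto intro: continuous_on_Pair)
  show ?thesis unfolding dF_def
    using assms by (intro continuous_intros 1 2) auto
qed

lemma meas_F [measurable (raw)]:
  "f \<in> borel_measurable M \<Longrightarrow> g \<in> borel_measurable M \<Longrightarrow> (\<lambda>t. F (f t) (g t)) \<in> borel_measurable M"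
  using measurable_compose[OF borel_measurable_Pair[of f M g] borel_measurable_continuous_onI[OF cont_F]] by simp

lemma meas_P1 [measurable (raw)]:
  "f \<in> borel_measurable M \<Longrightarrow> g \<in> borel_measurable M \<Longrightarrow> (\<lambda>t. P1 c (f t) (g t)) \<in> borel_measurable M"
  using measurable_compose[OF borel_measurable_Pair[of f M g] borel_measurable_continuous_onI[OF cont_P1]] by simp

lemma meas_P2 [measurable (raw)]:
  "f \<in> borel_measurable M \<Longrightarrow> g \<in> borel_measurable M \<Longrightarrow> (\<lambda>t. P2 c (f t) (g t)) \<in> borel_measurable M"
  using measurable_compose[OF borel_measurable_Pair[of f M g] borel_measurable_continuous_onI[OF cont_P2]] by simp

lemma meas_A [measurable (raw)]:
  assumes [measurable]: "f \<in> borel_measurable M" "g \<in> borel_measurable M"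
  shows "(\<lambda>t. A (f t) (g t) $ c) \<in> borel_measurable M"
proof -
  have p: "(\<lambda>t. perp (k t)) \<in> borel_measurable M" if "k \<in> borel_measurable M" for k
    using measurable_compose[OF that borel_measurable_perp] .
  have "(\<lambda>t. A (f t) (g t)) \<in> borel_measurable M"
    unfolding A_def
    by (intro borel_measurable_add borel_measurable_scaleR borel_measurable_sum p) measurable
  then show ?thesis unfolding cart_eq_inner_axis by measurable
qed

lemma meas_E [measurable (raw)]:
  assumes [measurable]: "f \<in> borel_measurable M" "g \<in> borel_measurable M"
  shows "(\<lambda>t. E (f t) (g t)) \<in> borel_measurable M"
proof -
  have D: "(\<lambda>t. D1 c (f t) (g t)) \<in> borel_measurable M" "(\<lambda>t. D2 c (f t) (g t)) \<in> borel_measurable M" for c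
    unfolding D1_def D2_def
    by (intro borel_measurable_add borel_measurable_times
      measurable_compose[OF _ borel_measurable_of_real] meas_A meas_F meas_P1 meas_P2 borel_measurable_const assms; measurable)+
  show ?thesis unfolding E_def
    by (intro borel_measurable_add borel_measurable_sum borel_measurable_power D[THEN measurable_compose] borel_measurable_norm)
qed

lemma meas_W [measurable (raw)]:
  "f \<in> borel_measurable M \<Longrightarrow> g \<in> borel_measurable M \<Longrightarrow> (\<lambda>t. W (f t) (g t)) \<in> borel_measurable M"
  unfolding W_def by measurable

text \<open>Used with \<open>s0 = 0\<close> to integrate outward from a coincidence, and with
  \<open>s0 = 1/3\<close> to come from the middle third of a square.\<close>

lemma W_segment:
  assumes "s0 \<le> 1"
  shows "ennreal (W (x + h) (y + k)) \<le> ennreal (W (x + s0 *\<^sub>R h) (y + s0 *\<^sub>R k)) +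
    (\<integral>\<^sup>+s. ennreal (2 * cmod (F (x + s *\<^sub>R h) (y + s *\<^sub>R k)) * norm (h, k) * sqrt (E (x + s *\<^sub>R h) (y + s *\<^sub>R k)))
       * indicator {s0..1} s \<partial>lborel)"
proof -
  let ?w = "\<lambda>s. W (x + s *\<^sub>R h) (y + s *\<^sub>R k)"
  have v: "((\<lambda>s. x + s *\<^sub>R h) has_vector_derivative h) (at t)" for x h :: "real^2" and t
    by (auto intro!: derivative_eq_intros)
  have "ennreal (norm (?w 1 - ?w s0)) \<le> (\<integral>\<^sup>+s. ennreal (2 * cmod (F (x + s *\<^sub>R h) (y + s *\<^sub>R k)) * norm (h, k) * sqrt (E (x + s *\<^sub>R h) (y + s *\<^sub>R k)))
       * indicator {s0..1} s \<partial>lborel)"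
    apply (rule ennreal_norm_diff_le_nn_integral[OF assms deriv_W[OF v v]])
     apply (intro continuous_intros)
    using deriv_W_bound by simp
  moreover have "ennreal (?w 1) \<le> ennreal (?w s0) + ennreal (norm (?w 1 - ?w s0))"
    using ennreal_leI[of "?w 1" "?w s0 + norm (?w 1 - ?w s0)"] by (simp add: W_nonneg ennreal_plus)
  ultimately show ?thesis by (simp add: add_left_mono order_trans)
qed

lemma vderiv_rot: "((\<lambda>\<theta>. rot \<theta> r) has_vector_derivative perp (rot \<theta> r)) (at \<theta>)"
proof -
  have "perp (rot \<theta> r) = - sin \<theta> *\<^sub>R r + cos \<theta> *\<^sub>R perp r"
    by (simp add: perp_def rot_def vec_eq_iff forall_2)
  then show ?thesis unfolding rot_def
    by (auto intro!: derivative_eq_intros simp: has_real_derivative_iff_has_vector_derivative[symmetric])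
qed

text \<open>The mutual terms of the pair are 1/2 each at every angle and add up to \<open>pi\<close>
  over the half turn. A frozen particle inside the circle adds \<open>2 pi\<close>, one outside adds
  0. Excluding particles on the circle keeps the potential regular along the path and discards only
  a null set of \<open>r\<close>.\<close>

lemma half_turn_gauge:
  assumes r: "r \<noteq> 0" and nz: "\<And>l. l \<in> I \<Longrightarrow> norm (z l - X) \<noteq> norm r"
  shows "\<exists>ph. (\<forall>\<theta>. (ph has_real_derivative
       \<alpha> * (perp (rot \<theta> r) \<bullet> A (X + rot \<theta> r) (X - rot \<theta> r) + (- perp (rot \<theta> r)) \<bullet> A (X - rot \<theta> r) (X + rot \<theta> r))) (at \<theta>)) \<and>
     continuous_on UNIV (\<lambda>\<theta>. perp (rot \<theta> r) \<bullet> A (X + rot \<theta> r) (X - rot \<theta> r) + (- perp (rot \<theta> r)) \<bullet> A (X - rot \<theta> r) (X + rot \<theta> r)) \<and>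
     (\<exists>p. 0 \<le> p \<and> p \<le> int (card I) \<and> ph pi - ph 0 = pi * ((2 * of_int p + 1) * \<alpha>))"
proof -
  define w where "w l = cplx (z l - X)" for l
  define \<zeta> where "\<zeta> = cplx r"
  have wz: "cmod (w l) \<noteq> cmod \<zeta>" if "l \<in> I" for l
    using nz[OF that] by (simp add: w_def \<zeta>_def norm_cplx)
  have z0: "\<zeta> \<noteq> 0" using r by (simp add: \<zeta>_def cplx_eq_0_iff)
  define f where "f l \<theta> = Im (- 2 * \<i> * (\<zeta> * cis \<theta>)\<^sup>2 / ((w l)\<^sup>2 - (\<zeta> * cis \<theta>)\<^sup>2))" for l \<theta>
  have "\<forall>l\<in>I. \<exists>L. (\<forall>\<theta>. (L has_real_derivative f l \<theta>) (at \<theta>)) \<and>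
      L pi - L 0 = (if cmod (w l) < cmod \<zeta> then 2 * pi else 0)"
    unfolding f_def using half_turn_argument[OF wz] by blast
  then obtain \<Lambda> where L: "\<And>l \<theta>. l \<in> I \<Longrightarrow> (\<Lambda> l has_real_derivative f l \<theta>) (at \<theta>)"
      "\<And>l. l \<in> I \<Longrightarrow> \<Lambda> l pi - \<Lambda> l 0 = (if cmod (w l) < cmod \<zeta> then 2 * pi else 0)"
    by (metis bchoice)
  have ne: "(w l)\<^sup>2 - (\<zeta> * cis \<theta>)\<^sup>2 \<noteq> 0" "\<zeta> * cis \<theta> \<noteq> w l" "- (\<zeta> * cis \<theta>) \<noteq> w l" if "l \<in> I" for l \<theta>
  proof -
    have n: "cmod (\<zeta> * cis \<theta>) = cmod \<zeta>" by (simp add: norm_mult)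
    show 2: "\<zeta> * cis \<theta> \<noteq> w l" and 3: "- (\<zeta> * cis \<theta>) \<noteq> w l"
      using n wz[OF that] by (metis, metis norm_minus_cancel)
    show "(w l)\<^sup>2 - (\<zeta> * cis \<theta>)\<^sup>2 \<noteq> 0"
      using 2 3 by (auto simp: power2_eq_iff)
  qed
  let ?q = "\<lambda>\<theta>. perp (rot \<theta> r)"
  have pair: "?q \<theta> \<bullet> ((1 / (norm (X + rot \<theta> r - (X - rot \<theta> r)))\<^sup>2) *\<^sub>R perp (X + rot \<theta> r - (X - rot \<theta> r)))
     + (- ?q \<theta>) \<bullet> ((1 / (norm (X - rot \<theta> r - (X + rot \<theta> r)))\<^sup>2) *\<^sub>R perp (X - rot \<theta> r - (X + rot \<theta> r))) = 1" for \<theta>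
  proof -
    let ?e = "\<zeta> * cis \<theta>"
    have 1: "cplx (X + rot \<theta> r - (X - rot \<theta> r)) = 2 * ?e" "cplx (X - rot \<theta> r - (X + rot \<theta> r)) = - 2 * ?e"
      "cplx (?q \<theta>) = \<i> * ?e" "cplx (- ?q \<theta>) = - (\<i> * ?e)"
      by (simp_all only: cplx_simps) (simp_all add: \<zeta>_def)
    have "?e \<noteq> 0" using z0 by simp
    then have 2: "\<i> * ?e / (2 * ?e) = \<i> / 2" "- (\<i> * ?e) / (- 2 * ?e) = \<i> / 2" by simp_all
    show ?thesis unfolding inner_perp_eq_Im 1 2 by simp
  qed
  have other: "?q \<theta> \<bullet> ((1 / (norm (X + rot \<theta> r - z l))\<^sup>2) *\<^sub>R perp (X + rot \<theta> r - z l))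
     + (- ?q \<theta>) \<bullet> ((1 / (norm (X - rot \<theta> r - z l))\<^sup>2) *\<^sub>R perp (X - rot \<theta> r - z l)) = f l \<theta>" if l: "l \<in> I" for \<theta> l
  proof -
    let ?e = "\<zeta> * cis \<theta>"
    have 1: "cplx (X + rot \<theta> r - z l) = ?e - w l" "cplx (X - rot \<theta> r - z l) = - ?e - w l"
      by (simp_all add: cplx_simps w_def \<zeta>_def)
    have 2: "\<i> * ?e / (?e - w l) + (- (\<i> * ?e)) / (- ?e - w l) = - 2 * \<i> * ?e\<^sup>2 / ((w l)\<^sup>2 - ?e\<^sup>2)"
    proof -
      have d: "?e - w l \<noteq> 0" "- ?e - w l \<noteq> 0" using ne[OF l, of \<theta>] by auto
      have "(w l)\<^sup>2 - ?e\<^sup>2 = (?e - w l) * (- ?e - w l)" by (simp add: power2_eq_square algebra_simps)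
      moreover have "\<i> * ?e * (- ?e - w l) + (- (\<i> * ?e)) * (?e - w l) = - 2 * \<i> * ?e\<^sup>2"
        by (simp add: power2_eq_square algebra_simps)
      ultimately show ?thesis unfolding add_frac_eq[OF d] by metis
    qed
    show ?thesis unfolding inner_perp_eq_Im f_def 2[symmetric] 1 
      by (simp add: cplx_simps \<zeta>_def mult.commute)
  qed
  have flux: "?q \<theta> \<bullet> A (X + rot \<theta> r) (X - rot \<theta> r) + (- ?q \<theta>) \<bullet> A (X - rot \<theta> r) (X + rot \<theta> r) = 1 + (\<Sum>l\<in>I. f l \<theta>)" for \<theta>
  proof -
    have "(\<Sum>l\<in>I. f l \<theta>) = ?q \<theta> \<bullet> (\<Sum>l\<in>I. (1 / (norm (X + rot \<theta> r - z l))\<^sup>2) *\<^sub>R perp (X + rot \<theta> r - z l))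
     + (- ?q \<theta>) \<bullet> (\<Sum>l\<in>I. (1 / (norm (X - rot \<theta> r - z l))\<^sup>2) *\<^sub>R perp (X - rot \<theta> r - z l))"
      unfolding inner_sum_right sum.distrib[symmetric] by (intro sum.cong refl other[symmetric])
    then show ?thesis unfolding A_def inner_add_right using pair[of \<theta>] by linarith
  qed
  define ph where "ph \<theta> = \<alpha> * (\<theta> + (\<Sum>l\<in>I. \<Lambda> l \<theta>))" for \<theta>
  define p where "p = card {l\<in>I. cmod (w l) < cmod \<zeta>}"
  have "(ph has_real_derivative \<alpha> * (1 + (\<Sum>l\<in>I. f l \<theta>))) (at \<theta>)" for \<theta>
    unfolding ph_def by (auto intro!: derivative_eq_intros DERIV_sum L(1))
  moreover have "continuous_on UNIV (\<lambda>\<theta>. 1 + (\<Sum>l\<in>I. f l \<theta>))"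
    unfolding f_def using ne(1) by (intro continuous_intros) auto
  moreover have "ph pi - ph 0 = pi * ((2 * of_int (int p) + 1) * \<alpha>)"
  proof -
    have "ph pi - ph 0 = \<alpha> * (pi + (\<Sum>l\<in>I. \<Lambda> l pi - \<Lambda> l 0))"
      by (simp add: ph_def sum_subtractf algebra_simps)
    also have "(\<Sum>l\<in>I. \<Lambda> l pi - \<Lambda> l 0) = (\<Sum>l\<in>I. if cmod (w l) < cmod \<zeta> then 2 * pi else 0)"
      by (intro sum.cong refl L(2))
    also have "\<dots> = real p * (2 * pi)"
      using finite_I by (simp add: sum.If_cases p_def Int_def conj_commute)
    finally show ?thesis by (simp add: algebra_simps)
  qed
  moreover have "p \<le> card I" unfolding p_def by (intro card_mono finite_I) auto
  ultimately show ?thesis unfolding flux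
    by (intro exI[of _ ph] conjI exI[of _ "int p"]) auto
qed

text \<open>The phase \<open>cis (ph \<theta>)\<close> turns the plain derivative along the half
  turn into the covariant one. At the end the pair is exchanged, so by symmetry of \<open>F\<close>
  the end values of \<open>v\<close> differ by a phase at distance at least \<open>2 a\<close> from
  1. Covariant energy has to pay for this change.\<close>

lemma hardy_pointwise:
  assumes r: "r \<noteq> 0" and nz: "\<And>l. l \<in> I \<Longrightarrow> norm (z l - X) \<noteq> norm r"
  shows "ennreal (4 * a\<^sup>2 * W (X + r) (X - r)) \<le> ennreal (2 * pi * (norm r)\<^sup>2) *
     (\<integral>\<^sup>+\<theta>. ennreal (E (X + rot \<theta> r) (X - rot \<theta> r)) * indicator {0..pi} \<theta> \<partial>lborel)"
proof -
  define J where "J = (\<integral>\<^sup>+\<theta>. ennreal (E (X + rot \<theta> r) (X - rot \<theta> r)) * indicator {0..pi} \<theta> \<partial>lborel)"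
  let ?g1 = "\<lambda>\<theta>. X + rot \<theta> r" and ?g2 = "\<lambda>\<theta>. X - rot \<theta> r" and ?q = "\<lambda>\<theta>. perp (rot \<theta> r)"
  define fl where "fl \<theta> = ?q \<theta> \<bullet> A (?g1 \<theta>) (?g2 \<theta>) + (- ?q \<theta>) \<bullet> A (?g2 \<theta>) (?g1 \<theta>)" for \<theta>
  obtain ph p where ph: "\<And>\<theta>. (ph has_real_derivative \<alpha> * fl \<theta>) (at \<theta>)" and fl: "continuous_on UNIV fl"
    and p: "0 \<le> p" "p \<le> int (card I)" "ph pi - ph 0 = pi * ((2 * of_int p + 1) * \<alpha>)"
    using half_turn_gauge[OF assms] unfolding fl_def by blast
  define v where "v \<theta> = cis (ph \<theta>) * F (?g1 \<theta>) (?g2 \<theta>)" for \<theta>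
  define v' where "v' \<theta> = cis (ph \<theta>) * (dF (?q \<theta>) (- ?q \<theta>) (?g1 \<theta>) (?g2 \<theta>) + \<i> * (\<alpha> * fl \<theta>) * F (?g1 \<theta>) (?g2 \<theta>))" for \<theta>
  have dg: "(?g1 has_vector_derivative ?q \<theta>) (at \<theta>)" "(?g2 has_vector_derivative (- ?q \<theta>)) (at \<theta>)" for \<theta>
    by (auto intro!: derivative_eq_intros vderiv_rot)
  have cph: "continuous_on S ph" for S
    using DERIV_isCont[OF ph] by (simp add: continuous_at_imp_continuous_on)
  have dc: "((\<lambda>\<theta>. cis (ph \<theta>)) has_vector_derivative (cis (ph \<theta>) * (\<i> * (\<alpha> * fl \<theta>)))) (at \<theta>)" for \<theta>
    unfolding has_vector_derivative_complex_iff using ph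
    by (auto intro!: derivative_eq_intros)
  have dv: "(v has_vector_derivative v' \<theta>) (at \<theta>)" for \<theta>
    unfolding v_def[abs_def] v'_def
    using has_vector_derivative_mult[OF dc vderiv_F[OF dg]] by (simp add: algebra_simps)
  have cr: "continuous_on S (\<lambda>\<theta>. rot \<theta> r)" "continuous_on S (\<lambda>\<theta>. perp (rot \<theta> r))" for S
  proof -
    show 1: "continuous_on S (\<lambda>\<theta>. rot \<theta> r)" unfolding rot_def by (intro continuous_intros)
    have "perp (rot \<theta> r) = - sin \<theta> *\<^sub>R r + cos \<theta> *\<^sub>R perp r" for \<theta>
      by (simp add: perp_def rot_def vec_eq_iff forall_2)
    then show "continuous_on S (\<lambda>\<theta>. perp (rot \<theta> r))" by (simp add: continuous_intros)
  qed
  have cv: "continuous_on {0..pi} v'"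
    unfolding v'_def cis_conv_exp using continuous_on_subset[OF fl subset_UNIV]
    by (intro continuous_intros cr cph) auto
  have nq: "norm (?q \<theta>, - ?q \<theta>) = sqrt 2 * norm r" for \<theta>
  proof -
    have "norm (perp x) = norm x" for x
      using norm_cplx[of "perp x"] norm_cplx[of x] by (simp add: cplx_simps norm_mult)
    then show ?thesis by (simp add: norm_Pair real_sqrt_mult)
  qed
  have nv: "norm (v' \<theta>) \<le> sqrt 2 * norm r * sqrt (E (?g1 \<theta>) (?g2 \<theta>))" for \<theta>
  proof -
    have "v' \<theta> = cis (ph \<theta>) * (\<i> * Cov (?q \<theta>) (- ?q \<theta>) (?g1 \<theta>) (?g2 \<theta>))"
      unfolding v'_def dF_Cov fl_def by (simp add: algebra_simps)
    then have "norm (v' \<theta>) = cmod (Cov (?q \<theta>) (- ?q \<theta>) (?g1 \<theta>) (?g2 \<theta>))" by (simp add: norm_mult)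
    with norm_Cov[of "?q \<theta>" "- ?q \<theta>" "?g1 \<theta>" "?g2 \<theta>"] show ?thesis unfolding nq by simp
  qed
  define \<delta> where "\<delta> = 2 * a * cmod (F (X + r) (X - r))"
  have rp: "rot pi r = - r" "rot 0 r = r" by (simp_all add: rot_def)
  have "\<delta> \<le> cmod (v pi - v 0)"
  proof -
    have "v pi - v 0 = cis (ph 0) * (cis (ph pi - ph 0) - 1) * F (X + r) (X - r)"
      unfolding v_def rp by (simp add: F_sym[of "X - r"] algebra_simps cis_mult)
    then have "cmod (v pi - v 0) = cmod (cis (pi * ((2 * of_int p + 1) * \<alpha>)) - 1) * cmod (F (X + r) (X - r))"
      by (simp add: norm_mult p(3))
    moreover have "2 * a \<le> cmod (cis (pi * ((2 * of_int p + 1) * \<alpha>)) - 1)"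
      by (rule norm_cis_minus_one_ge) (rule a_le[OF p(1,2)])
    ultimately show ?thesis by (simp add: \<delta>_def mult_right_mono)
  qed
  then have "ennreal \<delta> \<le> ennreal (cmod (v pi - v 0))" by (rule ennreal_leI)
  also have "\<dots> \<le> (\<integral>\<^sup>+\<theta>. ennreal (sqrt 2 * norm r * sqrt (E (?g1 \<theta>) (?g2 \<theta>))) * indicator {0..pi} \<theta> \<partial>lborel)"
    by (rule ennreal_norm_diff_le_nn_integral[OF _ dv cv nv]) simp
  finally have main: "ennreal \<delta> \<le> (\<integral>\<^sup>+\<theta>. ennreal (sqrt 2 * norm r * sqrt (E (?g1 \<theta>) (?g2 \<theta>))) * indicator {0..pi} \<theta> \<partial>lborel)" .
  have d2: "4 * a\<^sup>2 * W (X + r) (X - r) = \<delta>\<^sup>2" by (simp add: \<delta>_def W_def power_mult_distrib)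
  show ?thesis
  proof (cases "\<delta> = 0")
    case True then show ?thesis unfolding d2 by simp
  next
    case False
    then have d: "\<delta> > 0" using a_pos by (simp add: \<delta>_def)
    \<comment> \<open>With this weight the constant part of Young's inequality integrates to
      \<open>\<delta> / 2\<close> over \<open>[0, pi]\<close> and is absorbed by the left
      side.\<close>
    define \<mu> where "\<mu> = \<delta> / pi"
    have l: "\<mu> > 0" using d by (simp add: \<mu>_def)
    have pt: "sqrt 2 * norm r * sqrt e \<le> \<mu> / 2 + (norm r)\<^sup>2 / \<mu> * e" if "e \<ge> 0" for e
    proof -
      have "0 \<le> (\<mu> - sqrt 2 * norm r * sqrt e)\<^sup>2" by simp
      then have "2 * \<mu> * (sqrt 2 * norm r * sqrt e) \<le> \<mu>\<^sup>2 + 2 * (norm r)\<^sup>2 * e"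
        using that by (simp add: power2_diff power_mult_distrib algebra_simps)
      then show ?thesis using l by (simp add: field_simps power2_eq_square)
    qed
    have [measurable]: "(\<lambda>\<theta>. rot \<theta> r) \<in> borel_measurable borel"
      by (rule borel_measurable_continuous_onI[OF cr(1)])
    note main
    also have "(\<integral>\<^sup>+\<theta>. ennreal (sqrt 2 * norm r * sqrt (E (?g1 \<theta>) (?g2 \<theta>))) * indicator {0..pi} \<theta> \<partial>lborel)
      \<le> (\<integral>\<^sup>+\<theta>. ennreal (\<mu> / 2) * indicator {0..pi} \<theta> + ennreal ((norm r)\<^sup>2 / \<mu>) * (ennreal (E (?g1 \<theta>) (?g2 \<theta>)) * indicator {0..pi} \<theta>) \<partial>lborel)"
      using pt[OF E_nonneg] l
      by (intro nn_integral_mono) (auto split: split_indicator simp: ennreal_mult[symmetric] E_nonneg ennreal_plus[symmetric] simp del: ennreal_plus intro!: ennreal_leI)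
    also have "\<dots> = ennreal (\<mu> / 2) * ennreal pi + ennreal ((norm r)\<^sup>2 / \<mu>) * J"
      by (subst nn_integral_add) (auto simp: nn_integral_cmult J_def)
    finally have le: "ennreal \<delta> \<le> ennreal (\<delta> / 2) + ennreal ((norm r)\<^sup>2 / \<mu>) * J"
      using l by (simp add: ennreal_mult[symmetric] \<mu>_def)
    show ?thesis
    proof (cases J rule: ennreal_cases)
      case (real j)
      have "\<delta> \<le> \<delta> / 2 + (norm r)\<^sup>2 / \<mu> * j"
        using le d l real by (simp add: ennreal_mult[symmetric] ennreal_plus[symmetric] del: ennreal_plus)
      then have "\<delta>\<^sup>2 \<le> 2 * pi * (norm r)\<^sup>2 * j"
        using d by (simp add: \<mu>_def field_simps power2_eq_square)
      then show ?thesis unfolding d2 J_def[symmetric] real(2)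
        using real(1) by (simp add: ennreal_mult[symmetric] ennreal_leI)
    next
      case top
      then show ?thesis unfolding J_def[symmetric] using r by (simp add: ennreal_mult_top)
    qed
  qed
qed

end

section \<open>Integration of the half-turn bound over discs\<close>

lemma measurable_rot [measurable (raw)]:
  assumes [measurable]: "f \<in> borel_measurable M" "g \<in> borel_measurable M"
  shows "(\<lambda>x. rot (f x) (g x)) \<in> borel_measurable M"
proof -
  have [measurable]: "(\<lambda>t. perp (g t)) \<in> borel_measurable M"
    using measurable_compose[OF assms(2) borel_measurable_perp] .
  show ?thesis unfolding rot_def by measurable
qed

lemma AE_lborel_norm_neq: "AE x in lborel. norm (x :: 'a::euclidean_space) \<noteq> \<rho>"
proof -
  have "sphere (0::'a) \<rho> \<in> null_sets lebesgue" using negligible_sphere by (simp add: negligible_iff_null_sets)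
  then have "sphere (0::'a) \<rho> \<in> null_sets lborel"
    by (subst (asm) null_sets_completion_iff) auto
  then show ?thesis by (rule AE_I') (auto simp: dist_norm)
qed

lemma nn_integral_inverse_cube:
  assumes "0 < u"
  shows "(\<integral>\<^sup>+s. ennreal (1 / s^3) * indicator {u<..1} s \<partial>lborel) \<le> ennreal (1 / (2 * u\<^sup>2))"
proof (cases "u \<le> 1")
  case True
  have "((\<lambda>s. 1 / s^3) has_integral (- 1 / (2 * 1\<^sup>2) - (- 1 / (2 * u\<^sup>2)))) {u..1}"
  proof (rule fundamental_theorem_of_calculus[OF True])
    fix s assume "s \<in> {u..1}"
    then have s: "s > 0" using assms by auto
    have "((\<lambda>s. - 1 / (2 * s\<^sup>2)) has_real_derivative 1 / s^3) (at s)"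
      using s by (auto intro!: derivative_eq_intros simp: field_simps power2_eq_square power3_eq_cube)
    then show "((\<lambda>s. - 1 / (2 * s\<^sup>2)) has_vector_derivative 1 / s^3) (at s within {u..1})"
      by (simp add: has_real_derivative_iff_has_vector_derivative has_vector_derivative_at_within)
  qed
  from nn_integral_has_integral_lebesgue'[OF _ this] assms
  have "(\<integral>\<^sup>+s. ennreal (1 / s^3) * indicator {u..1} s \<partial>lborel) = ennreal (- 1 / (2 * 1\<^sup>2) - (- 1 / (2 * u\<^sup>2)))"
    by simp
  moreover have "(\<integral>\<^sup>+s. ennreal (1 / s^3) * indicator {u<..1} s \<partial>lborel) \<le> (\<integral>\<^sup>+s. ennreal (1 / s^3) * indicator {u..1} s \<partial>lborel)"
    by (intro nn_integral_mono) (auto split: split_indicator)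
  moreover have "ennreal (- 1 / (2 * 1\<^sup>2) - (- 1 / (2 * u\<^sup>2))) \<le> ennreal (1 / (2 * u\<^sup>2))"
    by (intro ennreal_leI) simp
  ultimately show ?thesis by order
next
  case False
  then have "{u<..1} = {}" by auto
  then show ?thesis by simp
qed

context anyon_pair begin

text \<open>A rotation preserves both the disc and the measure, so after exchanging the integrals
  the angle contributes only the length \<open>pi\<close> of its range. Hence
  \<open>2 pi / (4 a^2)\<close> becomes \<open>pi^2 / (2 a^2)\<close>.\<close>

lemma hardy:
  "(\<integral>\<^sup>+r. ennreal (W (X + r) (X - r) / (norm r)\<^sup>2) * indicator (ball 0 R) r \<partial>lborel)
   \<le> ennreal (pi\<^sup>2 / (2 * a\<^sup>2)) * (\<integral>\<^sup>+r. ennreal (E (X + r) (X - r)) * indicator (ball 0 R) r \<partial>lborel)"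
proof -
  have [measurable]: "ball (0::real^2) R \<in> sets borel" by simp
  let ?J = "\<lambda>r. \<integral>\<^sup>+\<theta>. ennreal (E (X + rot \<theta> r) (X - rot \<theta> r)) * indicator {0..pi} \<theta> \<partial>lborel"
  \<comment> \<open>The excluded \<open>r\<close> lie on finitely many circles about the origin,
    possibly of radius 0.\<close>
  have AE: "AE r::real^2 in lborel. r \<noteq> 0 \<and> (\<forall>l\<in>I. norm (z l - X) \<noteq> norm r)"
  proof -
    have "AE r in lborel. norm (z l - X) \<noteq> norm (r::real^2)" for l
      using AE_lborel_norm_neq[of "norm (z l - X)"] by eventually_elim auto
    then have "AE r in lborel. \<forall>l\<in>I. norm (z l - X) \<noteq> norm (r::real^2)"
      using finite_I by (simp add: AE_finite_all)
    with AE_lborel_norm_neq[where 'a="real^2" and \<rho>=0] show ?thesis by eventually_elim auto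
  qed
  have pt: "ennreal (W (X + r) (X - r) / (norm r)\<^sup>2) \<le> ennreal (pi / (2 * a\<^sup>2)) * ?J r"
    if r: "r \<noteq> 0" and nz: "\<And>l. l \<in> I \<Longrightarrow> norm (z l - X) \<noteq> norm r" for r
  proof -
    have "ennreal (W (X + r) (X - r) / (norm r)\<^sup>2) = ennreal (1 / (4 * a\<^sup>2 * (norm r)\<^sup>2)) * ennreal (4 * a\<^sup>2 * W (X + r) (X - r))"
      using a_pos r by (simp add: ennreal_mult[symmetric] W_nonneg)
    also have "\<dots> \<le> ennreal (1 / (4 * a\<^sup>2 * (norm r)\<^sup>2)) * (ennreal (2 * pi * (norm r)\<^sup>2) * ?J r)"
      by (intro mult_left_mono hardy_pointwise that) auto
    also have "\<dots> = ennreal (1 / (4 * a\<^sup>2 * (norm r)\<^sup>2) * (2 * pi * (norm r)\<^sup>2)) * ?J r"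
      unfolding mult.assoc[symmetric] by (subst ennreal_mult[symmetric]) auto
    also have "1 / (4 * a\<^sup>2 * (norm r)\<^sup>2) * (2 * pi * (norm r)\<^sup>2) = pi / (2 * a\<^sup>2)"
      using a_pos r by (simp add: field_simps)
    finally show ?thesis .
  qed
  have "(\<integral>\<^sup>+r. ennreal (W (X + r) (X - r) / (norm r)\<^sup>2) * indicator (ball 0 R) r \<partial>lborel)
     \<le> (\<integral>\<^sup>+r. ennreal (pi / (2 * a\<^sup>2)) * (\<integral>\<^sup>+\<theta>. ennreal (E (X + rot \<theta> r) (X - rot \<theta> r)) * indicator (ball 0 R) (rot \<theta> r) * indicator {0..pi} \<theta> \<partial>lborel) \<partial>lborel)"
    using AE by (intro nn_integral_mono_AE, eventually_elim)
      (use pt in \<open>auto split: split_indicator simp: dist_norm\<close>)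
  also have "\<dots> = ennreal (pi / (2 * a\<^sup>2)) * (\<integral>\<^sup>+r. \<integral>\<^sup>+\<theta>. ennreal (E (X + rot \<theta> r) (X - rot \<theta> r)) * indicator (ball 0 R) (rot \<theta> r) * indicator {0..pi} \<theta> \<partial>lborel \<partial>lborel)"
    by (rule nn_integral_cmult) measurable
  also have "(\<integral>\<^sup>+r. \<integral>\<^sup>+\<theta>. ennreal (E (X + rot \<theta> r) (X - rot \<theta> r)) * indicator (ball 0 R) (rot \<theta> r) * indicator {0..pi} \<theta> \<partial>lborel \<partial>lborel)
     = (\<integral>\<^sup>+\<theta>. \<integral>\<^sup>+r. ennreal (E (X + rot \<theta> r) (X - rot \<theta> r)) * indicator (ball 0 R) (rot \<theta> r) * indicator {0..pi} \<theta> \<partial>lborel \<partial>lborel)"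
    by (rule lborel_pair.Fubini'[symmetric]) measurable
  also have "\<dots> = (\<integral>\<^sup>+\<theta>. (\<integral>\<^sup>+r. ennreal (E (X + r) (X - r)) * indicator (ball 0 R) r \<partial>lborel) * indicator {0..pi} \<theta> \<partial>lborel)"
  proof (intro nn_integral_cong)
    fix \<theta> :: real
    have "(\<integral>\<^sup>+r. ennreal (E (X + rot \<theta> r) (X - rot \<theta> r)) * indicator (ball 0 R) (rot \<theta> r) * indicator {0..pi} \<theta> \<partial>lborel)
      = (\<integral>\<^sup>+r. ennreal (E (X + r) (X - r)) * indicator (ball 0 R) r * indicator {0..pi} \<theta> \<partial>lborel)"
      by (rule nn_integral_rot[of "\<lambda>r. ennreal (E (X + r) (X - r)) * indicator (ball 0 R) r * indicator {0..pi} \<theta>"]) measurable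
    then show "(\<integral>\<^sup>+r. ennreal (E (X + rot \<theta> r) (X - rot \<theta> r)) * indicator (ball 0 R) (rot \<theta> r) * indicator {0..pi} \<theta> \<partial>lborel)
      = (\<integral>\<^sup>+r. ennreal (E (X + r) (X - r)) * indicator (ball 0 R) r \<partial>lborel) * indicator {0..pi} \<theta>"
      by (simp add: nn_integral_multc)
  qed
  also have "\<dots> = (\<integral>\<^sup>+r. ennreal (E (X + r) (X - r)) * indicator (ball 0 R) r \<partial>lborel) * ennreal pi"
    by (simp add: nn_integral_cmult)
  finally have "(\<integral>\<^sup>+r. ennreal (W (X + r) (X - r) / (norm r)\<^sup>2) * indicator (ball 0 R) r \<partial>lborel)
    \<le> ennreal (pi / (2 * a\<^sup>2)) * ((\<integral>\<^sup>+r. ennreal (E (X + r) (X - r)) * indicator (ball 0 R) r \<partial>lborel) * ennreal pi)" .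
  moreover have "ennreal (pi\<^sup>2 / (2 * a\<^sup>2)) = ennreal (pi / (2 * a\<^sup>2)) * ennreal pi"
    by (simp add: ennreal_mult[symmetric] power2_eq_square)
  ultimately show ?thesis by (simp only: mult_ac)
qed

text \<open>As \<open>F\<close> vanishes at coincidences, \<open>W\<close> is the integral of its
  radial derivative, which is bounded by \<open>|F|\<close> times the root of \<open>E\<close>.
  Pairing \<open>|F| / |y|\<close>, controlled by the Hardy inequality, with the root of
  \<open>E\<close> gives \<open>1 / a\<close>; bounding \<open>W\<close> directly by the Hardy
  inequality would give \<open>1 / a^2\<close>.\<close>

lemma radial_bound:
  assumes R: "R > 0"
  shows "(\<integral>\<^sup>+r. ennreal (W (X + r) (X - r)) * indicator (ball 0 R) r \<partial>lborel)
   \<le> ennreal (pi * R\<^sup>2 / a) * (\<integral>\<^sup>+r. ennreal (E (X + r) (X - r)) * indicator (ball 0 R) r \<partial>lborel)"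
proof -
  have [measurable]: "ball (0::real^2) R \<in> sets borel" by simp
  define G where "G y = ennreal (2 * sqrt 2 * cmod (F (X + y) (X - y)) * sqrt (E (X + y) (X - y)))" for y
  have G [measurable]: "G \<in> borel_measurable borel" unfolding G_def by measurable
  have 1: "ennreal (W (X + r) (X - r)) \<le> (\<integral>\<^sup>+s. ennreal (norm r) * G (s *\<^sub>R r) * indicator {0..1} s \<partial>lborel)" for r
  proof -
    have n: "norm (r, - r) = sqrt 2 * norm r" by (simp add: norm_Pair real_sqrt_mult)
    have "W X X = 0" by (simp add: W_def F_diag)
    with W_segment[of 0 X r X "- r"] show ?thesis
      unfolding n G_def by (simp add: ennreal_mult[symmetric] E_nonneg mult_ac)
  qed
  have "(\<integral>\<^sup>+r. ennreal (W (X + r) (X - r)) * indicator (ball 0 R) r \<partial>lborel)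
    \<le> (\<integral>\<^sup>+r. (\<integral>\<^sup>+s. ennreal (norm r) * G (s *\<^sub>R r) * indicator {0..1} s * indicator (ball 0 R) r \<partial>lborel) \<partial>lborel)"
    using 1 by (intro nn_integral_mono) (auto split: split_indicator)
  also have "\<dots> = (\<integral>\<^sup>+s. (\<integral>\<^sup>+r. ennreal (norm r) * G (s *\<^sub>R r) * indicator {0..1} s * indicator (ball 0 R) r \<partial>lborel) \<partial>lborel)"
    by (rule lborel_pair.Fubini'[symmetric]) measurable
  \<comment> \<open>Substitute \<open>y = s r\<close>: the area element gives
    \<open>1 / s^2\<close>, the factor \<open>norm r\<close> another \<open>1 / s\<close>, and the
    disc becomes the condition \<open>norm y / R < s\<close>. The value \<open>s = 0\<close> is
    negligible.\<close>
  also have "\<dots> \<le> (\<integral>\<^sup>+s. (\<integral>\<^sup>+y. ennreal (1 / s^3) * indicator {norm y / R<..1} s * (ennreal (norm y) * G y) \<partial>lborel) \<partial>lborel)"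
  proof (intro nn_integral_mono_AE)
    show "AE s in lborel. (\<integral>\<^sup>+r. ennreal (norm r) * G (s *\<^sub>R r) * indicator {0..1} s * indicator (ball 0 R) r \<partial>lborel)
      \<le> (\<integral>\<^sup>+y. ennreal (1 / s^3) * indicator {norm y / R<..1} s * (ennreal (norm y) * G y) \<partial>lborel)"
      using AE_lborel_singleton[of "0::real"]
    proof eventually_elim
      case (elim s)
      show ?case
      proof (cases "s \<in> {0..1}")
        case True
        then have s: "s > 0" "s \<le> 1" using elim by auto
        let ?g = "\<lambda>y. ennreal (1 / s^3) * indicator {norm y / R<..1} s * (ennreal (norm y) * G y)"
        have "(\<lambda>y::real^2. ennreal (1 / s^3) * (if norm y / R < s \<and> s \<le> 1 then 1 else 0) * (ennreal (norm y) * G y)) \<in> borel_measurable borel"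
          by measurable
        then have gm [measurable]: "?g \<in> borel_measurable borel" by (simp add: indicator_def)
        have "(\<integral>\<^sup>+y. ?g y \<partial>lborel) = ennreal (s\<^sup>2) * (\<integral>\<^sup>+r. ?g (0 + s *\<^sub>R r) \<partial>lborel)"
          using nn_integral_lborel_affine[OF gm s(1), of 0] by simp
        also have "\<dots> = (\<integral>\<^sup>+r. ennreal (s\<^sup>2) * ?g (0 + s *\<^sub>R r) \<partial>lborel)"
          by (rule nn_integral_cmult[symmetric]) (rule measurable_compose[OF _ gm], measurable)
        also have "\<dots> = (\<integral>\<^sup>+r. ennreal (norm r) * G (s *\<^sub>R r) * indicator {0..1} s * indicator (ball 0 R) r \<partial>lborel)"
        proof (intro nn_integral_cong)
          fix r :: "real^2"
          have i: "indicator {norm (0 + s *\<^sub>R r) / R<..1} s = (indicator (ball 0 R) r :: ennreal)"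
            using s R by (auto split: split_indicator simp: field_simps)
          have e: "ennreal (s\<^sup>2) * (ennreal (1 / s^3) * ennreal (norm (0 + s *\<^sub>R r))) = ennreal (norm r)"
            using s by (simp add: ennreal_mult[symmetric] power2_eq_square power3_eq_cube)
          have t: "indicator {0..1} s = (1::ennreal)" using True by simp
          show "ennreal (s\<^sup>2) * ?g (0 + s *\<^sub>R r) = ennreal (norm r) * G (s *\<^sub>R r) * indicator {0..1} s * indicator (ball 0 R) r"
            unfolding i t e[symmetric] by (simp only: mult_ac mult_1_right mult_1_left add_0_left)
        qed
        finally show ?thesis by simp
      qed simp
    qed
  qed
  also have "\<dots> = (\<integral>\<^sup>+y. (\<integral>\<^sup>+s. ennreal (1 / s^3) * indicator {norm y / R<..1} s * (ennreal (norm y) * G y) \<partial>lborel) \<partial>lborel)"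
  proof (rule lborel_pair.Fubini')
    have "(\<lambda>(y::real^2, s). ennreal (1 / s^3) * (if norm y / R < s \<and> s \<le> 1 then 1 else 0) * (ennreal (norm y) * G y)) \<in> borel_measurable (lborel \<Otimes>\<^sub>M lborel)"
      by measurable
    then show "(\<lambda>(y, s). ennreal (1 / s^3) * indicator {norm y / R<..1} s * (ennreal (norm y) * G y)) \<in> borel_measurable (lborel \<Otimes>\<^sub>M lborel)"
      by (simp add: indicator_def)
  qed
  \<comment> \<open>The \<open>s\<close>-integral leaves the weight \<open>R^2 / (2 |y|^2)\<close>.
    The coefficients \<open>a / pi\<close> and \<open>pi / (2 a)\<close> in Young's inequality are
    balanced: once the Hardy inequality is applied to the first term, both are
    \<open>pi R^2 / (2 a)\<close> times the energy.\<close>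
  also have "\<dots> \<le> (\<integral>\<^sup>+y. ennreal (R\<^sup>2 * (a / pi)) * (ennreal (W (X + y) (X - y) / (norm y)\<^sup>2) * indicator (ball 0 R) y)
       + ennreal (R\<^sup>2 * pi / (2 * a)) * (ennreal (E (X + y) (X - y)) * indicator (ball 0 R) y) \<partial>lborel)"
  proof (intro nn_integral_mono)
    fix y :: "real^2"
    let ?f = "cmod (F (X + y) (X - y))" and ?E = "E (X + y) (X - y)"
    consider "y = 0" | "y \<noteq> 0" "norm y < R" | "norm y \<ge> R" by linarith
    then show "(\<integral>\<^sup>+s. ennreal (1 / s^3) * indicator {norm y / R<..1} s * (ennreal (norm y) * G y) \<partial>lborel) \<le>
      ennreal (R\<^sup>2 * (a / pi)) * (ennreal (W (X + y) (X - y) / (norm y)\<^sup>2) * indicator (ball 0 R) y)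
       + ennreal (R\<^sup>2 * pi / (2 * a)) * (ennreal ?E * indicator (ball 0 R) y)"
    proof cases
      case 1 then show ?thesis by simp
    next
      case 3
      then have "{norm y / R<..1} = {}" using R by (auto simp: field_simps)
      then show ?thesis by simp
    next
      case 2
      define n where "n = norm y"
      have n: "n > 0" using 2 by (simp add: n_def)
      have "(\<integral>\<^sup>+s. ennreal (1 / s^3) * indicator {norm y / R<..1} s * (ennreal (norm y) * G y) \<partial>lborel)
        = (\<integral>\<^sup>+s. ennreal (1 / s^3) * indicator {norm y / R<..1} s \<partial>lborel) * (ennreal (norm y) * G y)"
        by (rule nn_integral_multc) measurable
      also have "\<dots> \<le> ennreal (1 / (2 * (norm y / R)\<^sup>2)) * (ennreal (norm y) * G y)"
        using 2 R by (intro mult_right_mono nn_integral_inverse_cube) auto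
      also have "\<dots> = ennreal (R\<^sup>2 * (sqrt 2 * ?f / n * sqrt ?E))"
        unfolding G_def n_def[symmetric] using n R
        by (simp add: ennreal_mult[symmetric] E_nonneg power_divide field_simps power2_eq_square)
      also have "\<dots> \<le> ennreal (R\<^sup>2 * (a / pi) * (?f\<^sup>2 / n\<^sup>2) + R\<^sup>2 * pi / (2 * a) * ?E)"
      proof (rule ennreal_leI)
        define u where "u = ?f / n"
        define e where "e = sqrt ?E"
        have "0 \<le> (sqrt 2 * a * u - pi * e)\<^sup>2" by simp
        then have "2 * pi * a * (sqrt 2 * u * e) \<le> 2 * a\<^sup>2 * u\<^sup>2 + pi\<^sup>2 * e\<^sup>2"
          by (simp add: power2_diff power_mult_distrib algebra_simps)
        then have "sqrt 2 * u * e \<le> (a / pi) * u\<^sup>2 + pi / (2 * a) * e\<^sup>2"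
          using a_pos by (simp add: field_simps power2_eq_square)
        then have "R\<^sup>2 * (sqrt 2 * u * e) \<le> R\<^sup>2 * ((a / pi) * u\<^sup>2 + pi / (2 * a) * e\<^sup>2)"
          by (intro mult_left_mono) auto
        then show "R\<^sup>2 * (sqrt 2 * ?f / n * sqrt ?E) \<le> R\<^sup>2 * (a / pi) * (?f\<^sup>2 / n\<^sup>2) + R\<^sup>2 * pi / (2 * a) * ?E"
          by (simp add: u_def e_def E_nonneg power_divide algebra_simps)
      qed
      also have "\<dots> = ennreal (R\<^sup>2 * (a / pi)) * ennreal (?f\<^sup>2 / n\<^sup>2) + ennreal (R\<^sup>2 * pi / (2 * a)) * ennreal ?E"
        using a_pos by (simp add: ennreal_mult[symmetric] E_nonneg ennreal_plus)
      finally show ?thesis using 2 by (simp add: W_def n_def)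
    qed
  qed
  also have "\<dots> = ennreal (R\<^sup>2 * (a / pi)) * (\<integral>\<^sup>+y. (ennreal (W (X + y) (X - y) / (norm y)\<^sup>2) * indicator (ball 0 R) y) \<partial>lborel)
       + ennreal (R\<^sup>2 * pi / (2 * a)) * (\<integral>\<^sup>+y. (ennreal (E (X + y) (X - y)) * indicator (ball 0 R) y) \<partial>lborel)"
    by (subst nn_integral_add; (subst nn_integral_cmult)?; measurable?) (simp add: nn_integral_cmult)
  also have "\<dots> \<le> ennreal (R\<^sup>2 * (a / pi)) * (ennreal (pi\<^sup>2 / (2 * a\<^sup>2)) * (\<integral>\<^sup>+r. ennreal (E (X + r) (X - r)) * indicator (ball 0 R) r \<partial>lborel))
       + ennreal (R\<^sup>2 * pi / (2 * a)) * (\<integral>\<^sup>+y. (ennreal (E (X + y) (X - y)) * indicator (ball 0 R) y) \<partial>lborel)"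
    by (intro add_right_mono mult_left_mono hardy) auto
  also have "\<dots> = ennreal (pi * R\<^sup>2 / a) * (\<integral>\<^sup>+y. (ennreal (E (X + y) (X - y)) * indicator (ball 0 R) y) \<partial>lborel)"
  proof -
    have c: "ennreal (R\<^sup>2 * (a / pi)) * ennreal (pi\<^sup>2 / (2 * a\<^sup>2)) + ennreal (R\<^sup>2 * pi / (2 * a)) = ennreal (pi * R\<^sup>2 / a)"
    proof -
      have "R\<^sup>2 * (a / pi) * (pi\<^sup>2 / (2 * a\<^sup>2)) + R\<^sup>2 * pi / (2 * a) = pi * R\<^sup>2 / a"
        using a_pos by (simp add: field_simps power2_eq_square)
      then show ?thesis
        using a_pos by (subst ennreal_mult[symmetric], simp, simp, subst ennreal_plus[symmetric]) auto
    qed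
    show ?thesis unfolding c[symmetric] by (simp add: distrib_right mult.assoc)
  qed
  finally show ?thesis .
qed

end

text \<open>Half-open, so that a square is the disjoint union of its four quarters.\<close>

definition sq :: "real^2 \<Rightarrow> real \<Rightarrow> (real^2) set" where
  "sq p L = {x. \<forall>c. p $ c \<le> x $ c \<and> x $ c < p $ c + L}"

lemma mem_sq: "x \<in> sq p L \<longleftrightarrow> (p$1 \<le> x$1 \<and> x$1 < p$1 + L) \<and> (p$2 \<le> x$2 \<and> x$2 < p$2 + L)"
  by (simp add: sq_def forall_2)

lemma sets_sq [measurable]: "sq p L \<in> sets borel"
proof -
  have c: "continuous_on UNIV (\<lambda>x::real^2. x $ c)" for c by (intro continuous_intros)
  have [measurable]: "(\<lambda>x::real^2. x $ c) \<in> borel_measurable borel" for c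
    by (rule borel_measurable_continuous_onI[OF c])
  have "sq p L = {x \<in> space borel. (p$1 \<le> x$1 \<and> x$1 < p$1 + L) \<and> (p$2 \<le> x$2 \<and> x$2 < p$2 + L)}"
    by (auto simp: mem_sq)
  also have "\<dots> \<in> sets borel" by measurable
  finally show ?thesis .
qed

lemma norm_power2_real2: "(norm x)\<^sup>2 = (x$1)\<^sup>2 + (x$2)\<^sup>2" for x :: "real^2"
  unfolding power2_norm_eq_inner by (simp add: inner_vec_def sum_2 power2_eq_square)

section \<open>Exclusion for a pair in a square\<close>

context anyon_pair begin

text \<open>If both particles lie in the middle third, so does their centre, and the components of
  \<open>r\<close> are at most \<open>L / 6\<close>, whence \<open>norm r < L / 4\<close>.
  Conversely, around a centre in the middle third every pair with \<open>norm r < L / 4\<close>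
  stays in the square, because \<open>L / 4 < L / 3\<close>. So discs of radius \<open>L / 4\<close>
  are suitable on both sides.\<close>

lemma pair_inner_square:
  fixes p :: "real^2"
  assumes L: "L > 0"
  defines "Q \<equiv> sq p L" and "Q' \<equiv> sq (\<chi> c. p $ c + L / 3) (L / 3)"
  shows "(\<integral>\<^sup>+y. \<integral>\<^sup>+x. ennreal (W x y) * (indicator Q' x * indicator Q' y) \<partial>lborel \<partial>lborel)
    \<le> ennreal (pi * (L / 4)\<^sup>2 / a) * (\<integral>\<^sup>+y. \<integral>\<^sup>+x. ennreal (E x y) * (indicator Q x * indicator Q y) \<partial>lborel \<partial>lborel)"
proof -
  have [measurable]: "Q \<in> sets borel" "Q' \<in> sets borel" unfolding Q_def Q'_def by measurable
  have [measurable]: "ball (0::real^2) (L/4) \<in> sets borel" by simp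
  let ?c = "ennreal (pi * (L / 4)\<^sup>2 / a)"
  have g1: "X \<in> Q' \<and> r \<in> ball 0 (L/4)" if "X + r \<in> Q'" "X - r \<in> Q'" for X r
  proof
    show "X \<in> Q'" using that by (auto simp: Q'_def mem_sq)
    have "\<bar>r$1\<bar> \<le> L/6" "\<bar>r$2\<bar> \<le> L/6" using that by (auto simp: Q'_def mem_sq)
    then have "\<bar>r$1\<bar>\<^sup>2 \<le> (L/6)\<^sup>2" "\<bar>r$2\<bar>\<^sup>2 \<le> (L/6)\<^sup>2" by (intro power_mono; simp)+
    then have "(norm r)\<^sup>2 \<le> 2 * (L/6)\<^sup>2" unfolding norm_power2_real2 by simp
    also have "\<dots> < (L/4)\<^sup>2" using L by (simp add: power2_eq_square)
    finally have "norm r < L/4" using L by (meson less_eq_real_def power_less_imp_less_base zero_le_divide_iff zero_le_numeral)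
    then show "r \<in> ball 0 (L/4)" by simp
  qed
  have g2: "X + r \<in> Q \<and> X - r \<in> Q" if "X \<in> Q'" "r \<in> ball 0 (L/4)" for X r
  proof -
    have "\<bar>r$1\<bar> < L/4" "\<bar>r$2\<bar> < L/4"
      using that(2) component_le_norm_cart[of r 1] component_le_norm_cart[of r 2] by auto
    then show ?thesis using that(1) L by (auto simp: Q_def Q'_def mem_sq)
  qed
  have s1: "(\<integral>\<^sup>+r. ennreal (W (X + r) (X - r)) * (indicator Q' (X + r) * indicator Q' (X - r)) \<partial>lborel)
     \<le> indicator Q' X * (\<integral>\<^sup>+r. ennreal (W (X + r) (X - r)) * indicator (ball 0 (L/4)) r \<partial>lborel)" for X
  proof -
    have "(\<integral>\<^sup>+r. ennreal (W (X + r) (X - r)) * (indicator Q' (X + r) * indicator Q' (X - r)) \<partial>lborel)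
      \<le> (\<integral>\<^sup>+r. indicator Q' X * (ennreal (W (X + r) (X - r)) * indicator (ball 0 (L/4)) r) \<partial>lborel)"
      using g1 by (intro nn_integral_mono) (auto split: split_indicator)
    then show ?thesis by (simp add: nn_integral_cmult)
  qed
  have s2: "indicator Q' X * (\<integral>\<^sup>+r. ennreal (E (X + r) (X - r)) * indicator (ball 0 (L/4)) r \<partial>lborel)
     \<le> (\<integral>\<^sup>+r. ennreal (E (X + r) (X - r)) * (indicator Q (X + r) * indicator Q (X - r)) \<partial>lborel)" for X
  proof -
    have "(\<integral>\<^sup>+r. indicator Q' X * (ennreal (E (X + r) (X - r)) * indicator (ball 0 (L/4)) r) \<partial>lborel)
      \<le> (\<integral>\<^sup>+r. ennreal (E (X + r) (X - r)) * (indicator Q (X + r) * indicator Q (X - r)) \<partial>lborel)"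
      using g2 by (intro nn_integral_mono) (auto split: split_indicator)
    then show ?thesis by (simp add: nn_integral_cmult)
  qed
  have "(\<integral>\<^sup>+y. \<integral>\<^sup>+x. ennreal (W x y) * (indicator Q' x * indicator Q' y) \<partial>lborel \<partial>lborel)
     = ennreal 4 * (\<integral>\<^sup>+X. \<integral>\<^sup>+r. ennreal (W (X + r) (X - r)) * (indicator Q' (X + r) * indicator Q' (X - r)) \<partial>lborel \<partial>lborel)"
    by (subst nn_integral_lborel_centre_relative) (auto simp: borel_prod[symmetric])
  also have "\<dots> \<le> ennreal 4 * (\<integral>\<^sup>+X. indicator Q' X * (\<integral>\<^sup>+r. ennreal (W (X + r) (X - r)) * indicator (ball 0 (L/4)) r \<partial>lborel) \<partial>lborel)"
    by (intro mult_left_mono nn_integral_mono s1) simp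
  also have "\<dots> \<le> ennreal 4 * (\<integral>\<^sup>+X. indicator Q' X * (?c * (\<integral>\<^sup>+r. ennreal (E (X + r) (X - r)) * indicator (ball 0 (L/4)) r \<partial>lborel)) \<partial>lborel)"
    using L by (intro mult_left_mono nn_integral_mono radial_bound) auto
  also have "\<dots> = ennreal 4 * (?c * (\<integral>\<^sup>+X. indicator Q' X * ((\<integral>\<^sup>+r. ennreal (E (X + r) (X - r)) * indicator (ball 0 (L/4)) r \<partial>lborel)) \<partial>lborel))"
    by (subst nn_integral_cmult[symmetric]) (auto simp: mult_ac)
  also have "\<dots> \<le> ennreal 4 * (?c * (\<integral>\<^sup>+X. \<integral>\<^sup>+r. ennreal (E (X + r) (X - r)) * (indicator Q (X + r) * indicator Q (X - r)) \<partial>lborel \<partial>lborel))"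
    by (intro mult_left_mono nn_integral_mono s2) simp_all
  also have "\<dots> = ?c * (\<integral>\<^sup>+y. \<integral>\<^sup>+x. ennreal (E x y) * (indicator Q x * indicator Q y) \<partial>lborel \<partial>lborel)"
    by (subst nn_integral_lborel_centre_relative) (auto simp: borel_prod[symmetric] mult_ac)
  finally show ?thesis .
qed

text \<open>Finiteness is what permits subtracting half of this integral from both sides of an
  estimate between extended reals.\<close>

lemma finite_pair_square:
  "(\<integral>\<^sup>+q. ennreal (W (fst q) (snd q)) * indicator (sq p L \<times> sq p L) q \<partial>lborel) < \<infinity>"
proof -
  define K where "K = cbox (p, p) ((\<chi> c. p $ c + L), (\<chi> c. p $ c + L))"
  have sub: "sq p L \<times> sq p L \<subseteq> K"
    by (auto simp: K_def sq_def mem_box_cart cbox_Pair_eq less_imp_le)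
  have "compact ((\<lambda>q. W (fst q) (snd q)) ` K)"
    unfolding W_def K_def by (intro compact_continuous_image continuous_intros) auto
  then have "bounded ((\<lambda>q. W (fst q) (snd q)) ` K)" by (rule compact_imp_bounded)
  then obtain B where B: "\<And>q. q \<in> K \<Longrightarrow> W (fst q) (snd q) \<le> B"
    by (auto simp: bounded_iff) (metis abs_le_D1 surj_pair fst_conv snd_conv)
  have "(\<integral>\<^sup>+q. ennreal (W (fst q) (snd q)) * indicator (sq p L \<times> sq p L) q \<partial>lborel) \<le> (\<integral>\<^sup>+q. ennreal B * indicator K q \<partial>lborel)"
    using sub B by (intro nn_integral_mono) (auto split: split_indicator intro!: ennreal_leI)
  also have "\<dots> = ennreal B * emeasure lborel K" by (simp add: K_def nn_integral_cmult)
  also have "\<dots> < \<infinity>"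
    using emeasure_lborel_cbox_finite[of "(p, p)"] by (auto simp: K_def ennreal_mult_less_top)
  finally show ?thesis .
qed

text \<open>Contraction by \<open>1/3\<close> towards the centre of the square moves every pair into
  the middle third. \<open>W\<close> at the pair is compared with \<open>W\<close> at its image
  along the connecting segment, and Young's inequality with the free parameter \<open>\<eta>\<close>
  splits the error into mass and energy.\<close>

lemma pair_transport:
  fixes p :: "real^2"
  assumes L: "L > 0" and \<eta>: "\<eta> > 0"
  defines "Q \<equiv> sq p L \<times> sq p L" and "Q' \<equiv> sq (\<chi> c. p $ c + L / 3) (L / 3) \<times> sq (\<chi> c. p $ c + L / 3) (L / 3)"
  shows "(\<integral>\<^sup>+q. ennreal (W (fst q) (snd q)) * indicator Q q \<partial>lborel)
    \<le> ennreal 81 * (\<integral>\<^sup>+q. ennreal (W (fst q) (snd q)) * indicator Q' q \<partial>lborel)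
     + ennreal 54 * (\<integral>\<^sup>+q. ennreal (L * (\<eta> * W (fst q) (snd q) + E (fst q) (snd q) / \<eta>)) * indicator Q q \<partial>lborel)"
proof -
  have [measurable]: "(fst :: (real^2) \<times> (real^2) \<Rightarrow> _) \<in> borel_measurable borel"
      "(snd :: (real^2) \<times> (real^2) \<Rightarrow> _) \<in> borel_measurable borel"
    by (auto intro!: borel_measurable_continuous_onI continuous_intros)
  have [measurable]: "Q \<in> sets borel" "Q' \<in> sets borel"
    unfolding Q_def Q'_def by (auto intro!: borel_Times)
  define c0 :: "real^2" where "c0 = (\<chi> c. p $ c + L / 2)"
  define S where "S s q = (1 - s) *\<^sub>R (c0, c0) + s *\<^sub>R q" for s and q :: "(real^2) \<times> (real^2)"
  define g where "g q = ennreal (L * (\<eta> * W (fst q) (snd q) + E (fst q) (snd q) / \<eta>))" for q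
  have [measurable]: "g \<in> borel_measurable borel" unfolding g_def by measurable
  have S: "S s q = (c0 + s *\<^sub>R (fst q - c0), c0 + s *\<^sub>R (snd q - c0))" for s q
    by (cases q) (simp add: S_def algebra_simps)
  have inQ: "S s q \<in> Q" if "q \<in> Q" "0 \<le> s" "s \<le> 1" for s q
  proof -
    have *: "l \<le> (l + L/2) + s * (v - (l + L/2)) \<and> (l + L/2) + s * (v - (l + L/2)) < l + L" if "l \<le> v" "v < l + L" for l v :: real
    proof -
      have "s * (v - (l + L/2)) \<ge> s * (- L/2)" "s * (v - (l + L/2)) \<le> s * (L/2)" using that \<open>0 \<le> s\<close> by (intro mult_left_mono; simp)+
      moreover have "s * (L/2) \<le> 1 * (L/2)" using \<open>s \<le> 1\<close> L by (intro mult_right_mono) auto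
      moreover have "s * (v - (l + L/2)) < L/2"
      proof (cases "s = 0")
        case False
        then have "s * (v - (l + L/2)) < s * (L/2)" using that \<open>0 \<le> s\<close> by (intro mult_strict_left_mono) auto
        with \<open>s * (L/2) \<le> 1 * (L/2)\<close> show ?thesis by simp
      qed (use L in simp)
      ultimately show ?thesis by linarith
    qed
    show ?thesis using that(1) * unfolding S Q_def by (auto simp: mem_sq c0_def)
  qed
  have inQ': "S (1/3) q \<in> Q'" if "q \<in> Q" for q
    using that unfolding S Q_def Q'_def by (auto simp: mem_sq c0_def field_simps)
  \<comment> \<open>\<open>L\<close> is half the diagonal of a four-dimensional cube of side
    \<open>L\<close>.\<close>
  have nrm: "norm (fst q - c0, snd q - c0) \<le> L" if "q \<in> Q" for q
  proof -
    have "\<bar>(fst q - c0)$1\<bar> \<le> L/2" "\<bar>(fst q - c0)$2\<bar> \<le> L/2" "\<bar>(snd q - c0)$1\<bar> \<le> L/2" "\<bar>(snd q - c0)$2\<bar> \<le> L/2"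
      using that by (auto simp: Q_def mem_sq c0_def abs_le_iff field_simps)
    then have "\<bar>(fst q - c0)$1\<bar>\<^sup>2 \<le> (L/2)\<^sup>2" "\<bar>(fst q - c0)$2\<bar>\<^sup>2 \<le> (L/2)\<^sup>2" "\<bar>(snd q - c0)$1\<bar>\<^sup>2 \<le> (L/2)\<^sup>2" "\<bar>(snd q - c0)$2\<bar>\<^sup>2 \<le> (L/2)\<^sup>2"
      by (intro power_mono; simp)+
    then have "(norm (fst q - c0))\<^sup>2 + (norm (snd q - c0))\<^sup>2 \<le> L\<^sup>2"
      unfolding norm_power2_real2 by (simp add: power_divide)
    then show ?thesis unfolding norm_Pair using L real_le_lsqrt by auto
  qed
  have pt: "ennreal (W (fst q) (snd q)) * indicator Q q \<le> ennreal (W (fst (S (1/3) q)) (snd (S (1/3) q))) * indicator Q' (S (1/3) q)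
       + (\<integral>\<^sup>+s. g (S s q) * indicator Q (S s q) * indicator {1/3..1} s \<partial>lborel)" for q
  proof (cases "q \<in> Q")
    case True
    have "ennreal (W (fst q) (snd q)) \<le> ennreal (W (fst (S (1/3) q)) (snd (S (1/3) q))) +
      (\<integral>\<^sup>+s. ennreal (2 * cmod (F (fst (S s q)) (snd (S s q))) * norm (fst q - c0, snd q - c0) * sqrt (E (fst (S s q)) (snd (S s q)))) * indicator {1/3..1} s \<partial>lborel)"
      using W_segment[of "1/3" c0 "fst q - c0" c0 "snd q - c0"] by (simp add: S)
    also have "\<dots> \<le> ennreal (W (fst (S (1/3) q)) (snd (S (1/3) q))) + (\<integral>\<^sup>+s. g (S s q) * indicator Q (S s q) * indicator {1/3..1} s \<partial>lborel)"
    proof (intro add_left_mono nn_integral_mono)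
      fix s :: real
      let ?f = "cmod (F (fst (S s q)) (snd (S s q)))" and ?E = "E (fst (S s q)) (snd (S s q))"
      have "2 * ?f * norm (fst q - c0, snd q - c0) * sqrt ?E \<le> L * (\<eta> * ?f\<^sup>2 + ?E / \<eta>)"
      proof -
        have "0 \<le> (\<eta> * ?f - sqrt ?E)\<^sup>2" by simp
        then have "2 * \<eta> * (?f * sqrt ?E) \<le> \<eta>\<^sup>2 * ?f\<^sup>2 + ?E"
          by (simp add: power2_diff power_mult_distrib E_nonneg algebra_simps)
        then have "2 * ?f * sqrt ?E \<le> \<eta> * ?f\<^sup>2 + ?E / \<eta>"
          using \<eta> by (simp add: field_simps power2_eq_square)
        then have "L * (2 * ?f * sqrt ?E) \<le> L * (\<eta> * ?f\<^sup>2 + ?E / \<eta>)" using L by (intro mult_left_mono) auto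
        moreover have "norm (fst q - c0, snd q - c0) * (2 * ?f * sqrt ?E) \<le> L * (2 * ?f * sqrt ?E)"
          by (intro mult_right_mono nrm[OF True]) (auto simp: E_nonneg)
        ultimately show ?thesis by (simp add: mult_ac)
      qed
      then show "ennreal (2 * ?f * norm (fst q - c0, snd q - c0) * sqrt ?E) * indicator {1/3..1} s \<le> g (S s q) * indicator Q (S s q) * indicator {1/3..1} s"
        using inQ[OF True, of s] by (auto split: split_indicator simp: g_def W_def intro!: ennreal_leI)
    qed
    finally show ?thesis using True inQ'[OF True] by simp
  qed simp
  have scale: "(\<integral>\<^sup>+q. f (S s q) \<partial>lborel) = ennreal (1 / s^4) * (\<integral>\<^sup>+q. f q \<partial>lborel)"
    if f: "f \<in> borel_measurable borel" and s: "s > 0" for f s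
  proof -
    have "(\<integral>\<^sup>+q. f q \<partial>lborel) = ennreal (s^4) * (\<integral>\<^sup>+q. f (S s q) \<partial>lborel)"
      using nn_integral_lborel_affine[OF f s, of "(1 - s) *\<^sub>R (c0, c0)"] unfolding S_def by simp
    then show ?thesis using s by (simp add: mult.assoc[symmetric] ennreal_mult[symmetric])
  qed
  have Sm [measurable]: "(\<lambda>(q, s). S s q) \<in> borel_measurable (lborel \<Otimes>\<^sub>M lborel)"
    "(\<lambda>q. S s q) \<in> borel_measurable borel" for s
    unfolding S_def by measurable
  have gQ: "(\<lambda>q. g q * indicator Q q) \<in> borel_measurable borel" by measurable
  have j: "(\<lambda>(q, s). g (S s q) * indicator Q (S s q) * indicator {1/3..1} s) \<in> borel_measurable (lborel \<Otimes>\<^sub>M lborel)"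
    using measurable_compose[OF Sm(1) gQ] by (simp add: case_prod_unfold)
  have w': "(\<lambda>q. ennreal (W (fst q) (snd q)) * indicator Q' q) \<in> borel_measurable borel" by measurable
  have "(\<integral>\<^sup>+q. ennreal (W (fst q) (snd q)) * indicator Q q \<partial>lborel) \<le>
     (\<integral>\<^sup>+q. ennreal (W (fst (S (1/3) q)) (snd (S (1/3) q))) * indicator Q' (S (1/3) q)
       + (\<integral>\<^sup>+s. g (S s q) * indicator Q (S s q) * indicator {1/3..1} s \<partial>lborel) \<partial>lborel)"
    by (intro nn_integral_mono pt)
  also have "\<dots> = (\<integral>\<^sup>+q. ennreal (W (fst (S (1/3) q)) (snd (S (1/3) q))) * indicator Q' (S (1/3) q) \<partial>lborel)
       + (\<integral>\<^sup>+q. (\<integral>\<^sup>+s. g (S s q) * indicator Q (S s q) * indicator {1/3..1} s \<partial>lborel) \<partial>lborel)"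
    using j by (intro nn_integral_add lborel.borel_measurable_nn_integral)
      (use measurable_compose[OF Sm(2) w'] in simp_all)
  also have "(\<integral>\<^sup>+q. ennreal (W (fst (S (1/3) q)) (snd (S (1/3) q))) * indicator Q' (S (1/3) q) \<partial>lborel)
     = ennreal 81 * (\<integral>\<^sup>+q. ennreal (W (fst q) (snd q)) * indicator Q' q \<partial>lborel)"
    by (subst scale[OF w']) (auto simp: power4_eq_xxxx)
  also have "(\<integral>\<^sup>+q. (\<integral>\<^sup>+s. g (S s q) * indicator Q (S s q) * indicator {1/3..1} s \<partial>lborel) \<partial>lborel)
     = (\<integral>\<^sup>+s. (\<integral>\<^sup>+q. g (S s q) * indicator Q (S s q) * indicator {1/3..1} s \<partial>lborel) \<partial>lborel)"
    by (rule lborel_pair.Fubini'[symmetric]) (rule j)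
  \<comment> \<open>In dimension four the change of variables costs \<open>1 / s^4\<close>, at most
    81 for \<open>s >= 1/3\<close>; the length \<open>2/3\<close> of the interval turns this into
    54.\<close>
  also have "\<dots> \<le> (\<integral>\<^sup>+s. ennreal 81 * (\<integral>\<^sup>+q. g q * indicator Q q \<partial>lborel) * indicator {1/3..1::real} s \<partial>lborel)"
  proof (intro nn_integral_mono)
    fix s :: real
    show "(\<integral>\<^sup>+q. g (S s q) * indicator Q (S s q) * indicator {1/3..1} s \<partial>lborel) \<le> ennreal 81 * (\<integral>\<^sup>+q. g q * indicator Q q \<partial>lborel) * indicator {1/3..1} s"
    proof (cases "s \<in> {1/3..1}")
      case True
      have "1 / s^4 \<le> 81"
      proof -
        have "(1/3)^4 \<le> s^4" using True by (intro power_mono) auto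
        then show ?thesis using True by (simp add: field_simps power4_eq_xxxx)
      qed
      then have "ennreal (1 / s^4) \<le> ennreal 81" by (rule ennreal_leI)
      with True scale[OF gQ, of s] show ?thesis by (auto intro!: mult_right_mono)
    qed simp
  qed
  also have "\<dots> = ennreal 81 * (\<integral>\<^sup>+q. g q * indicator Q q \<partial>lborel) * ennreal (2/3)"
    by (simp add: nn_integral_cmult)
  also have "\<dots> = ennreal 54 * (\<integral>\<^sup>+q. g q * indicator Q q \<partial>lborel)"
  proof -
    have "ennreal 54 = ennreal 81 * ennreal (2/3)" by (subst ennreal_mult[symmetric]) auto
    then show ?thesis by (simp only: mult_ac)
  qed
  finally show ?thesis unfolding g_def by (simp add: add_left_mono)
qed

lemma pair_exclusion:
  assumes L: "L > 0" and a1: "a \<le> 1"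
  shows "(\<integral>\<^sup>+y. \<integral>\<^sup>+x. ennreal (W x y) * (indicator (sq p L) x * indicator (sq p L) y) \<partial>lborel \<partial>lborel)
    \<le> ennreal (12000 * L\<^sup>2 / a) * (\<integral>\<^sup>+y. \<integral>\<^sup>+x. ennreal (E x y) * (indicator (sq p L) x * indicator (sq p L) y) \<partial>lborel \<partial>lborel)"
proof -
  have [measurable]: "(fst :: (real^2) \<times> (real^2) \<Rightarrow> _) \<in> borel_measurable borel"
      "(snd :: (real^2) \<times> (real^2) \<Rightarrow> _) \<in> borel_measurable borel"
    by (auto intro!: borel_measurable_continuous_onI continuous_intros)
  let ?Q = "sq p L" and ?Q' = "sq (\<chi> c. p $ c + L / 3) (L / 3)"
  have [measurable]: "?Q \<times> ?Q \<in> sets borel" by (auto intro!: borel_Times)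
  have conv: "(\<integral>\<^sup>+q. f (fst q) (snd q) * indicator (A \<times> A) q \<partial>lborel)
     = (\<integral>\<^sup>+y. \<integral>\<^sup>+x. f x y * (indicator A x * indicator A y) \<partial>lborel \<partial>lborel)"
    if f: "(\<lambda>q. f (fst q) (snd q)) \<in> borel_measurable borel" and A: "A \<in> sets borel"
    for f :: "real^2 \<Rightarrow> real^2 \<Rightarrow> ennreal" and A
  proof -
    have m: "(\<lambda>q. f (fst q) (snd q) * indicator (A \<times> A) q) \<in> borel_measurable (lborel \<Otimes>\<^sub>M lborel)"
      using f borel_Times[OF A A] by (simp add: lborel_prod)
    show ?thesis
      unfolding lborel_prod[symmetric] lborel_pair.nn_integral_snd[OF m, symmetric]
      by (simp add: indicator_times)
  qed
  have mW: "(\<lambda>q. ennreal (W (fst q) (snd q))) \<in> borel_measurable borel" by measurable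
  have mE: "(\<lambda>q. ennreal (E (fst q) (snd q))) \<in> borel_measurable borel" by measurable
  define w where "w = (\<integral>\<^sup>+q. ennreal (W (fst q) (snd q)) * indicator (?Q \<times> ?Q) q \<partial>lborel)"
  define e where "e = (\<integral>\<^sup>+q. ennreal (E (fst q) (snd q)) * indicator (?Q \<times> ?Q) q \<partial>lborel)"
  define w' where "w' = (\<integral>\<^sup>+q. ennreal (W (fst q) (snd q)) * indicator (?Q' \<times> ?Q') q \<partial>lborel)"
  \<comment> \<open>This makes \<open>54 * L * \<eta> = 1/2\<close>, so half of \<open>w\<close>
    moves to the left side. Doubling the rest gives \<open>2 * 54 * 108 = 11664\<close> from
    transport and \<open>162 pi / (16 a)\<close> from the middle third, together at most
    \<open>12000 / a\<close> because \<open>a <= 1\<close>.\<close>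
  define \<eta> where "\<eta> = 1 / (108 * L)"
  have eta: "\<eta> > 0" using L by (simp add: \<eta>_def)
  have "w \<le> ennreal 81 * w' + ennreal 54 * (\<integral>\<^sup>+q. ennreal (L * (\<eta> * W (fst q) (snd q) + E (fst q) (snd q) / \<eta>)) * indicator (?Q \<times> ?Q) q \<partial>lborel)"
    unfolding w_def w'_def by (rule pair_transport[OF L eta])
  also have "(\<integral>\<^sup>+q. ennreal (L * (\<eta> * W (fst q) (snd q) + E (fst q) (snd q) / \<eta>)) * indicator (?Q \<times> ?Q) q \<partial>lborel)
    = (\<integral>\<^sup>+q. ennreal (1/108) * (ennreal (W (fst q) (snd q)) * indicator (?Q \<times> ?Q) q) + ennreal (108 * L\<^sup>2) * (ennreal (E (fst q) (snd q)) * indicator (?Q \<times> ?Q) q) \<partial>lborel)"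
  proof (intro nn_integral_cong)
    fix q
    have "L * (\<eta> * W (fst q) (snd q) + E (fst q) (snd q) / \<eta>) = (1/108) * W (fst q) (snd q) + (108 * L\<^sup>2) * E (fst q) (snd q)"
      using L by (simp add: \<eta>_def field_simps power2_eq_square)
    then show "ennreal (L * (\<eta> * W (fst q) (snd q) + E (fst q) (snd q) / \<eta>)) * indicator (?Q \<times> ?Q) q
      = ennreal (1/108) * (ennreal (W (fst q) (snd q)) * indicator (?Q \<times> ?Q) q) + ennreal (108 * L\<^sup>2) * (ennreal (E (fst q) (snd q)) * indicator (?Q \<times> ?Q) q)"
      using L by (simp add: ennreal_mult[symmetric] ennreal_plus[symmetric] W_nonneg E_nonneg del: ennreal_plus split: split_indicator)
  qed
  also have "\<dots> = ennreal (1/108) * w + ennreal (108 * L\<^sup>2) * e"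
    unfolding w_def e_def by (subst nn_integral_add) (auto simp: nn_integral_cmult)
  also have "w' \<le> ennreal (pi * (L / 4)\<^sup>2 / a) * e"
    using pair_inner_square[OF L, of p] unfolding w'_def e_def conv[OF mW sets_sq] conv[OF mE sets_sq] .
  finally have le: "w \<le> ennreal 81 * (ennreal (pi * (L / 4)\<^sup>2 / a) * e) + ennreal 54 * (ennreal (1/108) * w + ennreal (108 * L\<^sup>2) * e)"
    by (simp add: add_mono mult_left_mono)
  have wf: "w < \<infinity>" unfolding w_def by (rule finite_pair_square)
  have "w \<le> ennreal (12000 * L\<^sup>2 / a) * e"
  proof (cases e rule: ennreal_cases)
    case (real e')
    obtain w0 where w0: "w = ennreal w0" "w0 \<ge> 0" using wf by (cases w rule: ennreal_cases) auto
    have "w0 \<le> 81 * (pi * (L / 4)\<^sup>2 / a * e') + 54 * ((1/108) * w0 + 108 * L\<^sup>2 * e')"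
      using le w0(2) real(1) a_pos unfolding w0(1) real(2)
      by (simp add: ennreal_mult[symmetric] ennreal_plus[symmetric] del: ennreal_plus ennreal_numeral)
    then have "w0 \<le> (162 * pi / 16 / a + 11664) * (L\<^sup>2 * e')"
      by (simp add: power_divide algebra_simps)
    also have "\<dots> \<le> (12000 / a) * (L\<^sup>2 * e')"
    proof (intro mult_right_mono)
      have "162 * pi / 16 + 11664 * a \<le> 12000" using pi_less_4 a1 by simp
      then have "(162 * pi / 16 + 11664 * a) / a \<le> 12000 / a" using a_pos by (intro divide_right_mono) auto
      then show "162 * pi / 16 / a + 11664 \<le> 12000 / a" using a_pos by (simp add: add_divide_distrib)
    qed (use real in auto)
    finally show ?thesis using real a_pos w0 by (simp add: ennreal_mult[symmetric] ennreal_leI algebra_simps)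
  next
    case top
    then show ?thesis using L a_pos by (simp add: ennreal_mult_top)
  qed
  then show ?thesis unfolding w_def e_def conv[OF mW sets_sq] conv[OF mE sets_sq] .
qed

end

section \<open>Test functions\<close>

text \<open>Test functions come with derivatives along coordinate directions only. Continuity of
  these upgrades them to a total derivative, which the chain rule along circles and segments
  requires.\<close>

lemma has_derivative_real2:
  fixes \<phi> :: "real^2 \<Rightarrow> complex"
  assumes d: "\<And>a c. ((\<lambda>t. \<phi> (a + t *\<^sub>R axis c 1)) has_vector_derivative p c a) (at 0)"
    and cont: "\<And>c. continuous_on UNIV (p c)"
  shows "(\<phi> has_derivative (\<lambda>h. \<Sum>c\<in>UNIV. (h $ c) *\<^sub>R p c a)) (at a)"
proof -
  define e :: "real \<Rightarrow> real \<Rightarrow> real^2" where "e s t = s *\<^sub>R axis 1 1 + t *\<^sub>R axis 2 1" for s t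
  have x: "x = e (x$1) (x$2)" for x by (simp add: e_def vec_eq_iff forall_2 axis_def)
  have sh: "((\<lambda>u. u - s) has_vector_derivative 1) (at s)" for s :: real
    by (auto intro!: derivative_eq_intros)
  have d1: "((\<lambda>s. \<phi> (e s t)) has_vector_derivative p 1 (e s t)) (at s)" for s t
  proof -
    have "((\<lambda>u. \<phi> (e s t + u *\<^sub>R axis 1 1)) \<circ> (\<lambda>u. u - s) has_vector_derivative 1 *\<^sub>R p 1 (e s t)) (at s)"
      using d by (intro vector_diff_chain_at[OF sh]) simp
    then show ?thesis by (simp add: o_def e_def algebra_simps)
  qed
  have d2: "((\<lambda>t. \<phi> (e s t)) has_vector_derivative p 2 (e s t)) (at t)" for s t
  proof -
    have "((\<lambda>u. \<phi> (e s t + u *\<^sub>R axis 2 1)) \<circ> (\<lambda>u. u - t) has_vector_derivative 1 *\<^sub>R p 2 (e s t)) (at t)"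
      using d by (intro vector_diff_chain_at[OF sh]) simp
    then show ?thesis by (simp add: o_def e_def algebra_simps)
  qed
  have "((\<lambda>(s, t). \<phi> (e s t)) has_derivative (\<lambda>(tx, ty). tx *\<^sub>R p 1 (e (a$1) (a$2)) + blinfun_scaleR_left (p 2 (e (a$1) (a$2))) ty)) (at (a$1, a$2) within UNIV \<times> UNIV)"
  proof (rule has_derivative_partialsI)
    show "((\<lambda>s. \<phi> (e s (a$2))) has_derivative (\<lambda>tx. tx *\<^sub>R p 1 (e (a$1) (a$2)))) (at (a$1) within UNIV)"
      using d1 unfolding has_vector_derivative_def by simp
    show "((\<lambda>t. \<phi> (e s t)) has_derivative blinfun_apply (blinfun_scaleR_left (p 2 (e s t)))) (at t within UNIV)" for s t
      using d2 unfolding has_vector_derivative_def by (simp add: blinfun_scaleR_left.rep_eq)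
    have "continuous_on UNIV (\<lambda>q. blinfun_scaleR_left (p 2 (e (fst q) (snd q))))"
      unfolding e_def
      by (intro bounded_linear.continuous_on[OF bounded_linear_blinfun_scaleR_left]
          continuous_on_compose2[OF cont] continuous_intros) auto
    then show "continuous (at (a$1, a$2) within UNIV \<times> UNIV) (\<lambda>(s, t). blinfun_scaleR_left (p 2 (e s t)))"
      by (simp add: continuous_on_eq_continuous_at case_prod_unfold)
  qed auto
  then have D: "((\<lambda>(s, t). \<phi> (e s t)) has_derivative (\<lambda>h. \<Sum>c\<in>UNIV. (if c = 1 then fst h else snd h) *\<^sub>R p c a)) (at (a$1, a$2))"
    by (simp add: sum_2 case_prod_unfold x[symmetric])
  have L: "((\<lambda>x::real^2. (x$1, x$2)) has_derivative (\<lambda>h. (h$1, h$2))) (at a)"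
    by (intro has_derivative_Pair bounded_linear_imp_has_derivative[OF bounded_linear_vec_nth])
  from diff_chain_at[OF L D] show ?thesis
    by (simp add: o_def x[symmetric] sum_2)
qed

text \<open>The same criterion one level up, with two positions in the plane as the
  variables.\<close>

lemma has_derivative_real2_pair:
  fixes g :: "real^2 \<Rightarrow> real^2 \<Rightarrow> complex"
  assumes d1: "\<And>a b c. ((\<lambda>t. g (a + t *\<^sub>R axis c 1) b) has_vector_derivative P1 c a b) (at 0)"
    and d2: "\<And>a b c. ((\<lambda>t. g a (b + t *\<^sub>R axis c 1)) has_vector_derivative P2 c a b) (at 0)"
    and c1: "\<And>c. continuous_on UNIV (\<lambda>q. P1 c (fst q) (snd q))"
    and c2: "\<And>c. continuous_on UNIV (\<lambda>q. P2 c (fst q) (snd q))"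
  shows "((\<lambda>q. g (fst q) (snd q)) has_derivative
     (\<lambda>h. (\<Sum>c\<in>UNIV. (fst h $ c) *\<^sub>R P1 c a b) + (\<Sum>c\<in>UNIV. (snd h $ c) *\<^sub>R P2 c a b))) (at (a, b))"
proof -
  have k1: "continuous_on UNIV (\<lambda>x. P1 c x b)" for c b
    using continuous_on_compose2[OF c1, of UNIV "\<lambda>x. (x, b)" c] by (simp add: continuous_on_Pair)
  have k2: "continuous_on UNIV (\<lambda>y. P2 c x y)" for c x
    using continuous_on_compose2[OF c2, of UNIV "\<lambda>y. (x, y)" c] by (simp add: continuous_on_Pair)
  define fy where "fy x y = (\<Sum>c\<in>UNIV. blinfun_scaleR_left (P2 c x y) o\<^sub>L Blinfun (\<lambda>h::real^2. h $ c))" for x y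
  have fy: "blinfun_apply (fy x y) = (\<lambda>h. \<Sum>c\<in>UNIV. (h $ c) *\<^sub>R P2 c x y)" for x y
    by (auto simp: fy_def sum_2 blinfun.add_left bounded_linear_Blinfun_apply bounded_linear_vec_nth)
  have "((\<lambda>(x, y). g x y) has_derivative (\<lambda>(tx, ty). (\<Sum>c\<in>UNIV. (tx $ c) *\<^sub>R P1 c a b) + fy a b ty)) (at (a, b) within UNIV \<times> UNIV)"
  proof (rule has_derivative_partialsI)
    show "((\<lambda>x. g x b) has_derivative (\<lambda>tx. \<Sum>c\<in>UNIV. (tx $ c) *\<^sub>R P1 c a b)) (at a within UNIV)"
      by (intro has_derivative_real2[OF d1] k1)
    show "((\<lambda>y. g x y) has_derivative blinfun_apply (fy x y)) (at y within UNIV)" for x y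
      unfolding fy by (simp add: has_derivative_real2[OF d2 k2])
    have "continuous_on UNIV (\<lambda>q. fy (fst q) (snd q))"
      unfolding fy_def
      by (intro continuous_on_sum bounded_bilinear.continuous_on[OF bounded_bilinear_blinfun_compose]
         bounded_linear.continuous_on[OF bounded_linear_blinfun_scaleR_left] c2 continuous_on_const)
    then show "continuous (at (a, b) within UNIV \<times> UNIV) (\<lambda>(x, y). fy x y)"
      by (simp add: continuous_on_eq_continuous_at case_prod_unfold)
  qed auto
  then show ?thesis by (simp add: fy case_prod_unfold)
qed

section \<open>Measurability on configuration space\<close>

lemma space_cfgM: "space (cfgM N) = cfg N"
  by (simp add: cfgM_def cfg_def space_PiM)

lemma measurable_cfgM_component [measurable]: "j < N \<Longrightarrow> (\<lambda>x. x j) \<in> borel_measurable (cfgM N)"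
  unfolding cfgM_def using measurable_component_singleton[of j "{..<N}" "\<lambda>_. lborel::(real^2) measure"] by simp

text \<open>Continuity refers to the topology of all functions on \<open>nat\<close>, measurability
  to a finite product. Coordinates from \<open>N\<close> on are constantly \<open>undefined\<close>,
  so the inclusion into the countable product is measurable, and there the product sigma-algebra is
  the Borel one.\<close>

lemma borel_measurable_cfgM_continuous:
  fixes g :: "(nat \<Rightarrow> real^2) \<Rightarrow> 'b::topological_space"
  assumes "continuous_on (cfg N) g"
  shows "g \<in> borel_measurable (cfgM N)"
proof -
  have "(\<lambda>x i. x i) \<in> measurable (cfgM N) (PiM UNIV (\<lambda>_. borel :: (real^2) measure))"
  proof (rule measurable_PiM_single')
    fix i :: nat
    show "(\<lambda>x. x i) \<in> borel_measurable (cfgM N)"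
    proof (cases "i < N")
      case False
      then have "x i = undefined" if "x \<in> space (cfgM N)" for x
        using that by (auto simp: space_cfgM cfg_def PiE_def extensional_def)
      then show ?thesis by (subst measurable_cong[where g="\<lambda>_. undefined"]) auto
    qed measurable
  qed auto
  then have "(\<lambda>x. x) \<in> measurable (cfgM N) (borel :: (nat \<Rightarrow> real^2) measure)"
    using measurable_cong_sets[OF refl sets_PiM_equal_borel] by blast
  then have "(\<lambda>x. x) \<in> measurable (cfgM N) (restrict_space borel (cfg N))"
    by (intro measurable_restrict_space2) (auto simp: space_cfgM)
  from measurable_compose[OF this borel_measurable_continuous_on_restrict[OF assms]] show ?thesis .
qed

text \<open>What the estimates take from a test function: one continuous derivative, symmetry under
  transpositions, and the value 0 at coincidences, from which radial integration starts.\<close>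

locale anyon_fn =
  fixes N :: nat and \<alpha> :: real and f :: "(nat \<Rightarrow> real^2) \<Rightarrow> complex"
  assumes cont_f: "continuous_on (cfg N) f"
    and cont_pdiff: "\<And>j c. j < N \<Longrightarrow> continuous_on (cfg N) (pdiff j c f)"
    and deriv_pdiff: "\<And>j c x. j < N \<Longrightarrow> x \<in> cfg N \<Longrightarrow>
        ((\<lambda>t. f (x(j := x j + t *\<^sub>R axis c 1))) has_vector_derivative pdiff j c f x) (at 0)"
    and swap: "\<And>j k x. j < N \<Longrightarrow> k < N \<Longrightarrow> j \<noteq> k \<Longrightarrow> x \<in> cfg N \<Longrightarrow> f (x(j := x k, k := x j)) = f x"
    and diag_zero: "\<And>x. x \<in> diag N \<Longrightarrow> f x = 0"

lemma anyon_fn_test_sym: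
  assumes "f \<in> test_sym N"
  shows "anyon_fn N f"
proof
  have sm: "smooth_cfg N f" using assms by (simp add: test_sym_def)
  show "continuous_on (cfg N) f" using sm by (cases rule: smooth_cfg.cases) auto
  show "continuous_on (cfg N) (pdiff j c f)" if "j < N" for j c
  proof -
    have "smooth_cfg N (pdiff j c f)" using sm that by (cases rule: smooth_cfg.cases) auto
    then show ?thesis by (cases rule: smooth_cfg.cases) auto
  qed
  show "((\<lambda>t. f (x(j := x j + t *\<^sub>R axis c 1))) has_vector_derivative pdiff j c f x) (at 0)"
    if "j < N" "x \<in> cfg N" for j c x
    unfolding pdiff_def vector_derivative_works[symmetric]
    using sm that by (cases rule: smooth_cfg.cases) auto
  show "f (x(j := x k, k := x j)) = f x" if "j < N" "k < N" "j \<noteq> k" "x \<in> cfg N" for j k x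
  proof -
    have "x \<circ> Transposition.transpose j k = x(j := x k, k := x j)"
      using that(3) by (auto simp: Transposition.transpose_def fun_eq_iff)
    moreover have "Transposition.transpose j k permutes {..<N}" using that by (intro permutes_swap_id) auto
    ultimately show ?thesis using assms that(4) by (metis (mono_tags, lifting) mem_Collect_eq test_sym_def)
  qed
  show "f x = 0" if "x \<in> diag N" for x
  proof -
    obtain K where "K \<inter> diag N = {}" "\<forall>x\<in>cfg N - K. f x = 0" using assms by (auto simp: test_sym_def)
    then show ?thesis using that by (auto simp: diag_def)
  qed
qed

context anyon_fn begin

definition En :: "nat \<Rightarrow> (nat \<Rightarrow> real^2) \<Rightarrow> real" where
  "En j x = (\<Sum>c\<in>UNIV. (cmod (Dop \<alpha> N j c f x))\<^sup>2)"
definition Wf :: "(nat \<Rightarrow> real^2) \<Rightarrow> real" where "Wf x = (cmod (f x))\<^sup>2"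

lemma En_nonneg: "En j x \<ge> 0" by (simp add: En_def sum_nonneg)
lemma Wf_nonneg: "Wf x \<ge> 0" by (simp add: Wf_def)

lemma meas_f [measurable]: "f \<in> borel_measurable (cfgM N)"
  by (rule borel_measurable_cfgM_continuous[OF cont_f])

lemma meas_Apot: "j < N \<Longrightarrow> (\<lambda>x. Apot N j x) \<in> borel_measurable (cfgM N)"
proof -
  assume j: "j < N"
  have p: "(\<lambda>x. perp (x j - x k)) \<in> borel_measurable (cfgM N)" if "k < N" for k
    using that j by (intro measurable_compose[OF _ borel_measurable_perp]) measurable
  have n: "(\<lambda>x. 1 / (norm (x j - x k))\<^sup>2) \<in> borel_measurable (cfgM N)" if "k < N" for k
    using that j by measurable
  show ?thesis unfolding Apot_def
    using j by (intro borel_measurable_sum borel_measurable_scaleR n p) auto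
qed

lemma meas_Dop: "j < N \<Longrightarrow> Dop \<alpha> N j c f \<in> borel_measurable (cfgM N)"
proof -
  assume j: "j < N"
  have [measurable]: "(\<lambda>x. Apot N j x $ c) \<in> borel_measurable (cfgM N)"
    unfolding cart_eq_inner_axis using meas_Apot[OF j] by measurable
  have [measurable]: "pdiff j c f \<in> borel_measurable (cfgM N)"
    by (rule borel_measurable_cfgM_continuous[OF cont_pdiff[OF j]])
  show ?thesis unfolding Dop_def by measurable
qed

lemma meas_En [measurable]: "j < N \<Longrightarrow> En j \<in> borel_measurable (cfgM N)"
  unfolding En_def
  by (intro borel_measurable_sum borel_measurable_power measurable_compose[OF meas_Dop borel_measurable_norm])

lemma meas_Wf [measurable]: "Wf \<in> borel_measurable (cfgM N)"
  unfolding Wf_def by measurable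

end

section \<open>Local exclusion\<close>

lemma alphaN_le:
  assumes "N \<ge> 2" "0 \<le> p" "p \<le> int (N - 2)"
  shows "alphaN \<alpha> N \<le> \<bar>(2 * of_int p + 1) * \<alpha> - 2 * of_int q\<bar>"
proof -
  let ?g = "\<lambda>p. INF q::int. \<bar>(2 * real p + 1) * \<alpha> - 2 * of_int q\<bar>"
  have "alphaN \<alpha> N = Min (?g ` {0..N-2})" using assms by (simp add: alphaN_def)
  also have "\<dots> \<le> ?g (nat p)" using assms by (intro Min_le finite_imageI imageI) auto
  also have "\<dots> \<le> \<bar>(2 * real (nat p) + 1) * \<alpha> - 2 * of_int q\<bar>"
    by (intro cINF_lower bdd_belowI[where m=0]) auto
  finally show ?thesis using assms by simp
qed

lemma alphaN_nonneg: "alphaN \<alpha> N \<ge> 0"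
proof (cases "N < 2")
  case False
  have "0 \<le> (INF q::int. \<bar>(2 * real p + 1) * \<alpha> - 2 * of_int q\<bar>)" for p
    by (intro cINF_greatest) auto
  then show ?thesis using False by (auto simp: alphaN_def)
qed (simp add: alphaN_def)

text \<open>Some even integer lies within distance 1 of \<open>\<alpha>\<close>, which settles the
  term \<open>p = 0\<close>; for \<open>N < 2\<close> the value is 1 by convention.\<close>

lemma alphaN_le_1: "alphaN \<alpha> N \<le> 1"
proof (cases "N < 2")
  case False
  have "\<bar>of_int (round (\<alpha> / 2)) - \<alpha> / 2\<bar> \<le> 1/2" by (rule of_int_round_abs_le)
  then have "\<bar>\<alpha> - 2 * of_int (round (\<alpha> / 2))\<bar> \<le> 1" by linarith
  moreover have "alphaN \<alpha> N \<le> \<bar>(2 * of_int 0 + 1) * \<alpha> - 2 * of_int (round (\<alpha> / 2))\<bar>"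
    using False by (intro alphaN_le) auto
  ultimately show ?thesis by simp
qed (simp add: alphaN_def)

text \<open>If \<open>n\<close> particles lie in the square, each pair of them gets weight \<open>1 / (n - 1)\<close>. This weight depends only on
  the positions of the other particles, so it is constant in the integration over the pair.\<close>
lemma pair_weight_sums:
  fixes w :: real and e :: "nat \<Rightarrow> real"
  assumes S: "finite S" and w: "w \<ge> 0" and e: "\<And>j. e j \<ge> 0"
  defines "h \<equiv> \<lambda>j k. 1 / (1 + real (card (S - {j, k})))"
  shows "real (card S) * w \<le> w + (\<Sum>j\<in>S. \<Sum>k\<in>S - {j}. h j k * w)"
    and "(\<Sum>j\<in>S. \<Sum>k\<in>S - {j}. h j k * (e j + e k)) \<le> 2 * (\<Sum>j\<in>S. e j)"
proof -
  define n where "n = card S"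
  have h: "h j k = 1 / (real n - 1)" if "j \<in> S" "k \<in> S - {j}" for j k
  proof -
    have "card {j, k} \<le> n" unfolding n_def using that S by (intro card_mono) auto
    then have n: "n \<ge> 2" using that by simp
    have "card (S - {j, k}) = n - 2" unfolding n_def using that S by (subst card_Diff_subset) auto
    then show ?thesis using n by (simp add: h_def of_nat_diff)
  qed
  have c: "card (S - {j}) = n - 1" if "j \<in> S" for j using that S by (simp add: n_def)
  have "(\<Sum>j\<in>S. \<Sum>k\<in>S - {j}. h j k * w) = (\<Sum>j\<in>S. \<Sum>k\<in>S - {j}. w / (real n - 1))"
    by (intro sum.cong refl) (simp add: h)
  also have "\<dots> = real n * real (n - 1) * w / (real n - 1)"
    using c by (simp add: n_def)
  also have "w + \<dots> \<ge> real n * w"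
  \<comment> \<open>A single particle has no partner, and the separate summand \<open>w\<close>
    accounts for it. From two particles on the pair sum alone is \<open>n w\<close>.\<close>
  proof (cases "n \<le> 1")
    case True
    then have "n = 0 \<or> n = 1" by auto
    then show ?thesis using w by auto
  next
    case False
    then have "real n * real (n - 1) * w / (real n - 1) = real n * w" by (simp add: of_nat_diff)
    then show ?thesis using w by simp
  qed
  finally show "real (card S) * w \<le> w + (\<Sum>j\<in>S. \<Sum>k\<in>S - {j}. h j k * w)" by (simp add: n_def)
  have "(\<Sum>j\<in>S. \<Sum>k\<in>S - {j}. h j k * (e j + e k)) = (\<Sum>j\<in>S. \<Sum>k\<in>S - {j}. e j / (real n - 1)) + (\<Sum>j\<in>S. \<Sum>k\<in>S - {j}. e k / (real n - 1))"
    unfolding sum.distrib[symmetric] by (intro sum.cong refl) (simp add: h add_divide_distrib)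
  also have "(\<Sum>j\<in>S. \<Sum>k\<in>S - {j}. e k / (real n - 1)) = (\<Sum>j\<in>S. \<Sum>k\<in>S - {j}. e j / (real n - 1))"
  proof -
    have "(\<Sum>j\<in>S. \<Sum>k\<in>S - {j}. g j k) = (\<Sum>j\<in>S. \<Sum>k\<in>S - {j}. g k j)" for g :: "nat \<Rightarrow> nat \<Rightarrow> real"
    proof -
      have "(\<Sum>j\<in>S. \<Sum>k\<in>S - {j}. g j k) = (\<Sum>j\<in>S. \<Sum>k\<in>S. if k = j then 0 else g j k)"
        using S by (intro sum.cong refl sum.mono_neutral_cong_left) auto
      also have "\<dots> = (\<Sum>k\<in>S. \<Sum>j\<in>S. if k = j then 0 else g j k)" by (rule sum.swap)
      also have "\<dots> = (\<Sum>k\<in>S. \<Sum>j\<in>S - {k}. g j k)"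
        using S by (intro sum.cong refl sum.mono_neutral_cong_right) auto
      finally show ?thesis .
    qed
    then show ?thesis .
  qed
  also have "(\<Sum>j\<in>S. \<Sum>k\<in>S - {j}. e j / (real n - 1)) \<le> (\<Sum>j\<in>S. e j)"
  proof (intro sum_mono)
    fix j assume "j \<in> S"
    then have "(\<Sum>k\<in>S - {j}. e j / (real n - 1)) = real (n - 1) * (e j / (real n - 1))" by (simp add: n_def)
    also have "\<dots> \<le> e j"
    proof (cases "n \<le> 1")
      case False then show ?thesis by (simp add: of_nat_diff)
    qed (use e in simp)
    finally show "(\<Sum>k\<in>S - {j}. e j / (real n - 1)) \<le> e j" .
  qed
  finally show "(\<Sum>j\<in>S. \<Sum>k\<in>S - {j}. h j k * (e j + e k)) \<le> 2 * (\<Sum>j\<in>S. e j)" by simp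
qed

context anyon_fn begin

text \<open>With the other \<open>N - 2\<close> particles frozen at \<open>y\<close>, the number
  enclosed by a half turn lies in \<open>{0..N-2}\<close>, exactly the range of the minimum in
  \<open>alphaN\<close>.\<close>

lemma anyon_pair_slice:
  assumes j: "j < N" and k: "k < N" and jk: "j \<noteq> k" and y: "y \<in> PiE ({..<N} - {j, k}) (\<lambda>_. UNIV)"
    and a: "alphaN \<alpha> N > 0"
  shows "anyon_pair (\<lambda>a b. f (y(j := a, k := b))) (\<lambda>c a b. pdiff j c f (y(j := a, k := b)))
     (\<lambda>c a b. pdiff k c f (y(j := a, k := b))) \<alpha> (alphaN \<alpha> N) ({..<N} - {j, k})"
proof
  have cfg: "y(j := a, k := b) \<in> cfg N" for a b
    using y j k by (auto simp: cfg_def PiE_def extensional_def)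
  have ct: "continuous_on UNIV (\<lambda>q. y(j := fst q, k := snd q))"
  proof (rule continuous_on_coordinatewise_then_product)
    show "continuous_on UNIV (\<lambda>q. (y(j := fst q, k := snd q)) i)" for i
      by (cases "i = k"; cases "i = j") (auto intro!: continuous_intros)
  qed
  have cc: "continuous_on UNIV (\<lambda>q. g (y(j := fst q, k := snd q)))" if "continuous_on (cfg N) g" for g :: "_ \<Rightarrow> complex"
    using cfg by (intro continuous_on_compose2[OF that ct]) auto
  show c1: "continuous_on UNIV (\<lambda>q. pdiff j c f (y(j := fst q, k := snd q)))" for c
    by (rule cc[OF cont_pdiff[OF j]])
  show c2: "continuous_on UNIV (\<lambda>q. pdiff k c f (y(j := fst q, k := snd q)))" for c
    by (rule cc[OF cont_pdiff[OF k]])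
  have d1: "((\<lambda>t. f (y(j := a + t *\<^sub>R axis c 1, k := b))) has_vector_derivative pdiff j c f (y(j := a, k := b))) (at 0)" for a b c
    using deriv_pdiff[OF j cfg[of a b], of c] jk by (simp add: fun_upd_twist)
  have d2: "((\<lambda>t. f (y(j := a, k := b + t *\<^sub>R axis c 1))) has_vector_derivative pdiff k c f (y(j := a, k := b))) (at 0)" for a b c
    using deriv_pdiff[OF k cfg[of a b], of c] by simp
  show "((\<lambda>p. f (y(j := fst p, k := snd p))) has_derivative (\<lambda>h. (\<Sum>c\<in>UNIV. (fst h $ c) *\<^sub>R pdiff j c f (y(j := x, k := ya))) +
           (\<Sum>c\<in>UNIV. (snd h $ c) *\<^sub>R pdiff k c f (y(j := x, k := ya))))) (at (x, ya))" for x ya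
    by (rule has_derivative_real2_pair[OF d1 d2 c1 c2])
  show "f (y(j := x, k := ya)) = f (y(j := ya, k := x))" for x ya
    using swap[OF j k jk cfg[of x ya]] jk by (simp add: fun_upd_twist)
  show "f (y(j := x, k := x)) = 0" for x
    using cfg[of x x] j k jk by (intro diag_zero) (auto simp: diag_def)
  show "alphaN \<alpha> N > 0" by (rule a)
  have "N \<ge> 2" using j k jk by linarith
  moreover have "card ({..<N} - {j, k}) = N - 2" using j k jk by (subst card_Diff_subset) auto
  ultimately show "alphaN \<alpha> N \<le> \<bar>(2 * of_int p + 1) * \<alpha> - 2 * of_int q\<bar>"
    if "0 \<le> p" "p \<le> int (card ({..<N} - {j, k}))" for p q
    using that by (intro alphaN_le) auto
qed auto

lemma slice_E:
  assumes j: "j < N" and k: "k < N" and jk: "j \<noteq> k" and y: "y \<in> PiE ({..<N} - {j, k}) (\<lambda>_. UNIV)"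
    and a: "alphaN \<alpha> N > 0"
  shows "anyon_pair.E (\<lambda>a b. f (y(j := a, k := b))) (\<lambda>c a b. pdiff j c f (y(j := a, k := b)))
     (\<lambda>c a b. pdiff k c f (y(j := a, k := b))) \<alpha> ({..<N} - {j, k}) y u v
     = En j (y(j := u, k := v)) + En k (y(j := u, k := v))"
proof -
  interpret P: anyon_pair "\<lambda>a b. f (y(j := a, k := b))" "\<lambda>c a b. pdiff j c f (y(j := a, k := b))"
     "\<lambda>c a b. pdiff k c f (y(j := a, k := b))" \<alpha> "alphaN \<alpha> N" "{..<N} - {j, k}" y
    by (rule anyon_pair_slice[OF assms])
  \<comment> \<open>Splitting off the partner brings the sum in \<open>Apot\<close> into the
    two-part form of \<open>A\<close>.\<close>
  have s1: "{..<N} - {j} = insert k ({..<N} - {j, k})" and s2: "{..<N} - {k} = insert j ({..<N} - {j, k})"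
    using j k jk by auto
  have A1: "Apot N j (y(j := u, k := v)) = P.A u v"
    unfolding Apot_def P.A_def s1 using jk by (subst sum.insert) (auto intro!: sum.cong)
  have A2: "Apot N k (y(j := u, k := v)) = P.A v u"
    unfolding Apot_def P.A_def s2 using jk by (subst sum.insert) (auto intro!: sum.cong)
  show ?thesis unfolding P.E_def En_def P.D1_def P.D2_def Dop_def A1 A2 ..
qed

lemma nn_integral_cfgM_pair:
  assumes j: "j < N" and k: "k < N" and jk: "j \<noteq> k" and g: "g \<in> borel_measurable (cfgM N)"
  shows "(\<integral>\<^sup>+x. g x \<partial>cfgM N) = (\<integral>\<^sup>+y. \<integral>\<^sup>+v. \<integral>\<^sup>+u. g (y(j := u, k := v)) \<partial>lborel \<partial>lborel \<partial>PiM ({..<N} - {j, k}) (\<lambda>_. lborel))"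
proof -
  interpret product_sigma_finite "\<lambda>_::nat. lborel :: (real^2) measure" ..
  let ?I = "{..<N} - {j, k}"
  have s: "{..<N} = insert j (insert k ?I)" using j k by auto
  have M: "cfgM N = PiM (insert j (insert k ?I)) (\<lambda>_. lborel)" unfolding cfgM_def using s by simp
  have g': "g \<in> borel_measurable (PiM (insert j (insert k ?I)) (\<lambda>_. lborel))" using g unfolding M .
  have m: "(\<lambda>x. \<integral>\<^sup>+u. g (x(j := u)) \<partial>lborel) \<in> borel_measurable (PiM (insert k ?I) (\<lambda>_. lborel))"
    using measurable_compose[OF measurable_add_dim g'] by (intro lborel.borel_measurable_nn_integral) (simp add: case_prod_unfold)
  show ?thesis unfolding M
    using jk by (subst product_nn_integral_insert[OF _ _ g'], simp, simp,
        subst product_nn_integral_insert[OF _ _ m]) (auto simp: fun_upd_twist)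
qed

lemma cfgM_pair_exclusion:
  assumes j: "j < N" and k: "k < N" and jk: "j \<noteq> k" and a: "alphaN \<alpha> N > 0" and L: "L > 0"
    and h [measurable]: "h \<in> borel_measurable (cfgM N)" and h_inv: "\<And>x u v. h (x(j := u, k := v)) = h x"
  shows "(\<integral>\<^sup>+x. h x * (ennreal (Wf x) * (indicator (sq p L) (x j) * indicator (sq p L) (x k))) \<partial>cfgM N)
     \<le> ennreal (12000 * L\<^sup>2 / alphaN \<alpha> N) *
       (\<integral>\<^sup>+x. h x * (ennreal (En j x + En k x) * (indicator (sq p L) (x j) * indicator (sq p L) (x k))) \<partial>cfgM N)"
proof -
  let ?Q = "sq p L" and ?C = "ennreal (12000 * L\<^sup>2 / alphaN \<alpha> N)"
  let ?I = "PiM ({..<N} - {j, k}) (\<lambda>_. lborel :: (real^2) measure)"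
  have [measurable]: "(\<lambda>x. indicator ?Q (x l) :: ennreal) \<in> borel_measurable (cfgM N)" if "l < N" for l
    using that by measurable
  have mW: "(\<lambda>x. h x * (ennreal (Wf x) * (indicator ?Q (x j) * indicator ?Q (x k)))) \<in> borel_measurable (cfgM N)"
    using j k by measurable
  have mE: "(\<lambda>x. h x * (ennreal (En j x + En k x) * (indicator ?Q (x j) * indicator ?Q (x k)))) \<in> borel_measurable (cfgM N)"
    using j k by measurable
  have "(\<integral>\<^sup>+x. h x * (ennreal (Wf x) * (indicator ?Q (x j) * indicator ?Q (x k))) \<partial>cfgM N)
    = (\<integral>\<^sup>+y. \<integral>\<^sup>+v. \<integral>\<^sup>+u. h y * (ennreal (Wf (y(j := u, k := v))) * (indicator ?Q u * indicator ?Q v)) \<partial>lborel \<partial>lborel \<partial>?I)"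
    unfolding nn_integral_cfgM_pair[OF j k jk mW] using jk by (simp add: h_inv)
  also have "\<dots> \<le> (\<integral>\<^sup>+y. ?C * (\<integral>\<^sup>+v. \<integral>\<^sup>+u. h y * (ennreal (En j (y(j := u, k := v)) + En k (y(j := u, k := v))) * (indicator ?Q u * indicator ?Q v)) \<partial>lborel \<partial>lborel) \<partial>?I)"
  proof (intro nn_integral_mono)
    fix y assume "y \<in> space ?I"
    then have y: "y \<in> PiE ({..<N} - {j, k}) (\<lambda>_. UNIV)" by (simp add: space_PiM)
    interpret P: anyon_pair "\<lambda>a b. f (y(j := a, k := b))" "\<lambda>c a b. pdiff j c f (y(j := a, k := b))"
      "\<lambda>c a b. pdiff k c f (y(j := a, k := b))" \<alpha> "alphaN \<alpha> N" "{..<N} - {j, k}" y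
      by (rule anyon_pair_slice[OF j k jk y a])
    have W: "Wf (y(j := u, k := v)) = P.W u v" for u v by (simp add: Wf_def P.W_def)
    have E: "En j (y(j := u, k := v)) + En k (y(j := u, k := v)) = P.E u v" for u v
      by (rule slice_E[OF j k jk y a, symmetric])
    have c: "(\<integral>\<^sup>+v. \<integral>\<^sup>+u. h y * (ennreal (P.W u v) * (indicator ?Q u * indicator ?Q v)) \<partial>lborel \<partial>lborel)
       = h y * (\<integral>\<^sup>+v. \<integral>\<^sup>+u. (ennreal (P.W u v) * (indicator ?Q u * indicator ?Q v)) \<partial>lborel \<partial>lborel)"
      by (simp add: nn_integral_cmult)
    have d: "(\<integral>\<^sup>+v. \<integral>\<^sup>+u. h y * (ennreal (P.E u v) * (indicator ?Q u * indicator ?Q v)) \<partial>lborel \<partial>lborel)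
       = h y * (\<integral>\<^sup>+v. \<integral>\<^sup>+u. (ennreal (P.E u v) * (indicator ?Q u * indicator ?Q v)) \<partial>lborel \<partial>lborel)"
      by (simp add: nn_integral_cmult)
    have "h y * (\<integral>\<^sup>+v. \<integral>\<^sup>+u. (ennreal (P.W u v) * (indicator ?Q u * indicator ?Q v)) \<partial>lborel \<partial>lborel)
      \<le> h y * (?C * (\<integral>\<^sup>+v. \<integral>\<^sup>+u. (ennreal (P.E u v) * (indicator ?Q u * indicator ?Q v)) \<partial>lborel \<partial>lborel))"
      by (intro mult_left_mono P.pair_exclusion[OF L alphaN_le_1]) auto
    then show "(\<integral>\<^sup>+v. \<integral>\<^sup>+u. h y * (ennreal (Wf (y(j := u, k := v))) * (indicator ?Q u * indicator ?Q v)) \<partial>lborel \<partial>lborel)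
      \<le> ?C * (\<integral>\<^sup>+v. \<integral>\<^sup>+u. h y * (ennreal (En j (y(j := u, k := v)) + En k (y(j := u, k := v))) * (indicator ?Q u * indicator ?Q v)) \<partial>lborel \<partial>lborel)"
      unfolding W E c d by (simp only: mult_ac)
  qed
  also have "\<dots> = (\<integral>\<^sup>+x. ?C * (h x * (ennreal (En j x + En k x) * (indicator ?Q (x j) * indicator ?Q (x k)))) \<partial>cfgM N)"
  proof -
    interpret product_sigma_finite "\<lambda>_::nat. lborel :: (real^2) measure" ..
    have "(\<integral>\<^sup>+x. ?C * (h x * (ennreal (En j x + En k x) * (indicator ?Q (x j) * indicator ?Q (x k)))) \<partial>cfgM N)
     = (\<integral>\<^sup>+y. \<integral>\<^sup>+v. \<integral>\<^sup>+u. ?C * (h y * (ennreal (En j (y(j := u, k := v)) + En k (y(j := u, k := v))) * (indicator ?Q u * indicator ?Q v))) \<partial>lborel \<partial>lborel \<partial>?I)"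
      using mE jk by (subst nn_integral_cfgM_pair[OF j k jk]) (auto simp: h_inv)
    also have "\<dots> = (\<integral>\<^sup>+y. ?C * (\<integral>\<^sup>+v. \<integral>\<^sup>+u. h y * (ennreal (En j (y(j := u, k := v)) + En k (y(j := u, k := v))) * (indicator ?Q u * indicator ?Q v)) \<partial>lborel \<partial>lborel) \<partial>?I)"
    proof (intro nn_integral_cong)
      fix y assume "y \<in> space ?I"
      then have y: "y \<in> PiE ({..<N} - {j, k}) (\<lambda>_. UNIV)" by (simp add: space_PiM)
      interpret P: anyon_pair "\<lambda>a b. f (y(j := a, k := b))" "\<lambda>c a b. pdiff j c f (y(j := a, k := b))"
        "\<lambda>c a b. pdiff k c f (y(j := a, k := b))" \<alpha> "alphaN \<alpha> N" "{..<N} - {j, k}" y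
        by (rule anyon_pair_slice[OF j k jk y a])
      have E: "En j (y(j := u, k := v)) + En k (y(j := u, k := v)) = P.E u v" for u v
        by (rule slice_E[OF j k jk y a, symmetric])
      show "(\<integral>\<^sup>+v. \<integral>\<^sup>+u. ?C * (h y * (ennreal (En j (y(j := u, k := v)) + En k (y(j := u, k := v))) * (indicator ?Q u * indicator ?Q v))) \<partial>lborel \<partial>lborel)
        = ?C * (\<integral>\<^sup>+v. \<integral>\<^sup>+u. h y * (ennreal (En j (y(j := u, k := v)) + En k (y(j := u, k := v))) * (indicator ?Q u * indicator ?Q v)) \<partial>lborel \<partial>lborel)"
        unfolding E by (simp add: nn_integral_cmult)
    qed
    finally show ?thesis by simp
  qed
  also have "\<dots> = ?C * (\<integral>\<^sup>+x. h x * (ennreal (En j x + En k x) * (indicator ?Q (x j) * indicator ?Q (x k))) \<partial>cfgM N)"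
    using mE by (rule nn_integral_cmult)
  finally show ?thesis .
qed

definition mass :: "(real^2) set \<Rightarrow> ennreal" where
  "mass Q = (\<Sum>j<N. \<integral>\<^sup>+x. ennreal (Wf x) * indicator Q (x j) \<partial>cfgM N)"
definition kin :: "(real^2) set \<Rightarrow> ennreal" where
  "kin Q = (\<Sum>j<N. \<integral>\<^sup>+x. ennreal (En j x) * indicator Q (x j) \<partial>cfgM N)"

text \<open>In each configuration the weights turn the mass of the particles inside into a sum over
  pairs, up to the summand for a lone particle. After the pair estimate the same weights recombine
  the energies; each particle occurs in both roles of a pair, which doubles 12000.\<close>

lemma local_exclusion:
  assumes a: "alphaN \<alpha> N > 0" and L: "L > 0"
  shows "mass (sq p L) \<le> (\<integral>\<^sup>+x. ennreal (Wf x) \<partial>cfgM N) + ennreal (24000 * L\<^sup>2 / alphaN \<alpha> N) * kin (sq p L)"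
proof -
  let ?Q = "sq p L" and ?C = "ennreal (12000 * L\<^sup>2 / alphaN \<alpha> N)"
  define S where "S x = {l \<in> {..<N}. x l \<in> ?Q}" for x
  \<comment> \<open>Counting through indicators keeps the weight measurable. If \<open>j\<close> and
    \<open>k\<close> are themselves among the \<open>n\<close> particles inside, it equals
    \<open>1 / (n - 1)\<close>.\<close>
  define h where "h j k x = 1 / (1 + (\<Sum>l\<in>{..<N} - {j, k}. indicator ?Q (x l) :: real))" for j k x
  have Sf: "finite (S x)" for x by (simp add: S_def)
  have hS: "h j k x = 1 / (1 + real (card (S x - {j, k})))" for j k x
  proof -
    have "(\<Sum>l\<in>{..<N} - {j, k}. indicator ?Q (x l) :: real) = (\<Sum>l\<in>S x - {j, k}. 1)"
      unfolding S_def by (intro sum.mono_neutral_cong_right) (auto simp: indicator_def)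
    then show ?thesis by (simp add: h_def)
  qed
  have h0: "h j k x \<ge> 0" for j k x unfolding hS by simp
  have [measurable]: "(\<lambda>x. indicator ?Q (x l) :: real) \<in> borel_measurable (cfgM N)"
      "(\<lambda>x. indicator ?Q (x l) :: ennreal) \<in> borel_measurable (cfgM N)" if "l < N" for l
    using that by measurable
  have hm [measurable]: "h j k \<in> borel_measurable (cfgM N)" for j k
    unfolding h_def by (intro borel_measurable_divide borel_measurable_const borel_measurable_add borel_measurable_sum) auto
  have hinv: "h j k (x(j := u, k := v)) = h j k x" for j k x u v
    unfolding h_def by (intro arg_cong2[where f="(/)"] arg_cong2[where f="(+)"] refl sum.cong) auto
  have conv: "(\<Sum>j<N. \<Sum>k\<in>{..<N} - {j}. g j k * (indicator ?Q (x j) * indicator ?Q (x k))) = (\<Sum>j\<in>S x. \<Sum>k\<in>S x - {j}. g j k)"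
    for g :: "nat \<Rightarrow> nat \<Rightarrow> real" and x
  proof -
    have "(\<Sum>j<N. \<Sum>k\<in>{..<N} - {j}. g j k * (indicator ?Q (x j) * indicator ?Q (x k))) =
      (\<Sum>j\<in>S x. \<Sum>k\<in>{..<N} - {j}. g j k * (indicator ?Q (x j) * indicator ?Q (x k)))"
      unfolding S_def by (intro sum.mono_neutral_right) (auto simp: indicator_def)
    also have "\<dots> = (\<Sum>j\<in>S x. \<Sum>k\<in>S x - {j}. g j k)"
      unfolding S_def by (intro sum.cong refl sum.mono_neutral_cong_right) (auto simp: indicator_def)
    finally show ?thesis .
  qed
  have conv1: "(\<Sum>j<N. g j * indicator ?Q (x j)) = (\<Sum>j\<in>S x. g j)" for g :: "nat \<Rightarrow> real" and x
    unfolding S_def by (intro sum.mono_neutral_cong_right) (auto simp: indicator_def)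
  have pt1: "(\<Sum>j<N. ennreal (Wf x) * indicator ?Q (x j)) \<le> ennreal (Wf x) +
      (\<Sum>j<N. \<Sum>k\<in>{..<N} - {j}. ennreal (h j k x) * (ennreal (Wf x) * (indicator ?Q (x j) * indicator ?Q (x k))))" for x
  proof -
    have "(\<Sum>j<N. Wf x * indicator ?Q (x j)) \<le> Wf x + (\<Sum>j<N. \<Sum>k\<in>{..<N} - {j}. (h j k x * Wf x) * (indicator ?Q (x j) * indicator ?Q (x k)))"
      unfolding conv conv1 hS using pair_weight_sums(1)[OF Sf Wf_nonneg, where e="\<lambda>_. 0"] by simp
    from ennreal_leI[OF this] show ?thesis
      by (simp add: ennreal_of_nat_eq_real_of_nat ennreal_plus sum_nonneg Wf_nonneg h0 sum_ennreal[symmetric] ennreal_mult ennreal_indicator mult.assoc)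
  qed
  have pt2: "(\<Sum>j<N. \<Sum>k\<in>{..<N} - {j}. ennreal (h j k x) * (ennreal (En j x + En k x) * (indicator ?Q (x j) * indicator ?Q (x k))))
     \<le> 2 * (\<Sum>j<N. ennreal (En j x) * indicator ?Q (x j))" for x
  proof -
    have "(\<Sum>j<N. \<Sum>k\<in>{..<N} - {j}. (h j k x * (En j x + En k x)) * (indicator ?Q (x j) * indicator ?Q (x k))) \<le> 2 * (\<Sum>j<N. En j x * indicator ?Q (x j))"
      unfolding conv conv1 hS by (rule pair_weight_sums(2)[OF Sf Wf_nonneg En_nonneg])
    note le = ennreal_leI[OF this]
    have t: "ennreal (h j k x) * (ennreal (En j x + En k x) * (indicator ?Q (x j) * indicator ?Q (x k)))
      = ennreal (h j k x * (En j x + En k x) * (indicator ?Q (x j) * indicator ?Q (x k)))" for j k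
      by (auto simp: ennreal_mult[symmetric] h0 En_nonneg simp del: ennreal_plus split: split_indicator)
    have t1: "ennreal (En j x) * indicator ?Q (x j) = ennreal (En j x * indicator ?Q (x j))" for j
      by (auto split: split_indicator)
    have p: "0 \<le> h j k x * (En j x + En k x) * (indicator ?Q (x j) * indicator ?Q (x k))" for j k
      by (intro mult_nonneg_nonneg add_nonneg_nonneg h0 En_nonneg) auto
    have "(\<Sum>j<N. \<Sum>k\<in>{..<N} - {j}. ennreal (h j k x) * (ennreal (En j x + En k x) * (indicator ?Q (x j) * indicator ?Q (x k))))
      = ennreal (\<Sum>j<N. \<Sum>k\<in>{..<N} - {j}. h j k x * (En j x + En k x) * (indicator ?Q (x j) * indicator ?Q (x k)))"
      unfolding t using p by (subst sum_ennreal, simp)+ (auto intro!: sum_nonneg)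
    moreover have "2 * (\<Sum>j<N. ennreal (En j x) * indicator ?Q (x j)) = ennreal (2 * (\<Sum>j<N. En j x * indicator ?Q (x j)))"
      unfolding t1 by (subst sum_ennreal) (auto simp: En_nonneg ennreal_mult' )
    ultimately show ?thesis using le by metis
  qed
  have ss: "(\<integral>\<^sup>+x. (\<Sum>j<N. \<Sum>k\<in>{..<N} - {j}. g j k x) \<partial>cfgM N) = (\<Sum>j<N. \<Sum>k\<in>{..<N} - {j}. \<integral>\<^sup>+x. g j k x \<partial>cfgM N)"
    if "\<And>j k. j < N \<Longrightarrow> k < N \<Longrightarrow> g j k \<in> borel_measurable (cfgM N)" for g :: "nat \<Rightarrow> nat \<Rightarrow> (nat \<Rightarrow> real^2) \<Rightarrow> ennreal"
    using that by (subst nn_integral_sum) (auto intro!: sum.cong nn_integral_sum borel_measurable_sum)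
  have mW: "(\<lambda>x. ennreal (h j k x) * (ennreal (Wf x) * (indicator ?Q (x j) * indicator ?Q (x k)))) \<in> borel_measurable (cfgM N)"
    if "j < N" "k < N" for j k using that by measurable
  have mE: "(\<lambda>x. ennreal (h j k x) * (ennreal (En j x + En k x) * (indicator ?Q (x j) * indicator ?Q (x k)))) \<in> borel_measurable (cfgM N)"
    if "j < N" "k < N" for j k using that by measurable
  have "mass ?Q = (\<integral>\<^sup>+x. (\<Sum>j<N. ennreal (Wf x) * indicator ?Q (x j)) \<partial>cfgM N)"
    unfolding mass_def by (subst nn_integral_sum) auto
  also have "\<dots> \<le> (\<integral>\<^sup>+x. ennreal (Wf x) +
      (\<Sum>j<N. \<Sum>k\<in>{..<N} - {j}. ennreal (h j k x) * (ennreal (Wf x) * (indicator ?Q (x j) * indicator ?Q (x k)))) \<partial>cfgM N)"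
    by (intro nn_integral_mono pt1)
  also have "\<dots> = (\<integral>\<^sup>+x. ennreal (Wf x) \<partial>cfgM N) + (\<Sum>j<N. \<Sum>k\<in>{..<N} - {j}. \<integral>\<^sup>+x. ennreal (h j k x) * (ennreal (Wf x) * (indicator ?Q (x j) * indicator ?Q (x k))) \<partial>cfgM N)"
    by (subst nn_integral_add) (auto simp: ss[OF mW] intro!: borel_measurable_sum mW)
  also have "\<dots> \<le> (\<integral>\<^sup>+x. ennreal (Wf x) \<partial>cfgM N) + (\<Sum>j<N. \<Sum>k\<in>{..<N} - {j}. ?C * (\<integral>\<^sup>+x. ennreal (h j k x) * (ennreal (En j x + En k x) * (indicator ?Q (x j) * indicator ?Q (x k))) \<partial>cfgM N))"
    by (intro add_left_mono sum_mono cfgM_pair_exclusion[OF _ _ _ a L]) (auto simp: hinv)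
  also have "(\<Sum>j<N. \<Sum>k\<in>{..<N} - {j}. ?C * (\<integral>\<^sup>+x. ennreal (h j k x) * (ennreal (En j x + En k x) * (indicator ?Q (x j) * indicator ?Q (x k))) \<partial>cfgM N))
     = ?C * (\<integral>\<^sup>+x. (\<Sum>j<N. \<Sum>k\<in>{..<N} - {j}. ennreal (h j k x) * (ennreal (En j x + En k x) * (indicator ?Q (x j) * indicator ?Q (x k)))) \<partial>cfgM N)"
    by (simp add: ss[OF mE] sum_distrib_left del: ennreal_plus)
  also have "\<dots> \<le> ?C * (\<integral>\<^sup>+x. 2 * (\<Sum>j<N. ennreal (En j x) * indicator ?Q (x j)) \<partial>cfgM N)"
    by (intro mult_left_mono nn_integral_mono pt2) auto
  also have "\<dots> = ?C * (2 * kin ?Q)"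
  proof -
    have m: "(\<lambda>x. ennreal (En j x) * indicator ?Q (x j)) \<in> borel_measurable (cfgM N)" if "j \<in> {..<N}" for j
    proof -
      have j: "j < N" using that by simp
      then show ?thesis by measurable
    qed
    show ?thesis unfolding kin_def
      by (subst nn_integral_cmult, rule borel_measurable_sum[OF m], assumption,
          subst nn_integral_sum, rule m, assumption, rule refl)
  qed
  also have "\<dots> = ennreal (24000 * L\<^sup>2 / alphaN \<alpha> N) * kin ?Q"
  proof -
    have "ennreal (24000 * L\<^sup>2 / alphaN \<alpha> N) = ?C * 2"
      using a by (subst ennreal_numeral[symmetric], subst ennreal_mult[symmetric]) auto
    then show ?thesis by (simp only: mult_ac)
  qed
  finally show ?thesis by (simp add: add_left_mono)
qed

end

section \<open>Local uncertainty\<close>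

text \<open>Compare \<open>\<phi> s\<close> with \<open>\<phi> t\<close> by integrating the
  derivative between them, then average over \<open>t\<close> in the interval.\<close>

lemma nn_integral_line_average:
  fixes \<phi> :: "real \<Rightarrow> real"
  assumes L: "L > 0" and s: "l \<le> s" "s < l + L"
    and d: "\<And>t. (\<phi> has_vector_derivative \<phi>' t) (at t)" and c: "continuous_on UNIV \<phi>'"
    and g: "\<And>t. \<bar>\<phi>' t\<bar> \<le> g t" and gm: "g \<in> borel_measurable borel" and pos: "\<And>t. \<phi> t \<ge> 0"
  shows "ennreal (\<phi> s) \<le> (\<integral>\<^sup>+t. ennreal (\<phi> t / L + g t) * indicator {l..<l + L} t \<partial>lborel)"
proof -
  have g0: "g t \<ge> 0" for t using g[of t] by (meson abs_ge_zero order_trans)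
  have cphi: "continuous_on UNIV \<phi>"
    using d by (auto simp: continuous_on_eq_continuous_at intro: has_vector_derivative_continuous)
  have [measurable]: "\<phi> \<in> borel_measurable borel" "g \<in> borel_measurable borel"
    using gm borel_measurable_continuous_onI[OF cphi] by auto
  define G where "G = (\<integral>\<^sup>+t. ennreal (g t) * indicator {l..<l + L} t \<partial>lborel)"
  have half: "(\<integral>\<^sup>+t. ennreal (g t) * indicator {a..b} t \<partial>lborel) \<le> G" if "l \<le> a" "b < l + L" for a b
    unfolding G_def using that by (intro nn_integral_mono) (auto split: split_indicator)
  have diff: "ennreal (\<phi> s) \<le> ennreal (\<phi> t) + G" if t: "t \<in> {l..<l + L}" for t
  proof -
    have "ennreal (norm (\<phi> (max s t) - \<phi> (min s t))) \<le> (\<integral>\<^sup>+u. ennreal (g u) * indicator {min s t..max s t} u \<partial>lborel)"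
      by (rule ennreal_norm_diff_le_nn_integral[OF _ d continuous_on_subset[OF c]]) (use g in auto)
    also have "\<dots> \<le> G" using s t by (intro half) auto
    finally have "ennreal \<bar>\<phi> s - \<phi> t\<bar> \<le> G" by (auto simp: max_def min_def abs_minus_commute split: if_splits)
    moreover have "ennreal (\<phi> s) \<le> ennreal (\<phi> t) + ennreal \<bar>\<phi> s - \<phi> t\<bar>"
      using ennreal_leI[of "\<phi> s" "\<phi> t + \<bar>\<phi> s - \<phi> t\<bar>"] by (simp add: pos ennreal_plus)
    ultimately show ?thesis by (meson add_left_mono order_trans)
  qed
  have "ennreal (\<phi> s) * ennreal L = (\<integral>\<^sup>+t. ennreal (\<phi> s) * indicator {l..<l + L} t \<partial>lborel)"
    using L by (simp add: nn_integral_cmult)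
  also have "\<dots> \<le> (\<integral>\<^sup>+t. ennreal (\<phi> t) * indicator {l..<l + L} t + G * indicator {l..<l + L} t \<partial>lborel)"
    using diff by (intro nn_integral_mono) (auto split: split_indicator)
  also have "\<dots> = (\<integral>\<^sup>+t. ennreal (\<phi> t) * indicator {l..<l + L} t \<partial>lborel) + G * ennreal L"
    using L by (subst nn_integral_add) (auto simp: nn_integral_cmult)
  also have "\<dots> = ennreal L * (\<integral>\<^sup>+t. ennreal (\<phi> t / L + g t) * indicator {l..<l + L} t \<partial>lborel)"
  proof -
    have "(\<integral>\<^sup>+t. ennreal (\<phi> t / L + g t) * indicator {l..<l + L} t \<partial>lborel)
      = (\<integral>\<^sup>+t. ennreal (1 / L) * (ennreal (\<phi> t) * indicator {l..<l + L} t) + ennreal (g t) * indicator {l..<l + L} t \<partial>lborel)"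
      using L by (intro nn_integral_cong) (auto split: split_indicator simp: ennreal_mult[symmetric] pos g0)
    also have "\<dots> = ennreal (1 / L) * (\<integral>\<^sup>+t. ennreal (\<phi> t) * indicator {l..<l + L} t \<partial>lborel) + G"
      unfolding G_def by (subst nn_integral_add) (auto simp: nn_integral_cmult)
    finally show ?thesis
      using L by (simp add: distrib_left mult.assoc[symmetric] ennreal_mult[symmetric] mult.commute)
  qed
  finally have "ennreal L * ennreal (\<phi> s) \<le> ennreal L * (\<integral>\<^sup>+t. ennreal (\<phi> t / L + g t) * indicator {l..<l + L} t \<partial>lborel)"
    by (simp add: mult.commute)
  then have "ennreal (1 / L) * (ennreal L * ennreal (\<phi> s)) \<le> ennreal (1 / L) * (ennreal L * (\<integral>\<^sup>+t. ennreal (\<phi> t / L + g t) * indicator {l..<l + L} t \<partial>lborel))"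
    by (rule mult_left_mono) simp
  moreover have "ennreal (1 / L) * (ennreal L * Y) = Y" for Y
    unfolding mult.assoc[symmetric] using L by (subst ennreal_mult[symmetric]) auto
  ultimately show ?thesis by (simp only:)
qed

text \<open>The inner integral of \<open>rho\<close> for an arbitrary integrand, because the line
  estimates also need marginals of energy densities.\<close>

definition marg :: "nat \<Rightarrow> nat \<Rightarrow> ((nat \<Rightarrow> real^2) \<Rightarrow> ennreal) \<Rightarrow> real^2 \<Rightarrow> ennreal" where
  "marg N j g x = (\<integral>\<^sup>+y. g (y(j := x)) \<partial>PiM ({..<N} - {j}) (\<lambda>_. lborel))"

lemma measurable_upd:
  assumes "j < N" "g \<in> borel_measurable (cfgM N)"
  shows "(\<lambda>(y, x). g (y(j := x))) \<in> borel_measurable (PiM ({..<N} - {j}) (\<lambda>_. lborel) \<Otimes>\<^sub>M lborel)"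
proof -
  have s: "insert j ({..<N} - {j}) = {..<N}" using assms by auto
  have "(\<lambda>(y, x). y(j := x)) \<in> measurable (PiM ({..<N} - {j}) (\<lambda>_. lborel) \<Otimes>\<^sub>M lborel) (cfgM N)"
    using measurable_add_dim[of j "{..<N} - {j}" "\<lambda>_. lborel :: (real^2) measure"] unfolding cfgM_def s .
  from measurable_compose[OF this assms(2)] show ?thesis by (simp add: case_prod_unfold)
qed

lemma measurable_marg:
  assumes "j < N" "g \<in> borel_measurable (cfgM N)"
  shows "marg N j g \<in> borel_measurable borel"
proof -
  interpret product_sigma_finite "\<lambda>_::nat. lborel :: (real^2) measure" ..
  interpret S: sigma_finite_measure "PiM ({..<N} - {j}) (\<lambda>_. lborel :: (real^2) measure)" by (intro sigma_finite) auto
  have "(\<lambda>(x, y). g (y(j := x))) \<in> borel_measurable (lborel \<Otimes>\<^sub>M PiM ({..<N} - {j}) (\<lambda>_. lborel))"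
    using measurable_compose[OF measurable_pair_swap' measurable_upd[OF assms]] by (simp add: case_prod_unfold)
  from S.borel_measurable_nn_integral[OF this] show ?thesis unfolding marg_def[abs_def] by simp
qed

lemma nn_integral_marg:
  assumes j: "j < N" and g: "g \<in> borel_measurable (cfgM N)" and Q: "q \<in> borel_measurable borel"
  shows "(\<integral>\<^sup>+x. g x * q (x j) \<partial>cfgM N) = (\<integral>\<^sup>+x. marg N j g x * q x \<partial>lborel)"
proof -
  interpret product_sigma_finite "\<lambda>_::nat. lborel :: (real^2) measure" ..
  have s: "{..<N} = insert j ({..<N} - {j})" using j by auto
  have [measurable]: "(\<lambda>x. q (x j)) \<in> borel_measurable (cfgM N)"
    using j by (intro measurable_compose[OF _ Q]) measurable
  have m: "(\<lambda>x. g x * q (x j)) \<in> borel_measurable (cfgM N)" using g by measurable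
  then have m': "(\<lambda>x. g x * q (x j)) \<in> borel_measurable (PiM (insert j ({..<N} - {j})) (\<lambda>_. lborel))"
    unfolding cfgM_def using s by simp
  have gy: "(\<lambda>y. g (y(j := x))) \<in> borel_measurable (PiM ({..<N} - {j}) (\<lambda>_. lborel))" for x
    using measurable_Pair1'[of x] measurable_compose[OF measurable_Pair2'[of x lborel "PiM ({..<N} - {j}) (\<lambda>_. lborel)"] measurable_upd[OF j g]]
    by simp
  have "(\<integral>\<^sup>+x. g x * q (x j) \<partial>cfgM N) = (\<integral>\<^sup>+x. \<integral>\<^sup>+y. g (y(j := x)) * q x \<partial>PiM ({..<N} - {j}) (\<lambda>_. lborel) \<partial>lborel)"
    unfolding cfgM_def by (subst s) (subst product_nn_integral_insert_rev[OF _ _ m'], auto)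
  also have "\<dots> = (\<integral>\<^sup>+x. marg N j g x * q x \<partial>lborel)"
    unfolding marg_def using gy by (intro nn_integral_cong nn_integral_multc) auto
  finally show ?thesis .
qed

lemma borel_measurable_rho:
  assumes "\<Psi> \<in> borel_measurable (cfgM N)"
  shows "rho N \<Psi> \<in> borel_measurable borel"
proof -
  have "rho N \<Psi> x = (\<Sum>j<N. marg N j (\<lambda>x. ennreal ((cmod (\<Psi> x))\<^sup>2)) x)" for x
    by (simp add: rho_def marg_def)
  moreover have "(\<lambda>x. ennreal ((cmod (\<Psi> x))\<^sup>2)) \<in> borel_measurable (cfgM N)" using assms by measurable
  ultimately show ?thesis using measurable_marg by (subst measurable_cong[where g="\<lambda>x. \<Sum>j<N. marg N j (\<lambda>x. ennreal ((cmod (\<Psi> x))\<^sup>2)) x"]) auto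
qed

context anyon_fn begin

lemma rho_marg: "rho N f x = (\<Sum>j<N. marg N j (\<lambda>x. ennreal (Wf x)) x)"
  by (simp add: rho_def marg_def Wf_def)

text \<open>The parameter \<open>\<eta>\<close> stays free: its best value depends on mass and
  energy of the whole square, which are available only after all integrations.\<close>

lemma line_bound:
  assumes j: "j < N" and y: "y \<in> PiE ({..<N} - {j}) (\<lambda>_. UNIV)" and L: "L > 0" and s: "l \<le> s" "s < l + L" and \<eta>: "\<eta> > 0"
  shows "ennreal (Wf (y(j := v + s *\<^sub>R axis c 1))) \<le>
    (\<integral>\<^sup>+t. ennreal ((1/L + \<eta>) * Wf (y(j := v + t *\<^sub>R axis c 1)) + En j (y(j := v + t *\<^sub>R axis c 1)) / \<eta>) * indicator {l..<l + L} t \<partial>lborel)"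
proof -
  let ?x = "\<lambda>t. y(j := v + t *\<^sub>R axis c 1)"
  have cfg: "y(j := b) \<in> cfg N" for b using y j by (auto simp: cfg_def PiE_def extensional_def)
  have sh: "((\<lambda>u. u - t) has_vector_derivative 1) (at t)" for t :: real
    by (auto intro!: derivative_eq_intros)
  have df: "((\<lambda>t. f (?x t)) has_vector_derivative pdiff j c f (?x t)) (at t)" for t
  proof -
    have "((\<lambda>u. f ((?x t)(j := ?x t j + u *\<^sub>R axis c 1))) \<circ> (\<lambda>u. u - t) has_vector_derivative 1 *\<^sub>R pdiff j c f (?x t)) (at t)"
      using deriv_pdiff[OF j cfg] by (intro vector_diff_chain_at[OF sh]) simp
    then show ?thesis by (simp add: o_def algebra_simps)
  qed
  define w' where "w' t = 2 * Re (cnj (f (?x t)) * pdiff j c f (?x t))" for t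
  have dw: "((\<lambda>t. Wf (?x t)) has_vector_derivative w' t) (at t)" for t
    unfolding Wf_def w'_def by (rule has_vector_derivative_cmod_sq[OF df])
  have ct: "continuous_on UNIV ?x"
  proof (rule continuous_on_coordinatewise_then_product)
    show "continuous_on UNIV (\<lambda>t. ?x t i)" for i
      by (cases "i = j") (auto intro!: continuous_intros)
  qed
  have cc: "continuous_on UNIV (\<lambda>t. g (?x t))" if "continuous_on (cfg N) g" for g :: "_ \<Rightarrow> complex"
    using cfg by (intro continuous_on_compose2[OF that ct]) auto
  have cw: "continuous_on UNIV w'"
    unfolding w'_def by (intro continuous_intros cc cont_f cont_pdiff j)
  have bw: "\<bar>w' t\<bar> \<le> \<eta> * Wf (?x t) + En j (?x t) / \<eta>" for t
  proof -
    let ?D = "Dop \<alpha> N j c f (?x t)"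
    have "w' t = 2 * Re (cnj (f (?x t)) * (\<i> * ?D))"
      unfolding w'_def Dop_def by (simp add: algebra_simps)
    then have "\<bar>w' t\<bar> = 2 * \<bar>Re (cnj (f (?x t)) * (\<i> * ?D))\<bar>" by (simp only: abs_mult abs_numeral)
    also have "\<dots> \<le> 2 * cmod (cnj (f (?x t)) * (\<i> * ?D))" by (intro mult_left_mono abs_Re_le_cmod) auto
    also have "\<dots> = 2 * cmod (f (?x t)) * cmod ?D" by (simp add: norm_mult)
    finally have A: "\<bar>w' t\<bar> \<le> 2 * cmod (f (?x t)) * cmod ?D" .
    have B: "2 * cmod (f (?x t)) * cmod ?D \<le> \<eta> * Wf (?x t) + (cmod ?D)\<^sup>2 / \<eta>"
    proof -
      have "0 \<le> (\<eta> * cmod (f (?x t)) - cmod ?D)\<^sup>2" by simp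
      then have "2 * \<eta> * (cmod (f (?x t)) * cmod ?D) \<le> \<eta>\<^sup>2 * Wf (?x t) + (cmod ?D)\<^sup>2"
        by (simp add: power2_diff power_mult_distrib Wf_def algebra_simps)
      then show ?thesis using \<eta> by (simp add: field_simps power2_eq_square)
    qed
    have "(cmod ?D)\<^sup>2 \<le> En j (?x t)"
      unfolding En_def by (rule member_le_sum) auto
    then have "(cmod ?D)\<^sup>2 / \<eta> \<le> En j (?x t) / \<eta>" using \<eta> by (intro divide_right_mono) auto
    with A B show ?thesis by linarith
  qed
  have "(\<lambda>t. ?x t) \<in> measurable borel (cfgM N)"
    unfolding cfgM_def
  proof (rule measurable_PiM_single')
    show "(\<lambda>t. ?x t i) \<in> measurable borel lborel" if "i \<in> {..<N}" for i
      by (cases "i = j") auto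
    show "(\<lambda>t i. ?x t i) \<in> space borel \<rightarrow> (\<Pi>\<^sub>E i\<in>{..<N}. space lborel)" 
      by (rule funcsetI) (use cfg in \<open>simp add: cfg_def del: fun_upd_apply\<close>)
  qed
  note xm = measurable_compose[OF this]
  have gm: "(\<lambda>t. \<eta> * Wf (?x t) + En j (?x t) / \<eta>) \<in> borel_measurable borel"
    by (intro borel_measurable_add borel_measurable_times borel_measurable_divide borel_measurable_const
        xm[OF meas_Wf] xm[OF meas_En[OF j]])
  have "ennreal (Wf (?x s)) \<le> (\<integral>\<^sup>+t. ennreal (Wf (?x t) / L + (\<eta> * Wf (?x t) + En j (?x t) / \<eta>)) * indicator {l..<l + L} t \<partial>lborel)"
    by (rule nn_integral_line_average[OF L s dw cw bw gm Wf_nonneg])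
  then show ?thesis by (simp add: algebra_simps)
qed

lemma marg_line_bound:
  assumes j: "j < N" and L: "L > 0" and s: "l \<le> s" "s < l + L" and \<eta>: "\<eta> > 0"
  defines "B \<equiv> \<lambda>x. ennreal ((1/L + \<eta>) * Wf x + En j x / \<eta>)"
  shows "marg N j (\<lambda>x. ennreal (Wf x)) (v + s *\<^sub>R axis c 1) \<le> (\<integral>\<^sup>+u. marg N j B (v + u *\<^sub>R axis c 1) * indicator {l..<l + L} u \<partial>lborel)"
proof -
  interpret product_sigma_finite "\<lambda>_::nat. lborel :: (real^2) measure" ..
  let ?P = "PiM ({..<N} - {j}) (\<lambda>_. lborel :: (real^2) measure)"
  interpret S: sigma_finite_measure ?P by (intro sigma_finite) auto
  interpret PS: pair_sigma_finite ?P "lborel :: real measure" ..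
  have B: "B \<in> borel_measurable (cfgM N)" unfolding B_def using j by measurable
  have mp: "(\<lambda>(y, u). (y, v + u *\<^sub>R axis c 1)) \<in> measurable (?P \<Otimes>\<^sub>M lborel) (?P \<Otimes>\<^sub>M lborel)"
    by measurable
  have m0: "(\<lambda>(y, u). B (y(j := v + u *\<^sub>R axis c 1))) \<in> borel_measurable (?P \<Otimes>\<^sub>M lborel)"
    using measurable_compose[OF mp measurable_upd[OF j B]] by (simp add: case_prod_unfold)
  then have m: "(\<lambda>(y, u). B (y(j := v + u *\<^sub>R axis c 1)) * indicator {l..<l + L} u) \<in> borel_measurable (?P \<Otimes>\<^sub>M lborel)"
    by (simp add: case_prod_unfold) measurable
  have "marg N j (\<lambda>x. ennreal (Wf x)) (v + s *\<^sub>R axis c 1) \<le> (\<integral>\<^sup>+y. \<integral>\<^sup>+u. B (y(j := v + u *\<^sub>R axis c 1)) * indicator {l..<l + L} u \<partial>lborel \<partial>?P)"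
    unfolding marg_def B_def by (intro nn_integral_mono line_bound[OF j _ L s \<eta>]) (simp add: space_PiM)
  also have "\<dots> = (\<integral>\<^sup>+u. \<integral>\<^sup>+y. B (y(j := v + u *\<^sub>R axis c 1)) * indicator {l..<l + L} u \<partial>?P \<partial>lborel)"
    by (rule PS.Fubini'[symmetric]) (rule m)
  also have "\<dots> = (\<integral>\<^sup>+u. marg N j B (v + u *\<^sub>R axis c 1) * indicator {l..<l + L} u \<partial>lborel)"
    unfolding marg_def
  proof (intro nn_integral_cong nn_integral_multc)
    fix u :: real
    show "(\<lambda>y. B (y(j := v + u *\<^sub>R axis c 1))) \<in> borel_measurable ?P"
      using measurable_compose[OF measurable_Pair2'[of u lborel ?P] m0] by simp
  qed
  finally show ?thesis .
qed

text \<open>Averaging along horizontal lines bounds the density by a function \<open>H1\<close> of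
  the second coordinate, along vertical lines by a function \<open>H2\<close> of the first. So its
  square is at most \<open>H2 s * H1 t\<close>, whose integral factorises, and both factors equal
  \<open>K\<close>.\<close>

lemma local_uncertainty:
  assumes L: "L > 0" and \<eta>: "\<eta> > 0"
  shows "(\<integral>\<^sup>+x. (rho N f x)\<^sup>2 * indicator (sq p L) x \<partial>lborel)
    \<le> (ennreal (1/L + \<eta>) * mass (sq p L) + ennreal (1/\<eta>) * kin (sq p L))\<^sup>2"
proof -
  let ?Q = "sq p L"
  define B where "B j x = ennreal ((1/L + \<eta>) * Wf x + En j x / \<eta>)" for j x
  have Bm: "B j \<in> borel_measurable (cfgM N)" if "j < N" for j unfolding B_def using that by measurable
  define M where "M j = marg N j (B j)" for j
  have Mm: "M j \<in> borel_measurable borel" if "j < N" for j unfolding M_def by (rule measurable_marg[OF that Bm[OF that]])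
  define e :: "real \<Rightarrow> real \<Rightarrow> real^2" where "e s t = vector [s, t]" for s t
  have e: "e s t = t *\<^sub>R axis 2 1 + s *\<^sub>R axis 1 1" "e s t = s *\<^sub>R axis 1 1 + t *\<^sub>R axis 2 1" for s t
    by (simp_all add: e_def vec_eq_iff forall_2 axis_def)
  let ?i1 = "\<lambda>s. indicator {p$1..<p$1 + L} s :: ennreal" and ?i2 = "\<lambda>t. indicator {p$2..<p$2 + L} t :: ennreal"
  have iQ: "indicator ?Q (e s t) = ?i1 s * ?i2 t" for s t
    by (auto simp: e_def mem_sq split: split_indicator)
  define H1 where "H1 t = (\<Sum>j<N. \<integral>\<^sup>+u. M j (e u t) * ?i1 u \<partial>lborel)" for t
  define H2 where "H2 s = (\<Sum>j<N. \<integral>\<^sup>+u. M j (e s u) * ?i2 u \<partial>lborel)" for s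
  have em [measurable]: "(\<lambda>(s, t). e s t) \<in> borel_measurable (lborel \<Otimes>\<^sub>M lborel)" "(\<lambda>(s, t). e t s) \<in> borel_measurable (lborel \<Otimes>\<^sub>M lborel)"
    unfolding e by measurable
  have Me: "(\<lambda>(s, t). M j (e s t)) \<in> borel_measurable (lborel \<Otimes>\<^sub>M lborel)" "(\<lambda>(s, t). M j (e t s)) \<in> borel_measurable (lborel \<Otimes>\<^sub>M lborel)" if "j < N" for j
    using measurable_compose[OF em(1) Mm[OF that]] measurable_compose[OF em(2) Mm[OF that]] by (simp_all add: case_prod_unfold)
  have I1: "(\<lambda>t. \<integral>\<^sup>+u. M j (e u t) * ?i1 u \<partial>lborel) \<in> borel_measurable lborel" if "j < N" for j
    using Me(2)[OF that] by (intro lborel.borel_measurable_nn_integral) (simp add: case_prod_unfold, measurable)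
  have I2: "(\<lambda>s. \<integral>\<^sup>+u. M j (e s u) * ?i2 u \<partial>lborel) \<in> borel_measurable lborel" if "j < N" for j
    using Me(1)[OF that] by (intro lborel.borel_measurable_nn_integral) (simp add: case_prod_unfold, measurable)
  have H1m [measurable]: "H1 \<in> borel_measurable lborel" unfolding H1_def[abs_def] by (intro borel_measurable_sum I1) simp
  have H2m [measurable]: "H2 \<in> borel_measurable lborel" unfolding H2_def[abs_def] by (intro borel_measurable_sum I2) simp
  define K where "K = (\<Sum>j<N. \<integral>\<^sup>+x. M j x * indicator ?Q x \<partial>lborel)"
  have K: "K = ennreal (1/L + \<eta>) * mass ?Q + ennreal (1/\<eta>) * kin ?Q"
  proof -
    have "(\<integral>\<^sup>+x. M j x * indicator ?Q x \<partial>lborel) = ennreal (1/L + \<eta>) * (\<integral>\<^sup>+x. ennreal (Wf x) * indicator ?Q (x j) \<partial>cfgM N) + ennreal (1/\<eta>) * (\<integral>\<^sup>+x. ennreal (En j x) * indicator ?Q (x j) \<partial>cfgM N)"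
      if j: "j < N" for j
    proof -
      have [measurable]: "(\<lambda>x. indicator ?Q (x j) :: ennreal) \<in> borel_measurable (cfgM N)" using j by measurable
      have "(\<integral>\<^sup>+x. M j x * indicator ?Q x \<partial>lborel) = (\<integral>\<^sup>+x. B j x * indicator ?Q (x j) \<partial>cfgM N)"
        unfolding M_def by (rule nn_integral_marg[OF j Bm[OF j], symmetric]) measurable
      also have "\<dots> = (\<integral>\<^sup>+x. ennreal (1/L + \<eta>) * (ennreal (Wf x) * indicator ?Q (x j)) + ennreal (1/\<eta>) * (ennreal (En j x) * indicator ?Q (x j)) \<partial>cfgM N)"
        using L \<eta> by (intro nn_integral_cong)
          (auto simp: B_def ennreal_mult[symmetric] ennreal_plus[symmetric] Wf_nonneg En_nonneg simp del: ennreal_plus split: split_indicator)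
      also have "\<dots> = ennreal (1/L + \<eta>) * (\<integral>\<^sup>+x. ennreal (Wf x) * indicator ?Q (x j) \<partial>cfgM N) + ennreal (1/\<eta>) * (\<integral>\<^sup>+x. ennreal (En j x) * indicator ?Q (x j) \<partial>cfgM N)"
      proof -
        have m1: "(\<lambda>x. ennreal (Wf x) * indicator ?Q (x j)) \<in> borel_measurable (cfgM N)" by measurable
        have m2: "(\<lambda>x. ennreal (En j x) * indicator ?Q (x j)) \<in> borel_measurable (cfgM N)"
          using j by measurable
        show ?thesis using m1 m2 by (simp only: nn_integral_add borel_measurable_times_ennreal borel_measurable_const nn_integral_cmult)
      qed
      finally show ?thesis .
    qed
    then show ?thesis unfolding K_def mass_def kin_def by (simp add: sum.distrib sum_distrib_left)
  qed
  have MQ: "(\<lambda>x. M j x * indicator ?Q x) \<in> borel_measurable borel" if "j < N" for j using Mm[OF that] by measurable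
  have i: "(\<integral>\<^sup>+t. H1 t * ?i2 t \<partial>lborel) = K"
  proof -
    have "(\<integral>\<^sup>+t. H1 t * ?i2 t \<partial>lborel) = (\<Sum>j<N. \<integral>\<^sup>+t. (\<integral>\<^sup>+u. M j (e u t) * ?i1 u \<partial>lborel) * ?i2 t \<partial>lborel)"
      unfolding H1_def sum_distrib_right by (rule nn_integral_sum) (use I1 in measurable)
    also have "\<dots> = K" unfolding K_def
    proof (intro sum.cong refl)
      fix j assume "j \<in> {..<N}"
      then have j: "j < N" by simp
      have "(\<integral>\<^sup>+x. M j x * indicator ?Q x \<partial>lborel) = (\<integral>\<^sup>+t. \<integral>\<^sup>+u. M j (e u t) * ?i1 u * ?i2 t \<partial>lborel \<partial>lborel)"
        by (subst nn_integral_lborel_vector2(2)[OF MQ[OF j]]) (simp add: iQ mult.assoc flip: e_def)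
      also have "\<dots> = (\<integral>\<^sup>+t. (\<integral>\<^sup>+u. M j (e u t) * ?i1 u \<partial>lborel) * ?i2 t \<partial>lborel)"
      proof (intro nn_integral_cong nn_integral_multc)
        fix t show "(\<lambda>u. M j (e u t) * ?i1 u) \<in> borel_measurable lborel"
          using measurable_compose[OF measurable_Pair2'[of t lborel lborel] Me(1)[OF j]] by simp
      qed
      finally show "(\<integral>\<^sup>+t. (\<integral>\<^sup>+u. M j (e u t) * ?i1 u \<partial>lborel) * ?i2 t \<partial>lborel) = (\<integral>\<^sup>+x. M j x * indicator ?Q x \<partial>lborel)" by simp
    qed
    finally show ?thesis .
  qed
  have ii: "(\<integral>\<^sup>+s. H2 s * ?i1 s \<partial>lborel) = K"
  proof -
    have "(\<integral>\<^sup>+s. H2 s * ?i1 s \<partial>lborel) = (\<Sum>j<N. \<integral>\<^sup>+s. (\<integral>\<^sup>+u. M j (e s u) * ?i2 u \<partial>lborel) * ?i1 s \<partial>lborel)"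
      unfolding H2_def sum_distrib_right by (rule nn_integral_sum) (use I2 in measurable)
    also have "\<dots> = K" unfolding K_def
    proof (intro sum.cong refl)
      fix j assume "j \<in> {..<N}"
      then have j: "j < N" by simp
      have "(\<integral>\<^sup>+x. M j x * indicator ?Q x \<partial>lborel) = (\<integral>\<^sup>+s. \<integral>\<^sup>+u. M j (e s u) * ?i2 u * ?i1 s \<partial>lborel \<partial>lborel)"
        by (subst nn_integral_lborel_vector2(1)[OF MQ[OF j]]) (simp add: iQ mult_ac flip: e_def)
      also have "\<dots> = (\<integral>\<^sup>+s. (\<integral>\<^sup>+u. M j (e s u) * ?i2 u \<partial>lborel) * ?i1 s \<partial>lborel)"
      proof (intro nn_integral_cong nn_integral_multc)
        fix s show "(\<lambda>u. M j (e s u) * ?i2 u) \<in> borel_measurable lborel"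
          using measurable_compose[OF measurable_Pair2'[of s lborel lborel] Me(2)[OF j]] by simp
      qed
      finally show "(\<integral>\<^sup>+s. (\<integral>\<^sup>+u. M j (e s u) * ?i2 u \<partial>lborel) * ?i1 s \<partial>lborel) = (\<integral>\<^sup>+x. M j x * indicator ?Q x \<partial>lborel)" by simp
    qed
    finally show ?thesis .
  qed
  have r1: "rho N f (e s t) \<le> H1 t" if "p$1 \<le> s" "s < p$1 + L" for s t
    unfolding rho_marg H1_def M_def B_def e(1) by (intro sum_mono marg_line_bound[OF _ L that \<eta>]) simp
  have r2: "rho N f (e s t) \<le> H2 s" if "p$2 \<le> t" "t < p$2 + L" for s t
    unfolding rho_marg H2_def M_def B_def e(2) by (intro sum_mono marg_line_bound[OF _ L that \<eta>]) simp
  have rm: "(\<lambda>x. (rho N f x)\<^sup>2 * indicator ?Q x) \<in> borel_measurable borel"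
    using borel_measurable_rho[OF meas_f] by measurable
  have "(\<integral>\<^sup>+x. (rho N f x)\<^sup>2 * indicator ?Q x \<partial>lborel) = (\<integral>\<^sup>+s. \<integral>\<^sup>+t. (rho N f (e s t))\<^sup>2 * (?i1 s * ?i2 t) \<partial>lborel \<partial>lborel)"
    by (subst nn_integral_lborel_vector2(1)[OF rm]) (simp add: iQ flip: e_def)
  also have "\<dots> \<le> (\<integral>\<^sup>+s. \<integral>\<^sup>+t. (H2 s * ?i1 s) * (H1 t * ?i2 t) \<partial>lborel \<partial>lborel)"
    by (intro nn_integral_mono) (auto split: split_indicator simp: power2_eq_square intro!: mult_mono r1 r2)
  also have "\<dots> = K * K"
    by (subst nn_integral_cmult) (auto simp: i ii nn_integral_multc)
  finally show ?thesis by (simp add: K power2_eq_square)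
qed

end

section \<open>Covering by squares\<close>

text \<open>The best \<open>\<eta>\<close> is \<open>sqrt (t / m)\<close>. If this is at most
  \<open>1 / L\<close>, the choice \<open>1 / L\<close> does as well. In both cases the bracket is a
  sum of three terms with a common bound, whose square brings the 9.\<close>

lemma uncertainty_optimise:
  fixes m s t L :: real
  assumes L: "L > 0" and m: "m \<ge> 0" and t: "t \<ge> 0" and s: "s \<ge> 0"
    and le: "\<And>\<eta>. \<eta> > 0 \<Longrightarrow> s \<le> ((1/L + \<eta>) * m + (1/\<eta>) * t)\<^sup>2"
  shows "s \<le> 9 * (m\<^sup>2 / L\<^sup>2 + m * t)"
proof -
  consider "m = 0" | "m > 0" "t \<le> m / L\<^sup>2" | "m > 0" "t > m / L\<^sup>2" using m by linarith
  then show ?thesis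
  proof cases
    case 1
    have "s \<le> 0"
    proof (rule ccontr)
      assume "\<not> s \<le> 0"
      then have s: "s > 0" by simp
      show False
      proof (cases "t = 0")
        case True then show False using le[of 1] 1 s by simp
      next
        case False
        \<comment> \<open>For this \<open>\<eta>\<close> the bracket is \<open>sqrt s / 2\<close>,
          so \<open>s\<close> would be at most a quarter of itself.\<close>
        then have "2 * t / sqrt s > 0" using t s by simp
        from le[OF this] have "s \<le> (sqrt s / 2)\<^sup>2" using 1 False by simp
        then show False using s by (simp add: power_divide)
      qed
    qed
    then show ?thesis using 1 by simp
  next
    case 2
    have "s \<le> ((1/L + 1/L) * m + L * t)\<^sup>2" using le[of "1/L"] L by simp
    also have "\<dots> \<le> (3 * m / L)\<^sup>2"
    proof (rule power_mono)
      have "L * t \<le> L * (m / L\<^sup>2)" using 2 L by (intro mult_left_mono) auto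
      also have "\<dots> = m / L" using L by (simp add: power2_eq_square)
      finally show "(1/L + 1/L) * m + L * t \<le> 3 * m / L" using L by (simp add: field_simps)
    qed (use L t m in simp)
    also have "\<dots> = 9 * (m\<^sup>2 / L\<^sup>2)" by (simp add: power_divide power_mult_distrib)
    also have "\<dots> \<le> 9 * (m\<^sup>2 / L\<^sup>2 + m * t)" using m t by simp
    finally show ?thesis .
  next
    case 3
    have tp: "t > 0" using 3 L by (meson divide_pos_pos less_trans zero_less_power)
    define r where "r = sqrt (t * m)"
    have r2: "r\<^sup>2 = t * m" using t m by (simp add: r_def)
    have r0: "r > 0" using tp 3 by (simp add: r_def)
    have eta: "r / m > 0" using r0 3 by simp
    have "s \<le> ((1/L + r/m) * m + (1/(r/m)) * t)\<^sup>2" by (rule le[OF eta])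
    also have "(1/L + r/m) * m + (1/(r/m)) * t = m / L + r + r"
      using r2 r0 3 by (simp add: field_simps power2_eq_square)
    also have "(m / L + r + r)\<^sup>2 \<le> (3 * r)\<^sup>2"
    proof (rule power_mono)
      have "(m / L)\<^sup>2 = m * (m / L\<^sup>2)" by (simp add: power_divide power2_eq_square)
      also have "\<dots> \<le> m * t" using 3 by (intro mult_left_mono) auto
      also have "\<dots> = r\<^sup>2" using r2 by (simp add: mult.commute)
      finally have "m / L \<le> r" by (rule power2_le_imp_le) (use r0 in simp)
      then show "m / L + r + r \<le> 3 * r" by simp
    qed (use L m r0 in simp)
    also have "\<dots> = 9 * (m * t)" using r2 by (simp add: power_mult_distrib mult.commute)
    also have "\<dots> \<le> 9 * (m\<^sup>2 / L\<^sup>2 + m * t)" by simp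
    finally show ?thesis .
  qed
qed

text \<open>A square of large mass is halved until its mass drops below \<open>6 lam\<close>. Each time, at least one of the four
  parts carries mass \<open>\<ge> 3/2 lam\<close>, and the exclusion energy of that part, which grows by a factor of four,
  pays for the negative error terms of the other three.\<close>
lemma dyadic_covering:
  fixes m s t :: "real \<Rightarrow> real \<Rightarrow> real \<Rightarrow> real" and a lam \<kappa> S :: real
  assumes a: "0 \<le> a" "a \<le> 1" and lam: "lam > 0" and \<kappa>: "0 \<le> \<kappa>" "\<kappa> \<le> 1"
    and m0: "\<And>x y L. m x y L \<ge> 0" and t0: "\<And>x y L. t x y L \<ge> 0"
    and msplit: "\<And>x y L. L > 0 \<Longrightarrow> m x y (2 * L) = m x y L + m (x + L) y L + m x (y + L) L + m (x + L) (y + L) L"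
    and ssplit: "\<And>x y L. L > 0 \<Longrightarrow> s x y (2 * L) = s x y L + s (x + L) y L + s x (y + L) L + s (x + L) (y + L) L"
    and tsplit: "\<And>x y L. L > 0 \<Longrightarrow> t x y (2 * L) = t x y L + t (x + L) y L + t x (y + L) L + t (x + L) (y + L) L"
    and unc: "\<And>x y L. L > 0 \<Longrightarrow> s x y L \<le> 9 * ((m x y L)\<^sup>2 / L\<^sup>2 + m x y L * t x y L)"
    and excl: "\<And>x y L. L > 0 \<Longrightarrow> \<kappa> * a * (m x y L - lam) \<le> L\<^sup>2 * t x y L"
    and cs: "\<And>x y L. L > 0 \<Longrightarrow> (m x y L)\<^sup>2 \<le> L\<^sup>2 * S"
    and L: "L > 0" and big: "m x y L \<ge> 3/2 * lam"
  shows "\<kappa> / 120 * a / (54 * lam) * s x y L + 24 * (\<kappa> / 120 * a * lam / L\<^sup>2) \<le> t x y L"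
proof -
  define e where "e = \<kappa> / 120 * a"
  have e0: "e \<ge> 0" and e1: "e \<le> 1/2"
  proof -
    have "\<kappa> * a \<le> 1" using a \<kappa> by (simp add: mult_le_one)
    then show "e \<ge> 0" "e \<le> 1/2" using a \<kappa> by (simp_all add: e_def)
  qed
  \<comment> \<open>Below mass \<open>6 lam\<close> the uncertainty bound becomes linear in the
    energy, with slope \<open>9 * 6 lam = 54 lam\<close> and an error of 6 units
    \<open>e lam / L^2\<close>.\<close>
  have small: "e / (54 * lam) * s x y L - 6 * (e * lam / L\<^sup>2) \<le> e * t x y L" if "L > 0" "m x y L < 6 * lam" for x y L
  proof -
    have "s x y L \<le> 9 * (m x y L * (m x y L / L\<^sup>2 + t x y L))"
      using unc[OF that(1), of x y] by (simp add: power2_eq_square algebra_simps)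
    also have "\<dots> \<le> 9 * ((6 * lam) * (6 * lam / L\<^sup>2 + t x y L))"
      using that m0[of x y L] t0[of x y L] lam by (intro mult_left_mono mult_mono add_right_mono divide_right_mono) auto
    finally have "s x y L / (54 * lam) \<le> 6 * lam / L\<^sup>2 + t x y L"
      using lam by (simp add: field_simps)
    then have "e * (s x y L / (54 * lam)) \<le> e * (6 * lam / L\<^sup>2 + t x y L)" using e0 by (intro mult_left_mono)
    then show ?thesis by (simp add: algebra_simps)
  qed
  have bad: "e / (54 * lam) * s x y L - 6 * (e * lam / L\<^sup>2) \<le> t x y L" if "L > 0" "m x y L < 6 * lam" for x y L
  proof -
    have "e * t x y L \<le> 1 * t x y L" using e1 t0 by (intro mult_right_mono) auto
    with small[OF that] show ?thesis by linarith
  qed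
  \<comment> \<open>From mass \<open>3/2 lam\<close> on, exclusion provides 60 units
    \<open>e lam / L^2\<close> of energy; this is where the 120 in \<open>e\<close> comes from. Half
    of the energy supplies 30 units: 6 cancel the error and 24 stay in reserve.\<close>
  have mid: "e / (54 * lam) * s x y L + 24 * (e * lam / L\<^sup>2) \<le> t x y L"
    if L: "L > 0" and lt: "m x y L < 6 * lam" and ge: "m x y L \<ge> 3/2 * lam" for x y L
  proof -
    have "e * t x y L \<le> 1/2 * t x y L" using e1 t0 by (intro mult_right_mono) auto
    with small[OF L lt] have A: "e / (54 * lam) * s x y L - 6 * (e * lam / L\<^sup>2) \<le> t x y L / 2" by simp
    have "120 * e * (lam / 2) \<le> 120 * e * (m x y L - lam)" using ge e0 by (intro mult_left_mono) auto
    also have "\<dots> \<le> L\<^sup>2 * t x y L" using excl[OF L, of x y] by (simp add: e_def)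
    finally have "30 * (e * lam / L\<^sup>2) \<le> t x y L / 2" using L by (simp add: field_simps)
    with A show ?thesis by linarith
  qed
  \<comment> \<open>Induction on the number of halvings still allowed. By \<open>cs\<close>, the
    last hypothesis at \<open>n = 0\<close> forces the mass below \<open>6 lam\<close>, so halving
    must have stopped.\<close>
  have main: "e / (54 * lam) * s x y L + 24 * (e * lam / L\<^sup>2) \<le> t x y L"
    if "L > 0" "m x y L \<ge> 3/2 * lam" "L\<^sup>2 * S < 36 * lam\<^sup>2 * 4^n" for n x y L
    using that
  proof (induction n arbitrary: x y L)
    case base: 0
    show ?case
    proof -
      have "(m x y L)\<^sup>2 < (6 * lam)\<^sup>2" using cs[OF base(1), of x y] base(3) by (simp add: power_mult_distrib)
      then have lt: "m x y L < 6 * lam" by (rule power2_less_imp_less) (use lam in simp)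
      show ?thesis by (rule mid[OF base(1) lt base(2)])
    qed
  next
    case (Suc n)
    show ?case
    proof (cases "m x y L < 6 * lam")
      case True
      show ?thesis by (rule mid[OF Suc.prems(1) True Suc.prems(2)])
    next
      case False
      define h where "h = L / 2"
      have h: "h > 0" and Lh: "L = 2 * h" using Suc.prems by (auto simp: h_def)
      define V where "V = e * lam / L\<^sup>2"
      have V0: "V \<ge> 0" using e0 lam by (simp add: V_def)
      have Vh: "e * lam / h\<^sup>2 = 4 * V" using h by (simp add: V_def Lh power_mult_distrib)
      have hS: "h\<^sup>2 * S < 36 * lam\<^sup>2 * 4 ^ n" using Suc.prems(3) by (simp add: Lh power_mult_distrib mult_ac)
      \<comment> \<open>In units \<open>V\<close> of the large square, halving multiplies the error
        6 and the reserve 24 by four. Mass at least \<open>6 lam\<close> leaves a quarter with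
        \<open>3/2 lam\<close>, and \<open>96 - 3 * 24 = 24\<close> restores the reserve; 24 is the
        fixed point of this balance.\<close>
      have child: "e / (54 * lam) * s x y h + (if m x y h \<ge> 3/2 * lam then 96 * V else - 24 * V) \<le> t x y h" for x y
      proof (cases "m x y h \<ge> 3/2 * lam")
        case True
        from Suc.IH[OF h True hS] show ?thesis using True unfolding Vh by simp
      next
        case False
        then have "m x y h < 6 * lam" using lam by simp
        from bad[OF h this] show ?thesis using False unfolding Vh by simp
      qed
      have ex: "m x y h \<ge> 3/2 * lam \<or> m (x + h) y h \<ge> 3/2 * lam \<or> m x (y + h) h \<ge> 3/2 * lam \<or> m (x + h) (y + h) h \<ge> 3/2 * lam"
        using False msplit[OF h, of x y] unfolding Lh by linarith
      let ?b = "\<lambda>x y. if m x y h \<ge> 3/2 * lam then 96 * V else - 24 * V"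
      have "24 * V \<le> ?b x y + ?b (x + h) y + ?b x (y + h) + ?b (x + h) (y + h)" using ex V0 by auto
      moreover have "e / (54 * lam) * s x y L = e / (54 * lam) * s x y h + e / (54 * lam) * s (x + h) y h + e / (54 * lam) * s x (y + h) h + e / (54 * lam) * s (x + h) (y + h) h"
        unfolding Lh ssplit[OF h] by (simp add: algebra_simps)
      ultimately show ?thesis
        using child[of x y] child[of "x + h" y] child[of x "y + h"] child[of "x + h" "y + h"] tsplit[OF h, of x y]
        unfolding V_def[symmetric] Lh[symmetric] by linarith
    qed
  qed
  have "\<exists>n. L\<^sup>2 * S / (36 * lam\<^sup>2) < 4 ^ n" by (rule real_arch_pow) simp
  then obtain n where "L\<^sup>2 * S < 36 * lam\<^sup>2 * 4 ^ n" using lam by (auto simp: field_simps)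
  from main[OF L big this] show ?thesis by (simp add: e_def)
qed

section \<open>From the local estimates to the kinetic bound for test functions\<close>

lemma indicator_sq_split:
  assumes "L > 0"
  shows "(indicator (sq (vector [x, y]) (2 * L)) v :: ennreal) = indicator (sq (vector [x, y]) L) v
    + indicator (sq (vector [x + L, y]) L) v + indicator (sq (vector [x, y + L]) L) v + indicator (sq (vector [x + L, y + L]) L) v"
  using assms by (auto simp: mem_sq indicator_def)

lemma emeasure_sq: "L \<ge> 0 \<Longrightarrow> emeasure lborel (sq p L) = ennreal (L\<^sup>2)"
proof -
  assume L: "L \<ge> 0"
  have "emeasure lborel (sq p L) = (\<integral>\<^sup>+x. indicator (sq p L) x \<partial>lborel)" by simp
  also have "\<dots> = (\<integral>\<^sup>+s. \<integral>\<^sup>+t. indicator (sq p L) (vector [s, t]) \<partial>lborel \<partial>lborel)"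
    by (rule nn_integral_lborel_vector2(1)) measurable
  also have "\<dots> = (\<integral>\<^sup>+s. \<integral>\<^sup>+t. indicator {p$1..<p$1 + L} s * indicator {p$2..<p$2 + L} t \<partial>lborel \<partial>lborel)"
    by (intro nn_integral_cong) (auto simp: mem_sq split: split_indicator)
  also have "\<dots> = ennreal L * ennreal L" using L by (simp add: nn_integral_cmult nn_integral_multc)
  finally show ?thesis using L by (simp add: ennreal_mult power2_eq_square)
qed

lemma sq_mono: "L \<le> L' \<Longrightarrow> sq p L \<subseteq> sq p L'"
  by (auto simp: mem_sq)

context anyon_fn begin

definition dens2 :: "(real^2) set \<Rightarrow> ennreal" where
  "dens2 Q = (\<integral>\<^sup>+x. (rho N f x)\<^sup>2 * indicator Q x \<partial>lborel)"

lemma measurable_rho [measurable]: "rho N f \<in> borel_measurable borel"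
  by (rule borel_measurable_rho[OF meas_f])

lemma mass_eq: "Q \<in> sets borel \<Longrightarrow> mass Q = (\<integral>\<^sup>+x. rho N f x * indicator Q x \<partial>lborel)"
proof -
  assume [measurable]: "Q \<in> sets borel"
  have m: "marg N j (\<lambda>x. ennreal (Wf x)) \<in> borel_measurable borel" if "j < N" for j
    by (intro measurable_marg that) auto
  have "mass Q = (\<Sum>j<N. \<integral>\<^sup>+x. marg N j (\<lambda>x. ennreal (Wf x)) x * indicator Q x \<partial>lborel)"
    unfolding mass_def by (intro sum.cong refl nn_integral_marg) auto
  also have "\<dots> = (\<integral>\<^sup>+x. (\<Sum>j<N. marg N j (\<lambda>x. ennreal (Wf x)) x * indicator Q x) \<partial>lborel)"
    using m by (intro nn_integral_sum[symmetric]) auto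
  finally show ?thesis by (simp add: rho_marg sum_distrib_right)
qed

lemma mass_UNIV: "mass UNIV = of_nat N * (\<integral>\<^sup>+x. ennreal (Wf x) \<partial>cfgM N)"
  by (simp add: mass_def)

lemma mass_mono: "Q \<subseteq> Q' \<Longrightarrow> mass Q \<le> mass Q'"
  unfolding mass_def by (intro sum_mono nn_integral_mono) (auto split: split_indicator)

lemma kin_mono: "Q \<subseteq> Q' \<Longrightarrow> kin Q \<le> kin Q'"
  unfolding kin_def by (intro sum_mono nn_integral_mono) (auto split: split_indicator)

lemma dens2_mono: "Q \<subseteq> Q' \<Longrightarrow> dens2 Q \<le> dens2 Q'"
  unfolding dens2_def by (intro nn_integral_mono) (auto split: split_indicator)

lemma nn_integral_sq_split:
  assumes L: "L > 0" and g: "g \<in> borel_measurable M" and X: "X \<in> borel_measurable M"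
  shows "(\<integral>\<^sup>+w. g w * indicator (sq (vector [x, y]) (2 * L)) (X w) \<partial>M) =
    (\<integral>\<^sup>+w. g w * indicator (sq (vector [x, y]) L) (X w) \<partial>M) + (\<integral>\<^sup>+w. g w * indicator (sq (vector [x + L, y]) L) (X w) \<partial>M)
    + (\<integral>\<^sup>+w. g w * indicator (sq (vector [x, y + L]) L) (X w) \<partial>M) + (\<integral>\<^sup>+w. g w * indicator (sq (vector [x + L, y + L]) L) (X w) \<partial>M)"
proof -
  have m: "(\<lambda>w. g w * indicator (sq p L) (X w)) \<in> borel_measurable M" for p
    using g X by measurable
  show ?thesis unfolding indicator_sq_split[OF L] distrib_left
    by (subst nn_integral_add; (intro borel_measurable_add m)?)+ simp
qed

lemma square_split:
  assumes L: "L > 0"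
  shows "mass (sq (vector [x, y]) (2 * L)) = mass (sq (vector [x, y]) L) + mass (sq (vector [x + L, y]) L) + mass (sq (vector [x, y + L]) L) + mass (sq (vector [x + L, y + L]) L)"
    "kin (sq (vector [x, y]) (2 * L)) = kin (sq (vector [x, y]) L) + kin (sq (vector [x + L, y]) L) + kin (sq (vector [x, y + L]) L) + kin (sq (vector [x + L, y + L]) L)"
    "dens2 (sq (vector [x, y]) (2 * L)) = dens2 (sq (vector [x, y]) L) + dens2 (sq (vector [x + L, y]) L) + dens2 (sq (vector [x, y + L]) L) + dens2 (sq (vector [x + L, y + L]) L)"
  unfolding mass_def kin_def dens2_def sum.distrib[symmetric]
  by (intro sum.cong refl nn_integral_sq_split[OF L]; simp)+

text \<open>With two or more particles the total mass is at least \<open>2 l\<close>, so a large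
  square holds \<open>3/2 l\<close> and the covering applies with \<open>lam = l\<close> and
  \<open>\<kappa> = 1 / 24000\<close>. A single particle never reaches this threshold, but there the
  uncertainty bound suffices: its term \<open>m^2 / L^2\<close> disappears as the square
  grows.\<close>

lemma kinetic_bound:
  assumes N: "N \<ge> 1" and a: "alphaN \<alpha> N > 0"
    and l0: "(\<integral>\<^sup>+x. ennreal (Wf x) \<partial>cfgM N) = ennreal l" "l > 0" and T: "kin UNIV = ennreal T" "T \<ge> 0"
  shows "ennreal (alphaN \<alpha> N / (24000 * 120 * 54)) * (\<integral>\<^sup>+x. (rho N f x)\<^sup>2 \<partial>lborel) \<le> ennreal (l * T)"
proof -
  define a where "a = alphaN \<alpha> N"
  have a0: "a > 0" and a1: "a \<le> 1" using a alphaN_le_1 by (auto simp: a_def)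
  have massfin: "mass Q \<le> ennreal (N * l)" for Q
    using mass_mono[of Q UNIV] l0 by (simp add: mass_UNIV ennreal_of_nat_eq_real_of_nat ennreal_mult)
  have kinfin: "kin Q \<le> ennreal T" for Q using kin_mono[of Q UNIV] T by simp
  define m where "m x y L = enn2real (mass (sq (vector [x, y]) L))" for x y L
  define t where "t x y L = enn2real (kin (sq (vector [x, y]) L))" for x y L
  define s where "s x y L = enn2real (dens2 (sq (vector [x, y]) L))" for x y L
  have m: "mass (sq (vector [x, y]) L) = ennreal (m x y L)" for x y L
    unfolding m_def using massfin by (metis ennreal_enn2real_if ennreal_less_top leD top.not_eq_extremum)
  have t: "kin (sq (vector [x, y]) L) = ennreal (t x y L)" for x y L
    unfolding t_def using kinfin by (metis ennreal_enn2real_if ennreal_less_top leD top.not_eq_extremum)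
  have nn: "m x y L \<ge> 0" "t x y L \<ge> 0" "s x y L \<ge> 0" for x y L by (simp_all add: m_def t_def s_def)
  have mle: "m x y L \<le> N * l" for x y L
    using massfin[of "sq (vector [x, y]) L"] l0 by (simp add: m)
  have tle: "t x y L \<le> T" for x y L using kinfin[of "sq (vector [x, y]) L"] T by (simp add: t)
  have unc0: "dens2 (sq (vector [x, y]) L) \<le> ennreal (((1/L + \<eta>) * m x y L + (1/\<eta>) * t x y L)\<^sup>2)" if "L > 0" "\<eta> > 0" for x y L \<eta>
    using local_uncertainty[OF that, of "vector [x, y]"] that nn
    unfolding dens2_def[symmetric] m t
    by (simp add: ennreal_mult[symmetric] ennreal_plus[symmetric] ennreal_power del: ennreal_plus)
  have s: "dens2 (sq (vector [x, y]) L) = ennreal (s x y L)" if "L > 0" for x y L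
    unfolding s_def using unc0[OF that, of 1 x y] by (metis ennreal_enn2real_if ennreal_less_top leD top.not_eq_extremum zero_less_one)
  have unc: "s x y L \<le> 9 * ((m x y L)\<^sup>2 / L\<^sup>2 + m x y L * t x y L)" if "L > 0" for x y L
    by (rule uncertainty_optimise[OF that nn]) (use unc0[OF that] s[OF that] in simp)
  \<comment> \<open>Bounds the integral of the squared density over all squares at once: small ones
    lie in a square of side 1, and for sides at least 1 the term \<open>m^2 / L^2\<close> is
    harmless. Combined with Cauchy-Schwarz this gives the condition that stops the halving.\<close>
  define S where "S = 9 * ((N * l)\<^sup>2 + N * l * T)"
  have sS: "s x y L \<le> S" if L: "L > 0" for x y L
  proof -
    define L' where "L' = max L 1"
    have L': "L' > 0" "L \<le> L'" "L' \<ge> 1" by (auto simp: L'_def)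
    have "ennreal (s x y L) \<le> ennreal (s x y L')"
      using dens2_mono[OF sq_mono[OF L'(2), of "vector [x, y]"]] by (simp add: s[OF L] s[OF L'(1)])
    then have "s x y L \<le> s x y L'" by (simp add: nn)
    also have "\<dots> \<le> 9 * ((m x y L')\<^sup>2 / L'\<^sup>2 + m x y L' * t x y L')" by (rule unc[OF L'(1)])
    also have "\<dots> \<le> S" unfolding S_def
    proof (intro mult_left_mono add_mono mult_mono)
      have "(m x y L')\<^sup>2 / L'\<^sup>2 \<le> (m x y L')\<^sup>2 / 1" using L' by (intro divide_left_mono) (auto simp: one_le_power)
      also have "\<dots> \<le> (N * l)\<^sup>2" using mle[of x y L'] nn(1)[of x y L'] by (simp add: power_mono)
      finally show "(m x y L')\<^sup>2 / L'\<^sup>2 \<le> (N * l)\<^sup>2" .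
    qed (use mle tle nn l0 T in auto)
    finally show ?thesis .
  qed
  have cs: "(m x y L)\<^sup>2 \<le> L\<^sup>2 * S" if L: "L > 0" for x y L
  proof -
    let ?Q = "sq (vector [x, y]) L"
    \<comment> \<open>Cauchy-Schwarz as a family of Young inequalities; the choice
      \<open>\<theta> = m / L^2\<close> then yields \<open>m^2 <= L^2 s\<close>.\<close>
    have *: "2 * m x y L \<le> \<theta> * L\<^sup>2 + s x y L / \<theta>" if th: "\<theta> > 0" for \<theta>
    proof -
      have "2 * mass ?Q = (\<integral>\<^sup>+v. 2 * (rho N f v * indicator ?Q v) \<partial>lborel)"
        by (simp add: mass_eq nn_integral_cmult)
      also have "\<dots> \<le> (\<integral>\<^sup>+v. ennreal \<theta> * indicator ?Q v + ennreal (1/\<theta>) * ((rho N f v)\<^sup>2 * indicator ?Q v) \<partial>lborel)"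
      proof (intro nn_integral_mono)
        fix v
        have "2 * rho N f v \<le> ennreal \<theta> + ennreal (1/\<theta>) * (rho N f v)\<^sup>2"
        proof (cases "rho N f v" rule: ennreal_cases)
          case (real r)
          have "0 \<le> (\<theta> - r)\<^sup>2" by simp
          then have "2 * \<theta> * r \<le> \<theta> * \<theta> + r * r" by (simp add: power2_eq_square algebra_simps)
          then have "2 * r \<le> \<theta> + 1/\<theta> * r\<^sup>2" using th by (simp add: field_simps power2_eq_square)
          note le = ennreal_leI[OF this]
          have q: "ennreal (1/\<theta>) * ennreal (r\<^sup>2) = ennreal (r\<^sup>2 / \<theta>)" using th by (simp add: ennreal_mult[symmetric])
          show ?thesis using le real th by (simp add: ennreal_mult ennreal_power q)
        next
          case top then show ?thesis using th by (simp add: ennreal_mult_top power2_eq_square)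
        qed
        then show "2 * (rho N f v * indicator ?Q v) \<le> ennreal \<theta> * indicator ?Q v + ennreal (1/\<theta>) * ((rho N f v)\<^sup>2 * indicator ?Q v)"
          by (auto split: split_indicator)
      qed
      also have "\<dots> = ennreal \<theta> * ennreal (L\<^sup>2) + ennreal (1/\<theta>) * dens2 ?Q"
        unfolding dens2_def using L by (subst nn_integral_add) (auto simp: nn_integral_cmult emeasure_sq)
      finally have "ennreal 2 * ennreal (m x y L) \<le> ennreal \<theta> * ennreal (L\<^sup>2) + ennreal (1/\<theta>) * ennreal (s x y L)"
        by (simp add: m s[OF L])
      then show ?thesis using th nn
        by (simp add: ennreal_mult[symmetric] ennreal_plus[symmetric] del: ennreal_plus ennreal_numeral)
    qed
    have "(m x y L)\<^sup>2 \<le> L\<^sup>2 * s x y L"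
    proof (cases "m x y L = 0")
      case False
      then have mp: "m x y L > 0" using nn(1)[of x y L] by simp
      have "2 * m x y L \<le> m x y L / L\<^sup>2 * L\<^sup>2 + s x y L / (m x y L / L\<^sup>2)"
        using mp L by (intro *) auto
      then have "m x y L \<le> s x y L * L\<^sup>2 / m x y L" using L by simp
      then show ?thesis using mp by (simp add: field_simps power2_eq_square)
    qed (use nn in simp)
    also have "\<dots> \<le> L\<^sup>2 * S" using sS[OF L] by (intro mult_left_mono) auto
    finally show ?thesis .
  qed
  have excl: "(1/24000) * a * (m x y L - l) \<le> L\<^sup>2 * t x y L" if L: "L > 0" for x y L
  proof -
    have "ennreal (m x y L) \<le> ennreal l + ennreal (24000 * L\<^sup>2 / a) * ennreal (t x y L)"
      using local_exclusion[OF a L, of "vector [x, y]"] unfolding m t l0 a_def .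
    then have "m x y L \<le> l + 24000 * L\<^sup>2 / a * t x y L"
      using l0 a0 nn by (simp add: ennreal_mult[symmetric] ennreal_plus[symmetric] del: ennreal_plus)
    then show ?thesis using a0 by (simp add: field_simps)
  qed
  have split: "m x y (2 * L) = m x y L + m (x + L) y L + m x (y + L) L + m (x + L) (y + L) L"
    "t x y (2 * L) = t x y L + t (x + L) y L + t x (y + L) L + t (x + L) (y + L) L"
    "s x y (2 * L) = s x y L + s (x + L) y L + s x (y + L) L + s (x + L) (y + L) L" if L: "L > 0" for x y L
  proof -
    have L2: "2 * L > 0" using L by simp
    show "m x y (2 * L) = m x y L + m (x + L) y L + m x (y + L) L + m (x + L) (y + L) L"
      using square_split(1)[OF L, of x y] nn unfolding m by (simp add: ennreal_plus[symmetric] del: ennreal_plus)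
    show "t x y (2 * L) = t x y L + t (x + L) y L + t x (y + L) L + t (x + L) (y + L) L"
      using square_split(2)[OF L, of x y] nn unfolding t by (simp add: ennreal_plus[symmetric] del: ennreal_plus)
    show "s x y (2 * L) = s x y L + s (x + L) y L + s x (y + L) L + s (x + L) (y + L) L"
      using square_split(3)[OF L, of x y] nn unfolding s[OF L] s[OF L2] by (simp add: ennreal_plus[symmetric] del: ennreal_plus)
  qed
  define Q where "Q n = sq (vector [- real n, - real n]) (2 * real n)" for n
  have Qmono: "Q n \<subseteq> Q n'" if "n \<le> n'" for n n' using that by (auto simp: Q_def mem_sq)
  have Qsup: "(SUP n. indicator (Q n) v :: ennreal) = 1" for v
  proof (rule antisym)
    obtain n where n: "\<bar>v$1\<bar> < real n" "\<bar>v$2\<bar> < real n"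
      using reals_Archimedean2[of "max \<bar>v$1\<bar> \<bar>v$2\<bar>"] by (auto simp: max_less_iff_conj)
    then have "v \<in> Q n" by (auto simp: Q_def mem_sq)
    then show "1 \<le> (SUP n. indicator (Q n) v :: ennreal)" by (intro SUP_upper2[of n]) auto
  qed (auto intro!: SUP_least split: split_indicator)
  have [measurable]: "Q n \<in> sets borel" for n unfolding Q_def by measurable
  have mct: "(\<integral>\<^sup>+v. g v \<partial>lborel) = (SUP n. \<integral>\<^sup>+v. g v * indicator (Q n) v \<partial>lborel)"
    if [measurable]: "g \<in> borel_measurable borel" for g :: "real^2 \<Rightarrow> ennreal"
  proof -
    have inc: "incseq (\<lambda>n v. g v * indicator (Q n) v)"
      using Qmono by (auto simp: incseq_def le_fun_def intro!: mult_left_mono split: split_indicator)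
    have "(\<integral>\<^sup>+v. g v \<partial>lborel) = (\<integral>\<^sup>+v. (SUP n. g v * indicator (Q n) v) \<partial>lborel)"
      by (simp add: SUP_mult_left_ennreal[symmetric] Qsup)
    also have "\<dots> = (SUP n. \<integral>\<^sup>+v. g v * indicator (Q n) v \<partial>lborel)"
      by (rule nn_integral_monotone_convergence_SUP[OF inc])
         (use that in \<open>auto intro!: borel_measurable_times_ennreal borel_measurable_indicator\<close>)
    finally show ?thesis .
  qed
  define c where "c = a / (24000 * 120 * 54)"
  have c0: "c > 0" using a0 by (simp add: c_def)
  \<comment> \<open>The slack \<open>e\<close> serves the case of one particle, whose error
    \<open>m^2 / L^2\<close> vanishes only in the limit of large squares.\<close>
  have bound: "\<exists>n0. \<forall>n\<ge>n0. ennreal c * dens2 (Q n) \<le> ennreal (l * T + e)" if e: "e > 0" for e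
  proof (cases "N = 1")
    case True
    obtain n0 where n0: "real n0 > 9 * l\<^sup>2 / e + 1" using reals_Archimedean2 by blast
    have "ennreal c * dens2 (Q n) \<le> ennreal (l * T + e)" if n: "n \<ge> n0" for n
    proof -
      have n1: "real n > 9 * l\<^sup>2 / e + 1" using n n0 by linarith
      have "9 * l\<^sup>2 / e \<ge> 0" using e by simp
      then have np: "real n > 1" using n1 by linarith
      let ?x = "- real n" and ?L = "2 * real n"
      have L: "?L > 0" using np by simp
      have "s ?x ?x ?L \<le> 9 * ((m ?x ?x ?L)\<^sup>2 / ?L\<^sup>2 + m ?x ?x ?L * t ?x ?x ?L)" by (rule unc[OF L])
      also have "\<dots> \<le> 9 * (l\<^sup>2 / real n + l * T)"
      proof (intro mult_left_mono add_mono mult_mono)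
        have "(m ?x ?x ?L)\<^sup>2 \<le> l\<^sup>2" using mle[of ?x ?x ?L] nn(1)[of ?x ?x ?L] True by (simp add: power_mono)
        moreover have "real n \<le> ?L\<^sup>2"
        proof -
          have "1 * real n \<le> real n * real n" using np by (intro mult_right_mono) auto
          then show ?thesis using np by (simp add: power2_eq_square)
        qed
        ultimately show "(m ?x ?x ?L)\<^sup>2 / ?L\<^sup>2 \<le> l\<^sup>2 / real n" using np by (intro frac_le) auto
      qed (use mle[of ?x ?x ?L] tle nn l0 T True in auto)
      also have "\<dots> \<le> 9 * l * T + e"
      proof -
        have "9 * l\<^sup>2 / e \<le> real n" using n1 by linarith
        then have "9 * l\<^sup>2 / real n \<le> e" using e np by (simp add: field_simps)
        then show ?thesis by simp
      qed
      finally have "c * s ?x ?x ?L \<le> c * (9 * l * T + e)" using c0 by (intro mult_left_mono) auto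
      also have "\<dots> = (9 * c) * (l * T) + c * e" by (simp add: algebra_simps)
      also have "\<dots> \<le> 1 * (l * T) + 1 * e"
        using a0 a1 l0 T e by (intro add_mono mult_right_mono) (auto simp: c_def)
      finally have "ennreal (c * s ?x ?x ?L) \<le> ennreal (l * T + e)" by (intro ennreal_leI) simp
      then show ?thesis unfolding Q_def s[OF L] using c0 nn by (simp add: ennreal_mult)
    qed
    then show ?thesis by blast
  next
    case False
    then have N2: "real N \<ge> 2" using N by simp
    have "ennreal (3/2 * l) < mass UNIV"
      using N2 l0 by (simp add: mass_UNIV ennreal_of_nat_eq_real_of_nat ennreal_mult[symmetric] ennreal_less_iff)
    also have "mass UNIV = (SUP n. mass (Q n))"
      using mct[of "rho N f"] by (simp add: mass_eq)
    finally obtain n0 where n0: "ennreal (3/2 * l) < mass (Q n0)" by (auto simp: less_SUP_iff)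
    have "ennreal c * dens2 (Q n) \<le> ennreal (l * T + e)" if n: "n \<ge> Suc n0" for n
    proof -
      let ?x = "- real n" and ?L = "2 * real n"
      have L: "?L > 0" using n by simp
      have "ennreal (3/2 * l) < mass (Q n)" using n0 mass_mono[OF Qmono[of n0 n]] n by (metis Suc_leD order_less_le_trans)
      then have big: "m ?x ?x ?L \<ge> 3/2 * l" unfolding Q_def m using l0 nn by (simp add: ennreal_less_iff)
      have "1/24000 / 120 * a / (54 * l) * s ?x ?x ?L + 24 * (1/24000 / 120 * a * l / ?L\<^sup>2) \<le> t ?x ?x ?L"
        by (rule dyadic_covering[where m=m and s=s and t=t and S=S]) (use a0 a1 l0 nn split unc excl cs L big in auto)
      moreover have "0 \<le> 24 * (1/24000 / 120 * a * l / ?L\<^sup>2)" using a0 l0 by simp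
      ultimately have "1/24000 / 120 * a / (54 * l) * s ?x ?x ?L \<le> T" using tle[of ?x ?x ?L] by linarith
      then have "c * s ?x ?x ?L \<le> l * T" using l0 by (simp add: c_def field_simps)
      then have "ennreal (c * s ?x ?x ?L) \<le> ennreal (l * T + e)" using e by (intro ennreal_leI) simp
      then show ?thesis unfolding Q_def s[OF L] using c0 nn by (simp add: ennreal_mult)
    qed
    then show ?thesis by blast
  qed
  have "ennreal c * (\<integral>\<^sup>+x. (rho N f x)\<^sup>2 \<partial>lborel) = (SUP n. ennreal c * dens2 (Q n))"
    unfolding dens2_def by (subst mct) (auto simp: SUP_mult_left_ennreal)
  also have "\<dots> \<le> ennreal (l * T)"
  proof (rule SUP_least)
    fix n
    show "ennreal c * dens2 (Q n) \<le> ennreal (l * T)"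
    proof (rule ennreal_le_epsilon)
      fix e :: real assume "e > 0"
      from bound[OF this] obtain n0 where n0: "\<And>n. n \<ge> n0 \<Longrightarrow> ennreal c * dens2 (Q n) \<le> ennreal (l * T + e)" by auto
      have "ennreal c * dens2 (Q n) \<le> ennreal c * dens2 (Q (max n n0))"
        by (intro mult_left_mono dens2_mono Qmono) auto
      also have "\<dots> \<le> ennreal (l * T + e)" by (rule n0) simp
      finally show "ennreal c * dens2 (Q n) \<le> ennreal (l * T) + ennreal e"
        using l0 T \<open>e > 0\<close> by (simp add: ennreal_plus)
    qed
  qed
  finally show ?thesis by (simp add: c_def a_def)
qed

end

section \<open>The first zero of the derivative of a Bessel function\<close>

text \<open>Coefficients of \<open>BesselJ \<nu>\<close> in the variable
  \<open>y = (x / 2)^2\<close>, after the factor \<open>(x / 2) powr \<nu>\<close> is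
  removed.\<close>

definition bessel_coeff :: "real \<Rightarrow> nat \<Rightarrow> real" where
  "bessel_coeff \<nu> m = (-1) ^ m / (fact m * Gamma (real m + \<nu> + 1))"

lemma Gamma_shift:
  assumes "\<nu> > 0"
  shows "Gamma (real (Suc m) + \<nu> + 1) = (real m + \<nu> + 1) * Gamma (real m + \<nu> + 1)"
proof -
  have "real m + \<nu> + 1 > 0" using assms by simp
  then have "real m + \<nu> + 1 \<notin> \<int>\<^sub>\<le>\<^sub>0" by (auto elim!: nonpos_Ints_cases)
  from Gamma_plus1[OF this] show ?thesis by (simp add: add_ac)
qed

text \<open>Each recursion step multiplies \<open>Gamma\<close> by \<open>m + \<nu> + 1\<close>,
  which is at least 1, so the exponential series dominates.\<close>

lemma summable_bessel_coeff:
  assumes "\<nu> > 0"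
  shows "summable (\<lambda>m. bessel_coeff \<nu> m * y ^ m)"
proof (rule summable_comparison_test')
  have G: "Gamma (\<nu> + 1) \<le> Gamma (real m + \<nu> + 1)" for m
  proof (induction m)
    case (Suc m)
    have "Gamma (real (Suc m) + \<nu> + 1) = (real m + \<nu> + 1) * Gamma (real m + \<nu> + 1)"
      by (rule Gamma_shift[OF assms])
    moreover have "1 * Gamma (real m + \<nu> + 1) \<le> (real m + \<nu> + 1) * Gamma (real m + \<nu> + 1)"
      using assms by (intro mult_right_mono less_imp_le[OF Gamma_real_pos]) auto
    ultimately show ?case using Suc by simp
  qed simp
  show "summable (\<lambda>m. (1 / Gamma (\<nu> + 1)) * (inverse (fact m) * \<bar>y\<bar> ^ m))"
    by (intro summable_mult summable_exp)
  fix m :: nat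
  have G0: "Gamma (\<nu> + 1) > 0" using assms by (intro Gamma_real_pos) auto
  have "norm (bessel_coeff \<nu> m * y ^ m) = \<bar>y\<bar> ^ m / (fact m * Gamma (real m + \<nu> + 1))"
    using assms by (simp add: bessel_coeff_def abs_mult power_abs less_imp_le[OF Gamma_real_pos])
  also have "\<dots> \<le> \<bar>y\<bar> ^ m / (fact m * Gamma (\<nu> + 1))"
    using G[of m] G0 by (intro divide_left_mono mult_left_mono mult_pos_pos) auto
  finally show "norm (bessel_coeff \<nu> m * y ^ m) \<le> (1 / Gamma (\<nu> + 1)) * (inverse (fact m) * \<bar>y\<bar> ^ m)"
    by (simp add: divide_inverse mult_ac)
qed

text \<open>With \<open>y = (x / 2)^2\<close> and \<open>x > 0\<close>, the derivative of
  \<open>BesselJ \<nu>\<close> at \<open>x\<close> is a positive factor times \<open>k y\<close>. As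
  \<open>k\<close> changes sign on \<open>[0, \<nu>]\<close>, there is a critical point with
  \<open>x^2 <= 4 \<nu>\<close>, and the infimum of all positive critical points lies at or below
  it.\<close>

lemma jprime_bounds:
  assumes nu: "0 < \<nu>" "\<nu> \<le> 1"
  shows "0 \<le> jprime \<nu>" "(jprime \<nu>)\<^sup>2 \<le> 4 * \<nu>"
proof -
  let ?c = "bessel_coeff \<nu>"
  define g where "g y = (\<Sum>m. ?c m * y ^ m)" for y
  define g' where "g' y = (\<Sum>m. diffs ?c m * y ^ m)" for y
  note sm = summable_bessel_coeff[OF nu(1)]
  have sd: "summable (\<lambda>m. diffs ?c m * y ^ m)" for y
    by (rule termdiff_converges_all[OF sm])
  have dg: "(g has_real_derivative g' y) (at y)" for y
    unfolding g_def[abs_def] g'_def by (rule termdiffs_strong_converges_everywhere[OF sm])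
  have dg': "(g' has_real_derivative (\<Sum>m. diffs (diffs ?c) m * y ^ m)) (at y)" for y
    unfolding g'_def[abs_def] by (rule termdiffs_strong_converges_everywhere[OF sd])
  define k where "k y = \<nu> * g y + 2 * y * g' y" for y
  have contk: "isCont k y" for y
    unfolding k_def by (intro continuous_intros DERIV_isCont[OF dg] DERIV_isCont[OF dg'])
  have ksum: "(\<lambda>m. (\<nu> + 2 * real m) * ?c m * y ^ m) sums k y" for y
  proof -
    have 1: "(\<lambda>m. ?c m * y ^ m) sums g y" unfolding g_def by (rule summable_sums[OF sm])
    have "(\<lambda>m. of_nat m * ?c m * y ^ (m - Suc 0)) sums g' y"
      unfolding g'_def by (rule diffs_equiv[OF sd])
    from sums_add[OF sums_mult[OF 1, of \<nu>] sums_mult[OF this, of "2 * y"]]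
    have "(\<lambda>m. \<nu> * (?c m * y ^ m) + 2 * y * (real m * ?c m * y ^ (m - Suc 0))) sums k y"
      by (simp add: k_def)
    moreover have "\<nu> * (?c m * y ^ m) + 2 * y * (real m * ?c m * y ^ (m - Suc 0)) = (\<nu> + 2 * real m) * ?c m * y ^ m" for m
      by (cases m) (auto simp: algebra_simps)
    ultimately show ?thesis by simp
  qed
  have Gp: "Gamma (real m + \<nu> + 1) > 0" for m using nu by (intro Gamma_real_pos) auto
  have GS: "Gamma (real (Suc m) + \<nu> + 1) = (real m + \<nu> + 1) * Gamma (real m + \<nu> + 1)" for m
    by (rule Gamma_shift[OF nu(1)])
  have "g 0 = ?c 0" unfolding g_def by (rule powser_zero)
  then have k0: "k 0 > 0" using Gp[of 0] nu by (simp add: k_def bessel_coeff_def)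
  define b where "b m = (\<nu> + 2 * real m) * \<nu> ^ m / (fact m * Gamma (real m + \<nu> + 1))" for m
  have bc: "(\<nu> + 2 * real m) * ?c m * \<nu> ^ m = (-1) ^ m * b m" for m
    by (simp add: b_def bessel_coeff_def)
  have kb: "(\<lambda>m. (-1) ^ m * b m) sums k \<nu>" using ksum[of \<nu>] unfolding bc .
  have b0: "b m \<ge> 0" for m using nu Gp[of m] by (simp add: b_def)
  \<comment> \<open>The decrease starts only at \<open>m = 1\<close>: in fact
    \<open>b 1 > b 0\<close>, and this is what makes \<open>k \<nu>\<close> negative.\<close>
  have bdec: "b (Suc m) \<le> b m" if "m \<ge> 1" for m
  proof -
    have "(\<nu> + 2 * real (Suc m)) * \<nu> \<le> (\<nu> + 2 * real m) * ((real m + 1) * (real m + \<nu> + 1))"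
    proof -
      have "(\<nu> + 2 * real (Suc m)) * \<nu> \<le> (\<nu> + 2 * real (Suc m)) * 1" using nu by (intro mult_left_mono) auto
      also have "\<dots> \<le> (\<nu> + 2 * real m) * 2" using that nu by simp
      also have "\<dots> \<le> (\<nu> + 2 * real m) * ((real m + 1) * (real m + \<nu> + 1))"
      proof (intro mult_left_mono)
        have "(1 + 1) * 1 \<le> (real m + 1) * (real m + \<nu> + 1)" using that nu by (intro mult_mono) auto
        then show "2 \<le> (real m + 1) * (real m + \<nu> + 1)" by simp
      qed (use nu in auto)
      finally show ?thesis .
    qed
    then have "(\<nu> + 2 * real (Suc m)) * \<nu> * (\<nu> ^ m / (fact (Suc m) * Gamma (real (Suc m) + \<nu> + 1)))
       \<le> (\<nu> + 2 * real m) * ((real m + 1) * (real m + \<nu> + 1)) * (\<nu> ^ m / (fact (Suc m) * Gamma (real (Suc m) + \<nu> + 1)))"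
      using nu Gp[of "Suc m"] by (intro mult_right_mono) auto
    also have "\<dots> = b m"
    proof -
      have nz: "real m + 1 \<noteq> 0" "real m + \<nu> + 1 \<noteq> 0" "Gamma (real m + \<nu> + 1) \<noteq> 0"
        using nu less_imp_neq[OF Gp[of m]] by auto
      have f: "(fact (Suc m) :: real) = (real m + 1) * fact m" by simp
      have "x * (p * q) * (w / ((p * F) * (q * G))) = x * w / (F * G)" if "p \<noteq> 0" "q \<noteq> 0" for x p q w F G :: real
        using that by simp
      then show ?thesis unfolding b_def GS f using nz by blast
    qed
    finally show ?thesis by (simp add: b_def mult_ac)
  qed
  have kneg: "k \<nu> < 0"
  proof -
    have sb: "summable (\<lambda>m. (-1) ^ m * b m)" using kb by (rule sums_summable)
    have bl: "b \<longlonglongrightarrow> 0"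
    proof -
      have "(\<lambda>m. \<bar>(-1) ^ m * b m\<bar>) \<longlonglongrightarrow> 0" using summable_LIMSEQ_zero[OF sb] by (rule tendsto_rabs_zero)
      then show ?thesis using b0 by (simp add: abs_mult power_abs)
    qed
    have "k \<nu> = (\<Sum>m. (-1) ^ (m + 2) * b (m + 2)) + (\<Sum>m<2. (-1) ^ m * b m)"
      using suminf_split_initial_segment[OF sb, of 2] sums_unique[OF kb] by simp
    also have "(\<Sum>m. (-1) ^ (m + 2) * b (m + 2)) = (\<Sum>m. (-1) ^ m * b (m + 2))" by simp
    \<comment> \<open>By the Leibniz criterion the decreasing alternating tail is at most its first
      term, so \<open>b 0 - b 1 + b 2\<close> remains.\<close>
    also have "\<dots> \<le> b 2"
      using summable_Leibniz'(4)[of "\<lambda>m. b (m + 2)" 0] bl b0 bdec LIMSEQ_ignore_initial_segment[OF bl, of 2]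
      by (simp add: numeral_2_eq_2)
    also have "b 2 + (\<Sum>m<2. (-1) ^ m * b m) < 0"
    proof -
      define G0 where "G0 = Gamma (\<nu> + 1)"
      have G0: "G0 > 0" using Gp[of 0] by (simp add: G0_def)
      have g1: "Gamma (real 1 + \<nu> + 1) = (\<nu> + 1) * G0" using GS[of 0] by (simp add: G0_def)
      have g2: "Gamma (real 2 + \<nu> + 1) = (\<nu> + 2) * ((\<nu> + 1) * G0)" using GS[of 1] g1 by (simp add: numeral_2_eq_2 add_ac)
      have e0: "b 0 = \<nu> / G0" by (simp add: b_def G0_def)
      have e1: "b 1 = (\<nu> + 2) * \<nu> / ((\<nu> + 1) * G0)" using g1 by (simp add: b_def)
      have e2: "b 2 = (\<nu> + 4) * \<nu>\<^sup>2 / (2 * ((\<nu> + 2) * ((\<nu> + 1) * G0)))" using g2 by (simp add: b_def fact_numeral)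
      have "\<nu> * \<nu> \<le> 1 * 1" using nu by (intro mult_mono) auto
      then have q: "\<nu> * (\<nu> + 4) < 2 * (\<nu> + 2)" using nu by (simp add: algebra_simps)
      \<comment> \<open>The difference \<open>b 0 - b 1\<close> is exactly
        \<open>- \<nu> / (G0 * (\<nu> + 1))\<close>, and \<open>\<nu> <= 1\<close> makes
        \<open>b 2\<close> smaller than its modulus.\<close>
      have e: "b 2 + b 0 - b 1 = \<nu> / (G0 * (\<nu> + 1)) * (\<nu> * (\<nu> + 4) / (2 * (\<nu> + 2)) - 1)"
        unfolding e0 e1 e2 using G0 nu by (simp add: divide_simps) (simp add: power2_eq_square algebra_simps)
      have "\<nu> * (\<nu> + 4) / (2 * (\<nu> + 2)) - 1 < 0" using q nu by simp
      moreover have "\<nu> / (G0 * (\<nu> + 1)) > 0" using G0 nu by simp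
      ultimately have "b 2 + b 0 - b 1 < 0" unfolding e by (rule mult_pos_neg[rotated])
      then show ?thesis by (simp add: numeral_2_eq_2)
    qed
    finally show ?thesis by simp
  qed
  obtain y where y: "0 \<le> y" "y \<le> \<nu>" "k y = 0"
    using IVT2[of k \<nu> 0 0] contk k0 kneg nu by auto
  have yp: "y > 0" using y k0 by (cases "y = 0") auto
  define x where "x = 2 * sqrt y"
  have xp: "x > 0" and x2: "(x / 2)\<^sup>2 = y" and xle: "x\<^sup>2 \<le> 4 * \<nu>" using yp y by (auto simp: x_def power_mult_distrib)
  have "(BesselJ \<nu> has_real_derivative 0) (at x)"
  proof -
    have J: "BesselJ \<nu> u = (u / 2) powr \<nu> * g ((u / 2)\<^sup>2)" for u
      by (simp add: BesselJ_def g_def bessel_coeff_def power_mult)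
    have d2: "((\<lambda>u. g ((u / 2)\<^sup>2)) has_real_derivative g' y * (x / 2)) (at x)"
    proof -
      have "((\<lambda>u. (u / 2)\<^sup>2) has_real_derivative x / 2) (at x)"
        by (auto intro!: derivative_eq_intros)
      from DERIV_chain2[where f=g and g="\<lambda>u. (u / 2)\<^sup>2", OF dg this] show ?thesis by (simp only: x2)
    qed
    have d1: "((\<lambda>u. (u / 2) powr \<nu>) has_real_derivative \<nu> * (x / 2) powr (\<nu> - 1) / 2) (at x)"
      using xp by (auto intro!: derivative_eq_intros)
    have p: "(x / 2) powr \<nu> = (x / 2) powr (\<nu> - 1) * (x / 2)"
      using xp by (simp add: powr_diff)
    have "\<nu> * (x / 2) powr (\<nu> - 1) / 2 * g ((x / 2)\<^sup>2) + g' y * (x / 2) * (x / 2) powr \<nu> = (x / 2) powr (\<nu> - 1) / 2 * k y"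
      unfolding k_def p x2 using x2 by (simp add: power2_eq_square algebra_simps)
    with DERIV_mult[OF d1 d2] y(3) show ?thesis unfolding J[abs_def] by simp
  qed
  then have mem: "x \<in> {x. x > 0 \<and> deriv (BesselJ \<nu>) x = 0}" using xp DERIV_imp_deriv by auto
  have bd: "bdd_below {x. x > 0 \<and> deriv (BesselJ \<nu>) x = 0}" by (auto intro!: bdd_belowI[where m=0])
  have j: "jprime \<nu> = Inf {x. x > 0 \<and> deriv (BesselJ \<nu>) x = 0}" using nu by (simp add: jprime_def)
  show j0: "0 \<le> jprime \<nu>" unfolding j using mem by (intro cInf_greatest) auto
  have "jprime \<nu> \<le> x" unfolding j by (rule cInf_lower[OF mem bd])
  then have "(jprime \<nu>)\<^sup>2 \<le> x\<^sup>2" using j0 by (intro power_mono)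
  with xle show "(jprime \<nu>)\<^sup>2 \<le> 4 * \<nu>" by linarith
qed

section \<open>Passage to the closure\<close>

text \<open>The factor \<open>1 + e\<close> in place of 2 keeps the constant intact as
  \<open>e\<close> tends to 0.\<close>

lemma norm_sq_le_eps:
  fixes u v :: "'a::real_normed_vector"
  assumes "e > 0"
  shows "(norm u)\<^sup>2 \<le> (1 + e) * (norm v)\<^sup>2 + (1 + 1/e) * (norm (u - v))\<^sup>2"
proof -
  define p q where "p = norm v" and "q = norm (u - v)"
  have "norm u \<le> p + q" using norm_triangle_ineq[of v "u - v"] by (simp add: p_def q_def)
  then have "(norm u)\<^sup>2 \<le> (p + q)\<^sup>2" by (intro power_mono) auto
  also have "\<dots> \<le> (1 + e) * p\<^sup>2 + (1 + 1/e) * q\<^sup>2"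
  proof -
    have "0 \<le> (e * p - q)\<^sup>2" by simp
    then have "2 * e * (p * q) \<le> e\<^sup>2 * p\<^sup>2 + q\<^sup>2" by (simp add: power2_diff power_mult_distrib algebra_simps)
    then have "2 * (p * q) \<le> e * p\<^sup>2 + q\<^sup>2 / e" using assms by (simp add: field_simps power2_eq_square)
    then show ?thesis by (simp add: power2_sum algebra_simps)
  qed
  finally show ?thesis by (simp add: p_def q_def)
qed

lemma nn_integral_norm_sq_le_eps:
  fixes u v :: "'b \<Rightarrow> complex"
  assumes e: "e > 0" and [measurable]: "u \<in> borel_measurable M" "v \<in> borel_measurable M" "h \<in> borel_measurable M"
  shows "(\<integral>\<^sup>+x. ennreal ((cmod (u x))\<^sup>2) * h x \<partial>M) \<le> ennreal (1 + e) * (\<integral>\<^sup>+x. ennreal ((cmod (v x))\<^sup>2) * h x \<partial>M)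
     + ennreal (1 + 1/e) * (\<integral>\<^sup>+x. ennreal ((cmod (u x - v x))\<^sup>2) * h x \<partial>M)"
proof -
  have "(\<integral>\<^sup>+x. ennreal ((cmod (u x))\<^sup>2) * h x \<partial>M) \<le> (\<integral>\<^sup>+x. ennreal (1 + e) * (ennreal ((cmod (v x))\<^sup>2) * h x) + ennreal (1 + 1/e) * (ennreal ((cmod (u x - v x))\<^sup>2) * h x) \<partial>M)"
  proof (intro nn_integral_mono)
    fix x
    have "ennreal ((cmod (u x))\<^sup>2) \<le> ennreal ((1 + e) * (cmod (v x))\<^sup>2 + (1 + 1/e) * (cmod (u x - v x))\<^sup>2)"
      by (intro ennreal_leI norm_sq_le_eps e)
    also have "\<dots> = ennreal (1 + e) * ennreal ((cmod (v x))\<^sup>2) + ennreal (1 + 1/e) * ennreal ((cmod (u x - v x))\<^sup>2)"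
      using e by (simp only: ennreal_plus ennreal_mult mult_nonneg_nonneg add_nonneg_nonneg zero_le_power2 zero_le_one less_imp_le zero_le_divide_1_iff)
    finally have "ennreal ((cmod (u x))\<^sup>2) * h x \<le> (ennreal (1 + e) * ennreal ((cmod (v x))\<^sup>2) + ennreal (1 + 1/e) * ennreal ((cmod (u x - v x))\<^sup>2)) * h x"
      by (rule mult_right_mono) simp
    then show "ennreal ((cmod (u x))\<^sup>2) * h x \<le> ennreal (1 + e) * (ennreal ((cmod (v x))\<^sup>2) * h x) + ennreal (1 + 1/e) * (ennreal ((cmod (u x - v x))\<^sup>2) * h x)"
      by (simp only: distrib_right mult.assoc)
  qed
  also have "\<dots> = ennreal (1 + e) * (\<integral>\<^sup>+x. ennreal ((cmod (v x))\<^sup>2) * h x \<partial>M)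
     + ennreal (1 + 1/e) * (\<integral>\<^sup>+x. ennreal ((cmod (u x - v x))\<^sup>2) * h x \<partial>M)"
  proof -
    have m: "(\<lambda>x. ennreal ((cmod (v x))\<^sup>2) * h x) \<in> borel_measurable M"
      "(\<lambda>x. ennreal ((cmod (u x - v x))\<^sup>2) * h x) \<in> borel_measurable M" by measurable
    then show ?thesis
      by (simp only: nn_integral_add borel_measurable_times_ennreal borel_measurable_const nn_integral_cmult)
  qed
  finally show ?thesis .
qed

text \<open>Serves both the duality argument for the closure and the potential energy.\<close>

lemma nn_integral_rho:
  assumes P: "\<Psi> \<in> borel_measurable (cfgM N)" and V: "V \<in> borel_measurable borel"
  shows "(\<integral>\<^sup>+x. rho N \<Psi> x * V x \<partial>lborel) = (\<Sum>j<N. \<integral>\<^sup>+x. ennreal ((cmod (\<Psi> x))\<^sup>2) * V (x j) \<partial>cfgM N)"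
proof -
  let ?g = "\<lambda>x. ennreal ((cmod (\<Psi> x))\<^sup>2)"
  have g: "?g \<in> borel_measurable (cfgM N)" using P by measurable
  have m: "(\<lambda>x. marg N j ?g x * V x) \<in> borel_measurable lborel" if "j < N" for j
    using measurable_marg[OF that g] V by simp
  have "rho N \<Psi> x * V x = (\<Sum>j<N. marg N j ?g x * V x)" for x
    by (simp add: rho_def marg_def sum_distrib_right)
  then have "(\<integral>\<^sup>+x. rho N \<Psi> x * V x \<partial>lborel) = (\<Sum>j<N. \<integral>\<^sup>+x. marg N j ?g x * V x \<partial>lborel)"
    by (subst nn_integral_sum[symmetric]) (use m in auto)
  also have "\<dots> = (\<Sum>j<N. \<integral>\<^sup>+x. ?g x * V (x j) \<partial>cfgM N)"
    by (intro sum.cong refl nn_integral_marg[symmetric] g V) simp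
  finally show ?thesis .
qed

text \<open>The weight \<open>1 / (4 * c)\<close> is the source of the relation
  \<open>C' = 1 / (4 C)\<close> between the two constants of the theorem.\<close>

lemma ennreal_young:
  fixes r w :: ennreal
  assumes "c > 0"
  shows "r * w \<le> ennreal c * r\<^sup>2 + ennreal (1 / (4 * c)) * w\<^sup>2"
proof -
  consider "r = \<top>" "w = 0" | "r = 0" | "r = \<top>" "w \<noteq> 0" | "r \<noteq> 0" "w = \<top>" | "r \<noteq> \<top>" "w \<noteq> \<top>" by blast
  then show ?thesis
  proof cases
    case 5
    then obtain r' w' where rw: "r = ennreal r'" "w = ennreal w'" "r' \<ge> 0" "w' \<ge> 0"
      by (metis ennreal_cases)
    have "0 \<le> (2 * c * r' - w')\<^sup>2" by simp
    then have "4 * c * (r' * w') \<le> 4 * c\<^sup>2 * r'\<^sup>2 + w'\<^sup>2" by (simp add: power2_diff power_mult_distrib algebra_simps)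
    then have "r' * w' \<le> c * r'\<^sup>2 + 1 / (4 * c) * w'\<^sup>2" using assms by (simp add: field_simps power2_eq_square)
    from ennreal_leI[OF this] show ?thesis
      unfolding rw ennreal_power[OF rw(3)] ennreal_power[OF rw(4)] using rw(3,4) assms
      by (simp only: ennreal_plus ennreal_mult mult_nonneg_nonneg less_imp_le zero_le_power2 zero_le_divide_1_iff zero_le_numeral)
  qed (use assms in \<open>auto simp: ennreal_mult_top power2_eq_square ennreal_top_mult\<close>)
qed

text \<open>Convergence of the wave functions controls the densities only in the mean, so the
  integral of the squared density is reached by duality: \<open>rho N \<Psi>\<close> is tested
  against its own truncation \<open>V n\<close>. As \<open>V n\<close> is bounded, the error
  vanishes in the limit; as its square integral is finite, it can be absorbed. Fatou's lemma removes
  the truncation.\<close>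

lemma closure_bound:
  fixes \<Psi> :: "(nat \<Rightarrow> real^2) \<Rightarrow> complex" and G :: "nat \<Rightarrow> 2 \<Rightarrow> (nat \<Rightarrow> real^2) \<Rightarrow> complex"
  assumes N: "N \<ge> 1" and a: "alphaN \<alpha> N > 0"
    and P: "\<Psi> \<in> borel_measurable (cfgM N)" and G: "\<And>j c. G j c \<in> borel_measurable (cfgM N)"
    and test: "\<And>k. \<Phi> k \<in> test_sym N"
    and conv: "(\<lambda>k. \<integral>\<^sup>+x. ennreal ((cmod (\<Phi> k x - \<Psi> x))\<^sup>2) \<partial>cfgM N) \<longlonglongrightarrow> 0"
    and convD: "\<And>j. j < N \<Longrightarrow> (\<lambda>k. \<integral>\<^sup>+x. (\<Sum>c\<in>UNIV. ennreal ((cmod (Dop \<alpha> N j c (\<Phi> k) x - G j c x))\<^sup>2)) \<partial>cfgM N) \<longlonglongrightarrow> 0"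
    and nrm: "(\<integral>\<^sup>+x. ennreal ((cmod (\<Psi> x))\<^sup>2) \<partial>cfgM N) = 1"
  shows "ennreal (alphaN \<alpha> N / (24000 * 120 * 54)) * (\<integral>\<^sup>+x. (rho N \<Psi> x)\<^sup>2 \<partial>lborel)
    \<le> (\<Sum>j<N. \<integral>\<^sup>+x. (\<Sum>c\<in>UNIV. ennreal ((cmod (G j c x))\<^sup>2)) \<partial>cfgM N)"
proof (cases "(\<Sum>j<N. \<integral>\<^sup>+x. (\<Sum>c\<in>UNIV. ennreal ((cmod (G j c x))\<^sup>2)) \<partial>cfgM N)" rule: ennreal_cases)
  case (real t)
  define b where "b = alphaN \<alpha> N / (24000 * 120 * 54)"
  have b: "b > 0" using a by (simp add: b_def)
  define \<delta> where "\<delta> k = (\<integral>\<^sup>+x. ennreal ((cmod (\<Phi> k x - \<Psi> x))\<^sup>2) \<partial>cfgM N)" for k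
  define \<gamma> where "\<gamma> k = (\<Sum>j<N. \<integral>\<^sup>+x. (\<Sum>c\<in>UNIV. ennreal ((cmod (Dop \<alpha> N j c (\<Phi> k) x - G j c x))\<^sup>2)) \<partial>cfgM N)" for k
  have g0: "\<gamma> \<longlonglongrightarrow> 0"
    unfolding \<gamma>_def[abs_def] using tendsto_sum[of "{..<N}", OF convD] by simp
  have d0: "\<delta> \<longlonglongrightarrow> 0" unfolding \<delta>_def[abs_def] by (rule conv)
  have rm [measurable]: "rho N \<Psi> \<in> borel_measurable borel" by (rule borel_measurable_rho[OF P])
  define V where "V n x = min (rho N \<Psi> x) (of_nat n)" for n :: nat and x
  have Vm [measurable]: "V n \<in> borel_measurable borel" for n unfolding V_def by measurable
  have main: "(\<integral>\<^sup>+x. (V n x)\<^sup>2 \<partial>lborel) \<le> ennreal (t / b)" for n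
  proof -
    have vle: "(\<integral>\<^sup>+x. (V n x)\<^sup>2 \<partial>lborel) \<le> (\<integral>\<^sup>+x. rho N \<Psi> x * V n x \<partial>lborel)"
      by (intro nn_integral_mono) (auto simp: V_def power2_eq_square intro!: mult_right_mono)
    have "(\<integral>\<^sup>+x. rho N \<Psi> x * V n x \<partial>lborel) \<le> (\<integral>\<^sup>+x. rho N \<Psi> x * of_nat n \<partial>lborel)"
      by (intro nn_integral_mono mult_left_mono) (auto simp: V_def)
    also have "\<dots> = of_nat N * of_nat n"
    proof -
      have "(\<lambda>x. ennreal ((cmod (\<Psi> x))\<^sup>2)) \<in> borel_measurable (cfgM N)" using P by measurable
      then have "(\<integral>\<^sup>+x. ennreal ((cmod (\<Psi> x))\<^sup>2) * of_nat n \<partial>cfgM N) = of_nat n"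
        by (simp add: nn_integral_multc nrm)
      then show ?thesis by (subst nn_integral_rho[OF P]) auto
    qed
    also have "\<dots> < \<top>" by (simp add: ennreal_of_nat_eq_real_of_nat ennreal_mult[symmetric])
    finally have "(\<integral>\<^sup>+x. (V n x)\<^sup>2 \<partial>lborel) < \<top>" using vle by simp
    then obtain v where v: "(\<integral>\<^sup>+x. (V n x)\<^sup>2 \<partial>lborel) = ennreal v" "v \<ge> 0" by (metis ennreal_cases less_irrefl)
    \<comment> \<open>Young's inequality for \<open>rho N (\<Phi> k)\<close> against
      \<open>V n\<close> yields half of the kinetic bound plus half of \<open>v\<close>. As
      \<open>e\<close> tends to 0 this becomes \<open>v <= (t / b + v) / 2\<close>.\<close>
    have step: "v \<le> (1 + e) / 2 * ((1 + 2 * e) * ((1 + e) * t + e) / b + v) + e" if e: "0 < e" "e < 1" for e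
    proof -
      define w where "w = 1 + 1/e"
      have w: "w > 0" using e by (simp add: w_def add_pos_pos)
      \<comment> \<open>Small enough to keep below \<open>e\<close> both the errors in norm and
        energy, of size \<open>w * \<mu>\<close>, and the error of the tested density, which is
        \<open>N * n\<close> times as large.\<close>
      define \<mu> where "\<mu> = e / (w * (1 + real N * real n))"
      have mu: "\<mu> > 0" using e w by (simp add: \<mu>_def add_pos_nonneg)
      have mu1: "w * \<mu> \<le> e" and mu2: "w * (real N * real n) * \<mu> \<le> e"
      proof -
        define q where "q = real N * real n"
        have q: "q \<ge> 0" by (simp add: q_def)
        have "w * \<mu> = e / (1 + q)" using w by (simp add: \<mu>_def q_def)
        also have "\<dots> \<le> e" using e q by (simp add: field_simps)
        finally show "w * \<mu> \<le> e" .
        have "w * q * \<mu> = e * (q / (1 + q))" using w by (simp add: \<mu>_def q_def)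
        also have "\<dots> \<le> e * 1" using e q by (intro mult_left_mono) auto
        finally show "w * (real N * real n) * \<mu> \<le> e" by (simp add: q_def)
      qed
      have "\<forall>\<^sub>F k in sequentially. \<delta> k < ennreal \<mu> \<and> \<gamma> k < ennreal \<mu>"
        using order_tendstoD(2)[OF d0, of "ennreal \<mu>"] order_tendstoD(2)[OF g0, of "ennreal \<mu>"] mu
        by (intro eventually_conj) auto
      then obtain k where k: "\<delta> k < ennreal \<mu>" "\<gamma> k < ennreal \<mu>"
        using eventually_happens'[OF sequentially_bot] by blast
      interpret A: anyon_fn N \<alpha> "\<Phi> k" by (rule anyon_fn_test_sym[OF test])
      have wd: "ennreal w * \<delta> k \<le> ennreal e" "ennreal w * \<gamma> k \<le> ennreal e"
      proof -
        have "ennreal w * x \<le> ennreal e" if "x < ennreal \<mu>" for x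
        proof -
          have "ennreal w * x \<le> ennreal w * ennreal \<mu>" using that by (intro mult_left_mono) auto
          also have "\<dots> = ennreal (w * \<mu>)" using w mu by (simp add: ennreal_mult)
          also have "\<dots> \<le> ennreal e" by (rule ennreal_leI[OF mu1])
          finally show ?thesis .
        qed
        then show "ennreal w * \<delta> k \<le> ennreal e" "ennreal w * \<gamma> k \<le> ennreal e" using k by auto
      qed
      have dsym: "(\<integral>\<^sup>+x. ennreal ((cmod (\<Psi> x - \<Phi> k x))\<^sup>2) \<partial>cfgM N) = \<delta> k"
        unfolding \<delta>_def by (simp add: norm_minus_commute)
      have "(\<integral>\<^sup>+x. ennreal (A.Wf x) \<partial>cfgM N) \<le> ennreal (1 + e) * 1 + ennreal w * \<delta> k"
        using nn_integral_norm_sq_le_eps[OF e(1) A.meas_f P, of "\<lambda>_. 1"]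
        unfolding w_def[symmetric] by (simp add: A.Wf_def nrm \<delta>_def)
      also have "\<dots> \<le> ennreal (1 + e) * 1 + ennreal e" by (intro add_left_mono wd)
      also have "\<dots> = ennreal (1 + 2 * e)"
        using e by (simp add: ennreal_plus[symmetric] del: ennreal_plus)
      finally have l1: "(\<integral>\<^sup>+x. ennreal (A.Wf x) \<partial>cfgM N) \<le> ennreal (1 + 2 * e)" .
      then obtain l where l: "(\<integral>\<^sup>+x. ennreal (A.Wf x) \<partial>cfgM N) = ennreal l" "l \<ge> 0"
        by (metis ennreal_cases ennreal_less_top leD)
      have lle: "l \<le> 1 + 2 * e" using l1 l e by (simp del: ennreal_plus)
      have "ennreal 1 \<le> ennreal (1 + e) * ennreal l + ennreal w * \<delta> k"
        using nn_integral_norm_sq_le_eps[OF e(1) P A.meas_f, of "\<lambda>_. 1"] l(1)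
        unfolding w_def[symmetric] by (simp add: A.Wf_def nrm dsym)
      also have "\<dots> \<le> ennreal (1 + e) * ennreal l + ennreal e" by (intro add_left_mono wd)
      also have "\<dots> = ennreal ((1 + e) * l + e)" using e l by (simp add: ennreal_mult)
      finally have "1 \<le> (1 + e) * l + e" using e l by (simp del: ennreal_plus ennreal_1)
      \<comment> \<open>Because \<open>e < 1\<close>, the norm of the approximant cannot vanish, as
        the kinetic bound demands.\<close>
      then have lpos: "l > 0" using e l by (cases "l = 0") auto
      have kinle: "A.kin UNIV \<le> ennreal ((1 + e) * t + e)"
      proof -
        have m: "Dop \<alpha> N j c (\<Phi> k) \<in> borel_measurable (cfgM N)" if "j < N" for j c by (rule A.meas_Dop[OF that])
        have sc: "(\<integral>\<^sup>+x. (\<Sum>c\<in>UNIV. ennreal ((cmod (u c x))\<^sup>2)) \<partial>cfgM N) = (\<Sum>c\<in>UNIV. \<integral>\<^sup>+x. ennreal ((cmod (u c x))\<^sup>2) \<partial>cfgM N)"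
          if "\<And>c. u c \<in> borel_measurable (cfgM N)" for u :: "2 \<Rightarrow> (nat \<Rightarrow> real^2) \<Rightarrow> complex"
          using that by (intro nn_integral_sum) measurable
        have "A.kin UNIV = (\<Sum>j<N. \<Sum>c\<in>UNIV. \<integral>\<^sup>+x. ennreal ((cmod (Dop \<alpha> N j c (\<Phi> k) x))\<^sup>2) \<partial>cfgM N)"
          unfolding A.kin_def
        proof (intro sum.cong refl)
          fix j assume "j \<in> {..<N}"
          then have j: "j < N" by simp
          have "ennreal (A.En j x) = (\<Sum>c\<in>UNIV. ennreal ((cmod (Dop \<alpha> N j c (\<Phi> k) x))\<^sup>2))" for x
            unfolding A.En_def by (rule sum_ennreal[symmetric]) simp
          then show "(\<integral>\<^sup>+x. ennreal (A.En j x) * indicator UNIV (x j) \<partial>cfgM N) = (\<Sum>c\<in>UNIV. \<integral>\<^sup>+x. ennreal ((cmod (Dop \<alpha> N j c (\<Phi> k) x))\<^sup>2) \<partial>cfgM N)"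
            by (simp only: sc[OF m[OF j]] indicator_UNIV mult_1_right)
        qed
        also have "\<dots> \<le> (\<Sum>j<N. \<Sum>c\<in>UNIV. ennreal (1 + e) * (\<integral>\<^sup>+x. ennreal ((cmod (G j c x))\<^sup>2) \<partial>cfgM N)
           + ennreal w * (\<integral>\<^sup>+x. ennreal ((cmod (Dop \<alpha> N j c (\<Phi> k) x - G j c x))\<^sup>2) \<partial>cfgM N))"
        proof (intro sum_mono)
          fix j c assume "j \<in> {..<N}"
          then have j: "j < N" by simp
          show "(\<integral>\<^sup>+x. ennreal ((cmod (Dop \<alpha> N j c (\<Phi> k) x))\<^sup>2) \<partial>cfgM N) \<le> ennreal (1 + e) * (\<integral>\<^sup>+x. ennreal ((cmod (G j c x))\<^sup>2) \<partial>cfgM N)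
           + ennreal w * (\<integral>\<^sup>+x. ennreal ((cmod (Dop \<alpha> N j c (\<Phi> k) x - G j c x))\<^sup>2) \<partial>cfgM N)"
            using nn_integral_norm_sq_le_eps[OF e(1) m[OF j, of c] G[of j c], of "\<lambda>_. 1"] unfolding w_def[symmetric] by simp
        qed
        also have "\<dots> = ennreal (1 + e) * (\<Sum>j<N. \<Sum>c\<in>UNIV. \<integral>\<^sup>+x. ennreal ((cmod (G j c x))\<^sup>2) \<partial>cfgM N)
           + ennreal w * (\<Sum>j<N. \<Sum>c\<in>UNIV. \<integral>\<^sup>+x. ennreal ((cmod (Dop \<alpha> N j c (\<Phi> k) x - G j c x))\<^sup>2) \<partial>cfgM N)"
          by (simp only: sum.distrib sum_distrib_left)
        also have "(\<Sum>j<N. \<Sum>c\<in>UNIV. \<integral>\<^sup>+x. ennreal ((cmod (G j c x))\<^sup>2) \<partial>cfgM N) = ennreal t"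
          unfolding real(2)[symmetric] by (intro sum.cong refl sc[symmetric] G)
        also have "(\<Sum>j<N. \<Sum>c\<in>UNIV. \<integral>\<^sup>+x. ennreal ((cmod (Dop \<alpha> N j c (\<Phi> k) x - G j c x))\<^sup>2) \<partial>cfgM N) = \<gamma> k"
          unfolding \<gamma>_def by (intro sum.cong refl sc[symmetric] borel_measurable_diff m G) simp
        also have "ennreal (1 + e) * ennreal t + ennreal w * \<gamma> k \<le> ennreal (1 + e) * ennreal t + ennreal e"
          by (intro add_left_mono wd)
        also have "\<dots> = ennreal ((1 + e) * t + e)" using e real(1) by (simp add: ennreal_mult)
        finally show ?thesis .
      qed
      then obtain T where T: "A.kin UNIV = ennreal T" "T \<ge> 0" by (metis ennreal_cases ennreal_less_top leD)
      have Tle: "T \<le> (1 + e) * t + e" using kinle T e real(1) by (simp del: ennreal_plus)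
      define R where "R = (\<integral>\<^sup>+x. (rho N (\<Phi> k) x)\<^sup>2 \<partial>lborel)"
      have bR: "ennreal b * R \<le> ennreal (l * T)"
        unfolding R_def b_def by (rule A.kinetic_bound[OF N a l(1) lpos T])
      have Rle: "R \<le> ennreal ((1 + 2 * e) * ((1 + e) * t + e) / b)"
      proof -
        have "R = ennreal (1 / b) * (ennreal b * R)"
          unfolding mult.assoc[symmetric] using b by (subst ennreal_mult[symmetric]) auto
        also have "\<dots> \<le> ennreal (1 / b) * ennreal (l * T)" by (rule mult_left_mono[OF bR]) simp
        also have "\<dots> = ennreal (1 / b * (l * T))" using b l T by (intro ennreal_mult[symmetric]) auto
        also have "\<dots> \<le> ennreal ((1 + 2 * e) * ((1 + e) * t + e) / b)"
        proof (rule ennreal_leI)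
          have "l * T \<le> (1 + 2 * e) * ((1 + e) * t + e)" using lle Tle e T by (intro mult_mono) auto
          then show "1 / b * (l * T) \<le> (1 + 2 * e) * ((1 + e) * t + e) / b" using b by (simp add: divide_right_mono)
        qed
        finally show ?thesis .
      qed
      have "ennreal v \<le> (\<integral>\<^sup>+x. rho N \<Psi> x * V n x \<partial>lborel)" using vle v by simp
      also have "\<dots> = (\<Sum>j<N. \<integral>\<^sup>+x. ennreal ((cmod (\<Psi> x))\<^sup>2) * V n (x j) \<partial>cfgM N)"
        by (rule nn_integral_rho[OF P Vm])
      also have "\<dots> \<le> (\<Sum>j<N. ennreal (1 + e) * (\<integral>\<^sup>+x. ennreal ((cmod (\<Phi> k x))\<^sup>2) * V n (x j) \<partial>cfgM N) + ennreal w * (of_nat n * \<delta> k))"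
      proof (intro sum_mono)
        fix j assume "j \<in> {..<N}"
        then have j: "j < N" by simp
        have h: "(\<lambda>x. V n (x j)) \<in> borel_measurable (cfgM N)"
          by (rule measurable_compose[OF measurable_cfgM_component[OF j] Vm])
        have "(\<integral>\<^sup>+x. ennreal ((cmod (\<Psi> x - \<Phi> k x))\<^sup>2) * V n (x j) \<partial>cfgM N) \<le> (\<integral>\<^sup>+x. of_nat n * ennreal ((cmod (\<Psi> x - \<Phi> k x))\<^sup>2) \<partial>cfgM N)"
          by (intro nn_integral_mono) (auto simp: V_def mult.commute[of _ "min _ _"] intro!: mult_right_mono)
        also have "\<dots> = of_nat n * \<delta> k"
          unfolding dsym[symmetric] using P A.meas_f by (intro nn_integral_cmult) measurable
        finally have d: "(\<integral>\<^sup>+x. ennreal ((cmod (\<Psi> x - \<Phi> k x))\<^sup>2) * V n (x j) \<partial>cfgM N) \<le> of_nat n * \<delta> k" .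
        show "(\<integral>\<^sup>+x. ennreal ((cmod (\<Psi> x))\<^sup>2) * V n (x j) \<partial>cfgM N) \<le>
          ennreal (1 + e) * (\<integral>\<^sup>+x. ennreal ((cmod (\<Phi> k x))\<^sup>2) * V n (x j) \<partial>cfgM N) + ennreal w * (of_nat n * \<delta> k)"
          using nn_integral_norm_sq_le_eps[OF e(1) P A.meas_f h] unfolding w_def[symmetric]
          by (rule order_trans) (intro add_left_mono mult_left_mono d, simp)
      qed
      also have "\<dots> = ennreal (1 + e) * (\<integral>\<^sup>+x. rho N (\<Phi> k) x * V n x \<partial>lborel) + of_nat N * (ennreal w * (of_nat n * \<delta> k))"
        by (simp add: sum.distrib sum_distrib_left nn_integral_rho[OF A.meas_f Vm])
      also have "of_nat N * (ennreal w * (of_nat n * \<delta> k)) \<le> ennreal e"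
      proof -
        have "of_nat N * (ennreal w * (of_nat n * \<delta> k)) \<le> of_nat N * (ennreal w * (of_nat n * ennreal \<mu>))"
          using k by (intro mult_left_mono) auto
        also have "\<dots> = ennreal (w * (real N * real n) * \<mu>)"
          using w mu by (simp add: ennreal_of_nat_eq_real_of_nat ennreal_mult[symmetric] mult_ac)
        also have "\<dots> \<le> ennreal e" by (rule ennreal_leI[OF mu2])
        finally show ?thesis .
      qed
      also have "(\<integral>\<^sup>+x. rho N (\<Phi> k) x * V n x \<partial>lborel) \<le> ennreal (1/2) * R + ennreal (1/2) * ennreal v"
      proof -
        have "(\<integral>\<^sup>+x. rho N (\<Phi> k) x * V n x \<partial>lborel) \<le> (\<integral>\<^sup>+x. ennreal (1/2) * (rho N (\<Phi> k) x)\<^sup>2 + ennreal (1/2) * (V n x)\<^sup>2 \<partial>lborel)"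
          using ennreal_young[of "1/2"] by (intro nn_integral_mono) simp
        also have "\<dots> = ennreal (1/2) * R + ennreal (1/2) * ennreal v"
          unfolding R_def v(1)[symmetric] using A.measurable_rho Vm[of n]
          by (subst nn_integral_add) (auto simp: nn_integral_cmult)
        finally show ?thesis .
      qed
      also have "ennreal (1/2) * R + ennreal (1/2) * ennreal v \<le> ennreal (1/2) * ennreal ((1 + 2 * e) * ((1 + e) * t + e) / b) + ennreal (1/2) * ennreal v"
        by (intro add_right_mono mult_left_mono Rle) simp
      finally have fin: "ennreal v \<le> ennreal (1 + e) * (ennreal (1/2) * ennreal ((1 + 2 * e) * ((1 + e) * t + e) / b) + ennreal (1/2) * ennreal v) + ennreal e"
        by (simp add: add_mono mult_left_mono)
      define K where "K = (1 + 2 * e) * ((1 + e) * t + e) / b"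
      have K: "K \<ge> 0" using e b real(1) by (simp add: K_def)
      have "ennreal (1 + e) * (ennreal (1/2) * ennreal K + ennreal (1/2) * ennreal v) + ennreal e = ennreal ((1 + e) * (1/2 * K + 1/2 * v) + e)"
      proof -
        have "ennreal p * (ennreal h * ennreal K + ennreal h * ennreal v) + ennreal e = ennreal (p * (h * K + h * v) + e)"
          if "p \<ge> 0" "h \<ge> 0" for p h
          using that e v K by (simp add: ennreal_mult[symmetric] ennreal_plus[symmetric] del: ennreal_plus)
        from this[of "1 + e" "1/2"] e show ?thesis by simp
      qed
      with fin have "v \<le> (1 + e) * (1/2 * K + 1/2 * v) + e"
        unfolding K_def[symmetric] using e K v by (simp del: ennreal_plus)
      then show ?thesis unfolding K_def[symmetric] by (simp add: field_simps)
    qed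
    have "v \<le> (1 + 0) / 2 * ((1 + 2 * 0) * ((1 + 0) * t + 0) / b + v) + 0"
    proof (rule tendsto_lowerbound)
      show "((\<lambda>e. (1 + e) / 2 * ((1 + 2 * e) * ((1 + e) * t + e) / b + v) + e) \<longlongrightarrow> (1 + 0) / 2 * ((1 + 2 * 0) * ((1 + 0) * t + 0) / b + v) + 0) (at_right 0)"
        using b by (intro tendsto_intros) auto
      show "\<forall>\<^sub>F e in at_right 0. v \<le> (1 + e) / 2 * ((1 + 2 * e) * ((1 + e) * t + e) / b + v) + e"
        unfolding eventually_at_right_field by (intro exI[of _ 1]) (use step in auto)
    qed simp
    then have "v \<le> t / b" by simp
    then show ?thesis unfolding v by (rule ennreal_leI)
  qed
  have lim: "(\<lambda>n. (V n x)\<^sup>2) \<longlonglongrightarrow> (rho N \<Psi> x)\<^sup>2" for x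
  proof -
    have "(\<lambda>n. V n x) \<longlonglongrightarrow> min (rho N \<Psi> x) \<top>"
      unfolding V_def using of_nat_tendsto_top_ennreal by (intro tendsto_min tendsto_const)
    then have "(\<lambda>n. V n x) \<longlonglongrightarrow> rho N \<Psi> x" by simp
    from tendsto_mult_ennreal[OF this this] show ?thesis by (auto simp: power2_eq_square)
  qed
  have "(\<integral>\<^sup>+x. (rho N \<Psi> x)\<^sup>2 \<partial>lborel) = (\<integral>\<^sup>+x. liminf (\<lambda>n. (V n x)\<^sup>2) \<partial>lborel)"
    by (intro nn_integral_cong) (metis lim lim_imp_Liminf sequentially_bot)
  also have "\<dots> \<le> liminf (\<lambda>n. \<integral>\<^sup>+x. (V n x)\<^sup>2 \<partial>lborel)"
    by (rule nn_integral_liminf) (use Vm in simp)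
  also have "\<dots> \<le> ennreal (t / b)"
    by (intro Liminf_le always_eventually allI main) simp
  finally have "ennreal b * (\<integral>\<^sup>+x. (rho N \<Psi> x)\<^sup>2 \<partial>lborel) \<le> ennreal b * ennreal (t / b)" by (intro mult_left_mono) auto
  also have "\<dots> = ennreal t" using b real(1) by (simp add: ennreal_mult[symmetric])
  finally show ?thesis unfolding real(2) b_def .
next
  case top
  show ?thesis unfolding top by (rule top_greatest)
qed

text \<open>Membership in the closure is expressed by an approximating sequence
  \<open>\<Phi>\<close>; \<open>G j\<close> is the limit of the covariant derivatives, so
  \<open>T\<close> is the closed quadratic form. Positive and negative parts of the potential energy
  stand on opposite sides, so that no difference of infinities can occur.\<close>

theorem theorem1p6:
  "\<exists>C::real. C > 0 \<and>
    (\<forall>(\<alpha>::real) (N::nat) (\<Psi>::(nat \<Rightarrow> real^2) \<Rightarrow> complex)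
       (G::nat \<Rightarrow> 2 \<Rightarrow> (nat \<Rightarrow> real^2) \<Rightarrow> complex)
       (\<Phi>::nat \<Rightarrow> (nat \<Rightarrow> real^2) \<Rightarrow> complex).
      N \<ge> 1 \<longrightarrow>
      \<Psi> \<in> borel_measurable (cfgM N) \<longrightarrow>
      (\<forall>j c. G j c \<in> borel_measurable (cfgM N)) \<longrightarrow>
      (\<forall>k. \<Phi> k \<in> test_sym N) \<longrightarrow>
      (\<lambda>k. \<integral>\<^sup>+ x. ennreal ((cmod (\<Phi> k x - \<Psi> x))\<^sup>2) \<partial>cfgM N) \<longlonglongrightarrow> 0 \<longrightarrow>
      (\<forall>j<N. (\<lambda>k. \<integral>\<^sup>+ x. (\<Sum>c\<in>UNIV. ennreal ((cmod (Dop \<alpha> N j c (\<Phi> k) x - G j c x))\<^sup>2)) \<partial>cfgM N)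
                \<longlonglongrightarrow> 0) \<longrightarrow>
      (\<integral>\<^sup>+ x. ennreal ((cmod (\<Psi> x))\<^sup>2) \<partial>cfgM N) = 1 \<longrightarrow>
      (let T = (\<Sum>j<N. \<integral>\<^sup>+ x. (\<Sum>c\<in>UNIV. ennreal ((cmod (G j c x))\<^sup>2)) \<partial>cfgM N);
           jp = jprime (alphaN \<alpha> N)
       in T \<ge> ennreal (C * jp\<^sup>2) * (\<integral>\<^sup>+ x. (rho N \<Psi> x)\<^sup>2 \<partial>lborel) \<and>
          (\<forall>V::real^2 \<Rightarrow> real. V \<in> borel_measurable lborel \<longrightarrow>
             T + (\<integral>\<^sup>+ x. ennreal (max (\<Sum>j<N. V (x j)) 0 * (cmod (\<Psi> x))\<^sup>2) \<partial>cfgM N)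
               + ennreal (1 / (4 * C)) * inverse (ennreal (jp\<^sup>2))
                   * (\<integral>\<^sup>+ y. ennreal ((max (- V y) 0)\<^sup>2) \<partial>lborel)
             \<ge> (\<integral>\<^sup>+ x. ennreal (max (- (\<Sum>j<N. V (x j))) 0 * (cmod (\<Psi> x))\<^sup>2) \<partial>cfgM N))))"
proof (intro exI[of _ "1 / (24000 * 120 * 54 * 4)"] conjI allI impI)
  define C :: real where "C = 1 / (24000 * 120 * 54 * 4)"
  have C: "C > 0" by (simp add: C_def)
  show "(1 :: real) / (24000 * 120 * 54 * 4) > 0" by simp
  fix \<alpha> :: real and N :: nat and \<Psi> :: "(nat \<Rightarrow> real^2) \<Rightarrow> complex"
    and G :: "nat \<Rightarrow> 2 \<Rightarrow> (nat \<Rightarrow> real^2) \<Rightarrow> complex" and \<Phi> :: "nat \<Rightarrow> (nat \<Rightarrow> real^2) \<Rightarrow> complex"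
  assume N: "1 \<le> N" and P: "\<Psi> \<in> borel_measurable (cfgM N)"
    and G: "\<forall>j c. G j c \<in> borel_measurable (cfgM N)" and test: "\<forall>k. \<Phi> k \<in> test_sym N"
    and conv: "(\<lambda>k. \<integral>\<^sup>+x. ennreal ((cmod (\<Phi> k x - \<Psi> x))\<^sup>2) \<partial>cfgM N) \<longlonglongrightarrow> 0"
    and convD: "\<forall>j<N. (\<lambda>k. \<integral>\<^sup>+x. (\<Sum>c\<in>UNIV. ennreal ((cmod (Dop \<alpha> N j c (\<Phi> k) x - G j c x))\<^sup>2)) \<partial>cfgM N) \<longlonglongrightarrow> 0"
    and nrm: "(\<integral>\<^sup>+x. ennreal ((cmod (\<Psi> x))\<^sup>2) \<partial>cfgM N) = 1"
  define T where "T = (\<Sum>j<N. \<integral>\<^sup>+x. (\<Sum>c\<in>UNIV. ennreal ((cmod (G j c x))\<^sup>2)) \<partial>cfgM N)"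
  define jp where "jp = jprime (alphaN \<alpha> N)"
  define R where "R = (\<integral>\<^sup>+x. (rho N \<Psi> x)\<^sup>2 \<partial>lborel)"
  have rm [measurable]: "rho N \<Psi> \<in> borel_measurable borel" by (rule borel_measurable_rho[OF P])
  have first: "ennreal (C * jp\<^sup>2) * R \<le> T"
  proof (cases "alphaN \<alpha> N = 0")
    case True
    then show ?thesis by (simp add: jp_def jprime_def)
  next
    case False
    then have a: "alphaN \<alpha> N > 0" using alphaN_nonneg[of \<alpha> N] by simp
    have "C * jp\<^sup>2 \<le> C * (4 * alphaN \<alpha> N)"
      unfolding jp_def using C by (intro mult_left_mono jprime_bounds(2) a alphaN_le_1) simp
    also have "\<dots> = alphaN \<alpha> N / (24000 * 120 * 54)" by (simp add: C_def)
    finally have "ennreal (C * jp\<^sup>2) * R \<le> ennreal (alphaN \<alpha> N / (24000 * 120 * 54)) * R"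
      by (intro mult_right_mono ennreal_leI) auto
    also have "\<dots> \<le> T"
      unfolding R_def T_def by (rule closure_bound[OF N a P _ _ conv _ nrm]) (use G test convD in auto)
    finally show ?thesis .
  qed
  have second: "(\<integral>\<^sup>+x. ennreal (max (- (\<Sum>j<N. V (x j))) 0 * (cmod (\<Psi> x))\<^sup>2) \<partial>cfgM N) \<le>
     T + (\<integral>\<^sup>+x. ennreal (max (\<Sum>j<N. V (x j)) 0 * (cmod (\<Psi> x))\<^sup>2) \<partial>cfgM N)
       + ennreal (1 / (4 * C)) * inverse (ennreal (jp\<^sup>2)) * (\<integral>\<^sup>+y. ennreal ((max (- V y) 0)\<^sup>2) \<partial>lborel)"
    if V: "V \<in> borel_measurable lborel" for V :: "real^2 \<Rightarrow> real"
  proof -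
    have [measurable]: "V \<in> borel_measurable borel" using V by simp
    define U where "U y = ennreal (max (- V y) 0)" for y
    have U [measurable]: "U \<in> borel_measurable borel" unfolding U_def by measurable
    have U2: "(\<integral>\<^sup>+y. ennreal ((max (- V y) 0)\<^sup>2) \<partial>lborel) = (\<integral>\<^sup>+y. (U y)\<^sup>2 \<partial>lborel)"
      unfolding U_def by (intro nn_integral_cong ennreal_power[symmetric]) simp
    have "(\<integral>\<^sup>+x. ennreal (max (- (\<Sum>j<N. V (x j))) 0 * (cmod (\<Psi> x))\<^sup>2) \<partial>cfgM N)
      \<le> (\<integral>\<^sup>+x. (\<Sum>j<N. ennreal ((cmod (\<Psi> x))\<^sup>2) * U (x j)) \<partial>cfgM N)"
    proof (intro nn_integral_mono)
      fix x
      have "max (- (\<Sum>j<N. V (x j))) 0 \<le> (\<Sum>j<N. max (- V (x j)) 0)"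
        by (auto simp: sum_negf[symmetric] intro!: sum_mono sum_nonneg)
      then have "max (- (\<Sum>j<N. V (x j))) 0 * (cmod (\<Psi> x))\<^sup>2 \<le> (\<Sum>j<N. (cmod (\<Psi> x))\<^sup>2 * max (- V (x j)) 0)"
        unfolding sum_distrib_left[symmetric] by (subst (2) mult.commute) (intro mult_right_mono, auto)
      then have "ennreal (max (- (\<Sum>j<N. V (x j))) 0 * (cmod (\<Psi> x))\<^sup>2) \<le> ennreal (\<Sum>j<N. (cmod (\<Psi> x))\<^sup>2 * max (- V (x j)) 0)"
        by (rule ennreal_leI)
      also have "\<dots> = (\<Sum>j<N. ennreal ((cmod (\<Psi> x))\<^sup>2) * U (x j))"
        unfolding U_def by (subst sum_ennreal[symmetric]) (auto simp: ennreal_mult)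
      finally show "ennreal (max (- (\<Sum>j<N. V (x j))) 0 * (cmod (\<Psi> x))\<^sup>2) \<le> (\<Sum>j<N. ennreal ((cmod (\<Psi> x))\<^sup>2) * U (x j))" .
    qed
    also have "\<dots> = (\<Sum>j<N. \<integral>\<^sup>+x. ennreal ((cmod (\<Psi> x))\<^sup>2) * U (x j) \<partial>cfgM N)"
    proof (rule nn_integral_sum)
      fix j assume "j \<in> {..<N}"
      then have j: "j < N" by simp
      have "(\<lambda>x. U (x j)) \<in> borel_measurable (cfgM N)"
        by (rule measurable_compose[OF measurable_cfgM_component[OF j] U])
      then show "(\<lambda>x. ennreal ((cmod (\<Psi> x))\<^sup>2) * U (x j)) \<in> borel_measurable (cfgM N)" using P by measurable
    qed
    also have "\<dots> = (\<integral>\<^sup>+y. rho N \<Psi> y * U y \<partial>lborel)" by (rule nn_integral_rho[OF P U, symmetric])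
    also have "\<dots> \<le> T + ennreal (1 / (4 * C)) * inverse (ennreal (jp\<^sup>2)) * (\<integral>\<^sup>+y. (U y)\<^sup>2 \<partial>lborel)"
    \<comment> \<open>For \<open>jp = 0\<close> the inverse is infinite, so there is something to
      show only if the negative part of \<open>V\<close> vanishes almost everywhere.\<close>
    proof (cases "jp = 0")
      case True
      show ?thesis
      proof (cases "(\<integral>\<^sup>+y. (U y)\<^sup>2 \<partial>lborel) = 0")
        case zero: True
        then have "AE y in lborel. (U y)\<^sup>2 = 0" by (subst (asm) nn_integral_0_iff_AE) auto
        then have "AE y in lborel. rho N \<Psi> y * U y = 0" by eventually_elim simp
        then have "(\<integral>\<^sup>+y. rho N \<Psi> y * U y \<partial>lborel) = 0" by (subst nn_integral_0_iff_AE) auto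
        then show ?thesis by simp
      next
        case False
        then show ?thesis using True C by (simp add: ennreal_mult_top ennreal_top_mult)
      qed
    next
      case False
      \<comment> \<open>With this weight the quadratic term in Young's inequality is exactly the
        left side of the first inequality.\<close>
      define c where "c = C * jp\<^sup>2"
      have c: "c > 0" using C False by (simp add: c_def)
      have "(\<integral>\<^sup>+y. rho N \<Psi> y * U y \<partial>lborel) \<le> (\<integral>\<^sup>+y. ennreal c * (rho N \<Psi> y)\<^sup>2 + ennreal (1 / (4 * c)) * (U y)\<^sup>2 \<partial>lborel)"
        by (intro nn_integral_mono ennreal_young c)
      also have "\<dots> = ennreal c * R + ennreal (1 / (4 * c)) * (\<integral>\<^sup>+y. (U y)\<^sup>2 \<partial>lborel)"
        unfolding R_def by (subst nn_integral_add) (auto simp: nn_integral_cmult)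
      also have "\<dots> \<le> T + ennreal (1 / (4 * c)) * (\<integral>\<^sup>+y. (U y)\<^sup>2 \<partial>lborel)"
        unfolding c_def by (intro add_right_mono first)
      also have "ennreal (1 / (4 * c)) = ennreal (1 / (4 * C)) * inverse (ennreal (jp\<^sup>2))"
      proof -
        have i: "inverse (ennreal (jp\<^sup>2)) = ennreal (inverse (jp\<^sup>2))" using False by (intro inverse_ennreal) simp
        have e: "1 / (4 * c) = 1 / (4 * C) * inverse (jp\<^sup>2)" by (simp add: c_def field_simps)
        show ?thesis unfolding i e using C by (intro ennreal_mult) auto
      qed
      finally show ?thesis .
    qed
    also have "\<dots> \<le> T + (\<integral>\<^sup>+x. ennreal (max (\<Sum>j<N. V (x j)) 0 * (cmod (\<Psi> x))\<^sup>2) \<partial>cfgM N)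
       + ennreal (1 / (4 * C)) * inverse (ennreal (jp\<^sup>2)) * (\<integral>\<^sup>+y. (U y)\<^sup>2 \<partial>lborel)"
      by (intro add_right_mono add_increasing2) auto
    finally show ?thesis unfolding U2 .
  qed
  show "let T = \<Sum>j<N. \<integral>\<^sup>+x. (\<Sum>c\<in>UNIV. ennreal ((cmod (G j c x))\<^sup>2)) \<partial>cfgM N; jp = jprime (alphaN \<alpha> N)
    in T \<ge> ennreal (1 / (24000 * 120 * 54 * 4) * jp\<^sup>2) * (\<integral>\<^sup>+x. (rho N \<Psi> x)\<^sup>2 \<partial>lborel) \<and>
          (\<forall>V::real^2 \<Rightarrow> real. V \<in> borel_measurable lborel \<longrightarrow>
             T + (\<integral>\<^sup>+ x. ennreal (max (\<Sum>j<N. V (x j)) 0 * (cmod (\<Psi> x))\<^sup>2) \<partial>cfgM N)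
               + ennreal (1 / (4 * (1 / (24000 * 120 * 54 * 4)))) * inverse (ennreal (jp\<^sup>2))
                   * (\<integral>\<^sup>+ y. ennreal ((max (- V y) 0)\<^sup>2) \<partial>lborel)
             \<ge> (\<integral>\<^sup>+ x. ennreal (max (- (\<Sum>j<N. V (x j))) 0 * (cmod (\<Psi> x))\<^sup>2) \<partial>cfgM N))"
    unfolding Let_def T_def[symmetric] jp_def[symmetric] R_def[symmetric] C_def[symmetric]
    by (intro conjI allI impI first second)
qed

end
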